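(* Let $p$ be a prime, let $f\in\mathcal B$, let $y\in\mathbb Z_p$, and let $r$ be an integer with $r\ge1$ (i.e. $p^{-r}<1$) if $p>3$, and $r\ge2$ (i.e. $p^{-r}<\frac1p$) if $p\le3$. Then $f$ is ergodic on the sphere $S_{p^{-r}}(y)$ if and only if one of the following alternatives holds: (1) $p$ is odd, and simultaneously $f(y)\equiv y\pmod{p^{r+1}}$ and $f'(y)$ generates the whole group of units $(\mathbb Z/p^2\mathbb Z)^\ast$ modulo $p^2$; (2) $p=2$, and simultaneously $f(y)\equiv y\pmod{2^{r+1}}$, $f(y)\not\equiv y\pmod{2^{r+2}}$, and $f'(y)\equiv1\pmod4$.
   Context: $\mathcal B$ is the class of functions $f\colon\mathbb Z_p\to\mathbb Z_p$ of the form $f(x)=\sum_{i=0}^\infty a_i\binom{x}{i}$ with $\frac{a_i}{i!}\in\mathbb Z_p$ for all $i$; equivalently $f(x)=\sum_{i\ge0}b_i\,x(x-1)\cdots(x-i+1)$ with $b_i\in\mathbb Z_p$. Such functions are known to be Lipschitz with constant $1$ and differentiable, with $f'\in\mathcal B$. $S_{p^{-r}}(y)=\{z\in\mathbb Z_p:\|z-y\|_p=p^{-r}\}$. $\hat\mu_p$ is the restriction to the sphere of the Haar measure on $\mathbb Z_p$, normalized so that the sphere has measure $1$. A function $f$ is ergodic on $S_{p^{-r}}(y)$ if $f(S_{p^{-r}}(y))\subset S_{p^{-r}}(y)$ and the restriction of $f$ to the sphere is $\hat\mu_p$-preserving and ergodic with respect to $\hat\mu_p$ (every measurable $A\subset S_{p^{-r}}(y)$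 whose preimage under the restriction is $A$ has $\hat\mu_p(A)\in\{0,1\}$). *)

theory Defs
  imports
    "HOL-Probability.Probability"
    "HOL-Algebra.Generated_Groups"
    "HOL-Number_Theory.Residues"
    "Berlekamp_Zassenhaus.Finite_Field"
begin

section \<open>The ring of \<open>p\<close>-adic integers\<close>

text \<open>
  The prime \<open>p\<close> is the cardinality of the type parameter, \<open>p = CARD('p)\<close> with \<open>'p :: prime_card\<close>.
  A \<open>p\<close>-adic integer is a coherent sequence of residues, an element of the inverse limit of the
  rings \<open>\<int>/p\<^sup>n\<int>\<close>; \<open>padic_res x n\<close> is the representative of \<open>x\<close> modulo \<open>p\<^sup>n\<close> in \<open>{0..<p\<^sup>n}\<close>.
\<close>

typedef (overloaded) 'p padic_int =
  "{x :: nat \<Rightarrow> int. \<forall>n. x n = x (Suc n) mod int CARD('p::prime_card) ^ n}"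
  morphisms padic_res Abs_padic_int
  by (rule exI[of _ "\<lambda>_. 0"]) auto

setup_lifting type_definition_padic_int

lemma mod_pow_Suc_mod: "(a mod (p::int) ^ Suc n) mod p ^ n = a mod p ^ n"
  by (rule mod_mod_cancel) simp

lemma p_gt_1: "int CARD('p::prime_card) > 1"
  using prime_card_int[where 'a='p] prime_gt_1_int by blast

lemma padic_eq_iff: "x = y \<longleftrightarrow> (\<forall>n. padic_res x n = padic_res y n)"
  by (simp add: fun_eq_iff flip: padic_res_inject)

lemma padic_res_Suc_mod:
  fixes x :: "'p::prime_card padic_int"
  shows "padic_res x (Suc n) mod int CARD('p) ^ n = padic_res x n"
  by (rule CollectD[OF padic_res[of x], THEN spec, of n, symmetric])

lemma padic_res_mod_self:
  fixes x :: "'p::prime_card padic_int"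
  shows "padic_res x n mod int CARD('p) ^ n = padic_res x n"
  by (metis mod_mod_trivial padic_res_Suc_mod)

lemma padic_res_Abs:
  fixes q :: "nat \<Rightarrow> int"
  assumes "\<And>n. q n = q (Suc n) mod int CARD('p::prime_card) ^ n"
  shows "padic_res (Abs_padic_int q :: 'p padic_int) n = q n"
  by (subst Abs_padic_int_inverse[OF CollectI, OF allI], rule assms, rule refl)

instantiation padic_int :: (prime_card) comm_ring_1
begin

lift_definition zero_padic_int :: "'a padic_int" is "\<lambda>_. 0" by simp

lift_definition one_padic_int :: "'a padic_int" is "\<lambda>n. 1 mod int CARD('a) ^ n"
  by (simp only: mod_pow_Suc_mod simp_thms)

lift_definition plus_padic_int :: "'a padic_int \<Rightarrow> 'a padic_int \<Rightarrow> 'a padic_int"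
  is "\<lambda>x y n. (x n + y n) mod int CARD('a) ^ n"
  by (metis (no_types, lifting) mod_pow_Suc_mod mod_add_eq)

lift_definition minus_padic_int :: "'a padic_int \<Rightarrow> 'a padic_int \<Rightarrow> 'a padic_int"
  is "\<lambda>x y n. (x n - y n) mod int CARD('a) ^ n"
  by (metis (no_types, lifting) mod_pow_Suc_mod mod_diff_eq)

lift_definition uminus_padic_int :: "'a padic_int \<Rightarrow> 'a padic_int"
  is "\<lambda>x n. (- x n) mod int CARD('a) ^ n"
  by (metis (no_types, lifting) mod_pow_Suc_mod mod_minus_eq)

lift_definition times_padic_int :: "'a padic_int \<Rightarrow> 'a padic_int \<Rightarrow> 'a padic_int"
  is "\<lambda>x y n. (x n * y n) mod int CARD('a) ^ n"
  by (metis (no_types, lifting) mod_pow_Suc_mod mod_mult_eq)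

instance
proof
  note res = zero_padic_int.rep_eq one_padic_int.rep_eq plus_padic_int.rep_eq
    minus_padic_int.rep_eq uminus_padic_int.rep_eq times_padic_int.rep_eq
  fix a b c :: "'a padic_int"
  show "a * b * c = a * (b * c)" by (simp add: padic_eq_iff res mod_simps mult.assoc)
  show "a * b = b * a" by (simp add: padic_eq_iff res mult.commute)
  show "1 * a = a" by (simp add: padic_eq_iff res mod_simps padic_res_mod_self)
  show "a + b + c = a + (b + c)" by (simp add: padic_eq_iff res mod_simps add.assoc)
  show "a + b = b + a" by (simp add: padic_eq_iff res add.commute)
  show "0 + a = a" by (simp add: padic_eq_iff res padic_res_mod_self)
  show "- a + a = 0" by (simp add: padic_eq_iff res mod_simps)
  show "a - b = a + - b" by (simp add: padic_eq_iff res mod_simps)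
  show "(a + b) * c = a * c + b * c" by (simp add: padic_eq_iff res mod_simps distrib_right)
  have "1 mod int CARD('a) ^ 1 \<noteq> 0"
    using p_gt_1[where 'p='a] by simp
  then show "(0::'a padic_int) \<noteq> 1" unfolding padic_eq_iff res by metis
qed

end

lemma padic_res_simps [simp]:
  "padic_res (0 :: 'p::prime_card padic_int) n = 0"
  "padic_res (1 :: 'p padic_int) n = 1 mod int CARD('p) ^ n"
  "padic_res (x + y :: 'p padic_int) n = (padic_res x n + padic_res y n) mod int CARD('p) ^ n"
  "padic_res (x - y :: 'p padic_int) n = (padic_res x n - padic_res y n) mod int CARD('p) ^ n"
  "padic_res (- x :: 'p padic_int) n = (- padic_res x n) mod int CARD('p) ^ n"
  "padic_res (x * y :: 'p padic_int) n = (padic_res x n * padic_res y n) mod int CARD('p) ^ n"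
  by (simp_all add: zero_padic_int.rep_eq one_padic_int.rep_eq plus_padic_int.rep_eq
      minus_padic_int.rep_eq uminus_padic_int.rep_eq times_padic_int.rep_eq)

lemma padic_res_of_nat [simp]:
  "padic_res (of_nat k :: 'p::prime_card padic_int) n = int k mod int CARD('p) ^ n"
  by (induction k) (auto simp: mod_simps)

lemma padic_res_power [simp]:
  "padic_res (x ^ k :: 'p::prime_card padic_int) n = padic_res x n ^ k mod int CARD('p) ^ n"
  by (induction k) (auto simp: mod_simps)

lemma padic_res_of_int [simp]:
  "padic_res (of_int k :: 'p::prime_card padic_int) n = k mod int CARD('p) ^ n"
proof (cases k rule: int_cases2)
  case (nonneg m) then show ?thesis by simp
next
  case (nonpos m) then show ?thesis by (simp add: mod_simps)
qed

lemma padic_res_mod: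
  fixes x :: "'p::prime_card padic_int"
  assumes "n \<le> m"
  shows "padic_res x m mod int CARD('p) ^ n = padic_res x n"
  using assms
proof (induction rule: dec_induct)
  case base
  show ?case by (rule padic_res_mod_self)
next
  case (step m)
  have "padic_res x m = padic_res x (Suc m) mod int CARD('p) ^ m"
    by (rule padic_res_Suc_mod[symmetric])
  moreover have "int CARD('p) ^ n dvd int CARD('p) ^ m"
    using step.hyps by (intro le_imp_power_dvd) auto
  ultimately show ?case using step.IH by (simp add: mod_mod_cancel)
qed

lemma padic_res_range:
  fixes x :: "'p::prime_card padic_int"
  shows "0 \<le> padic_res x n" "padic_res x n < int CARD('p) ^ n"
proof -
  have "padic_res x n mod int CARD('p) ^ n = padic_res x n" by (rule padic_res_mod) simp
  moreover have "int CARD('p) ^ n > 0" using p_gt_1[where 'p='p] by simp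
  ultimately show "0 \<le> padic_res x n" "padic_res x n < int CARD('p) ^ n"
    by (metis pos_mod_sign, metis pos_mod_bound)
qed

lemma padic_p_power_dvd_iff:
  fixes x :: "'p::prime_card padic_int"
  shows "of_nat CARD('p) ^ n dvd x \<longleftrightarrow> padic_res x n = 0"
proof
  assume "of_nat CARD('p) ^ n dvd x"
  then obtain y where "x = of_nat (CARD('p) ^ n) * y" by (auto elim!: dvdE)
  then show "padic_res x n = 0" by (simp del: of_nat_power add: mod_simps) simp
next
  assume 0: "padic_res x n = 0"
  let ?p = "int CARD('p)"
  have p0: "?p > 0" using p_gt_1[where 'p='p] by simp
  define q where "q = (\<lambda>k. padic_res x (k + n) div ?p ^ n)"
  have dvd: "?p ^ n dvd padic_res x (k + n)" for k
    using padic_res_mod[of n "k + n" x] 0 by (simp add: dvd_eq_mod_eq_0)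
  have q: "padic_res x (k + n) = ?p ^ n * q k" for k
    using dvd[of k] by (simp add: q_def)
  have coh: "q k = q (Suc k) mod ?p ^ k" for k
  proof -
    have "?p ^ n * q k = padic_res x (Suc k + n) mod ?p ^ (k + n)"
      unfolding q[symmetric] by (rule padic_res_mod[symmetric]) simp
    also have "\<dots> = ?p ^ n * (q (Suc k) mod ?p ^ k)"
      unfolding q by (simp add: power_add mult.commute mod_mult_mult2)
    finally show ?thesis using p0 by simp
  qed
  define y :: "'p padic_int" where "y = Abs_padic_int q"
  have y: "padic_res y k = q k" for k
    unfolding y_def using coh by (rule padic_res_Abs)
  have "x = of_nat (CARD('p) ^ n) * y"
    unfolding padic_eq_iff
  proof
    fix k
    have "padic_res x k = padic_res x (k + n) mod ?p ^ k" by (rule padic_res_mod[symmetric]) simp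
    then show "padic_res x k = padic_res (of_nat (CARD('p) ^ n) * y) k"
      by (simp add: q y mod_simps)
  qed
  then show "of_nat CARD('p) ^ n dvd x" by simp
qed

lemma padic_mult_eq_0:
  fixes x y :: "'p::prime_card padic_int"
  assumes "x \<noteq> 0" "y \<noteq> 0"
  shows "x * y \<noteq> 0"
proof -
  let ?p = "int CARD('p)"
  have pr: "prime ?p" by (rule prime_card_int)
  from assms obtain n m where nm: "padic_res x n \<noteq> 0" "padic_res y m \<noteq> 0"
    by (auto simp: padic_eq_iff)
  define a b where "a = padic_res x (n + m)" and "b = padic_res y (n + m)"
  have a: "\<not> ?p ^ n dvd a" and b: "\<not> ?p ^ m dvd b"
    using nm padic_res_mod[of n "n + m" x] padic_res_mod[of m "n + m" y]
    by (auto simp: a_def b_def dvd_eq_mod_eq_0)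
  then have 0: "a \<noteq> 0" "b \<noteq> 0" by auto
  have nu: "\<not> is_unit ?p" using p_gt_1[where 'p='p] by simp
  have "multiplicity ?p a < n" "multiplicity ?p b < m"
    using a b by (meson multiplicity_dvd' not_less)+
  then have "multiplicity ?p (a * b) < n + m"
    using 0 pr by (simp add: prime_elem_multiplicity_mult_distrib)
  then have "\<not> ?p ^ (n + m) dvd a * b"
    using 0 nu by (metis multiplicity_geI mult_eq_0_iff not_less)
  then have "padic_res (x * y) (n + m) \<noteq> 0"
    by (simp add: a_def b_def dvd_eq_mod_eq_0)
  then show ?thesis by (metis padic_res_simps(1))
qed

instantiation padic_int :: (prime_card) idom_divide
begin

definition divide_padic_int :: "'a padic_int \<Rightarrow> 'a padic_int \<Rightarrow> 'a padic_int" where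
  "divide_padic_int x y = (if y \<noteq> 0 \<and> y dvd x then THE q. x = q * y else 0)"

instance
proof
  fix a b :: "'a padic_int"
  show "a \<noteq> 0 \<Longrightarrow> b \<noteq> 0 \<Longrightarrow> a * b \<noteq> 0" by (rule padic_mult_eq_0)
  show "a div 0 = 0" by (simp add: divide_padic_int_def)
  assume b: "b \<noteq> 0"
  have "(THE q. a * b = q * b) = a"
  proof (rule the_equality)
    fix q assume "a * b = q * b"
    then have "(q - a) * b = 0" by (simp add: algebra_simps)
    then show "q = a" using b padic_mult_eq_0[of "q - a" b] by auto
  qed simp
  then show "a * b div b = a" using b by (simp add: divide_padic_int_def)
qed

end

instance padic_int :: (prime_card) algebraic_semidom ..

instance padic_int :: (prime_card) ring_char_0
proof
  show "inj (of_nat :: nat \<Rightarrow> 'a padic_int)"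
  proof (rule injI)
    fix k l :: nat
    assume eq: "(of_nat k :: 'a padic_int) = of_nat l"
    have "CARD('a) > 1" using prime_card[where 'a='a] prime_gt_1_nat by blast
    then have "k + l < CARD('a) ^ (k + l)" using power_gt_expt[of "CARD('a)" "k + l"] by simp
    then have "int k < int CARD('a) ^ (k + l)" "int l < int CARD('a) ^ (k + l)"
      by (simp_all flip: of_nat_power)
    moreover have "int k mod int CARD('a) ^ (k + l) = int l mod int CARD('a) ^ (k + l)"
      using eq by (metis padic_res_of_nat)
    ultimately show "k = l" by simp
  qed
qed


section \<open>Absolute value and topology\<close>

definition padic_val :: "'p::prime_card padic_int \<Rightarrow> nat" where
  "padic_val x = (GREATEST n. of_nat CARD('p) ^ n dvd x)"

definition padic_norm :: "'p::prime_card padic_int \<Rightarrow> real" where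
  "padic_norm x = (if x = 0 then 0 else 1 / real CARD('p) ^ padic_val x)"

lemma padic_norm_le_iff:
  fixes x :: "'p::prime_card padic_int"
  shows "padic_norm x \<le> 1 / real CARD('p) ^ n \<longleftrightarrow> of_nat CARD('p) ^ n dvd x"
proof (cases "x = 0")
  case False
  let ?P = "of_nat CARD('p) :: 'p padic_int"
  have p1: "real CARD('p) > 1" using p_gt_1[where 'p='p] by simp
  from False obtain m where m: "padic_res x m \<noteq> 0" by (auto simp: padic_eq_iff)
  have "k < m" if "?P ^ k dvd x" for k
  proof (rule ccontr)
    assume "\<not> k < m"
    then have "?P ^ m dvd x" using that by (meson le_imp_power_dvd dvd_trans not_less)
    then show False using m by (simp add: padic_p_power_dvd_iff)
  qed
  then have bound: "\<forall>k. ?P ^ k dvd x \<longrightarrow> k \<le> m" by (auto intro: less_imp_le)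
  have "?P ^ padic_val x dvd x"
    unfolding padic_val_def by (rule GreatestI_nat[of _ 0 m]) (use bound in auto)
  then have "?P ^ n dvd x \<longleftrightarrow> n \<le> padic_val x"
    unfolding padic_val_def using bound
    by (metis (no_types, lifting) Greatest_le_nat dvd_trans le_imp_power_dvd)
  then show ?thesis using False p1
    by (simp add: padic_norm_def divide_simps)
qed (auto simp: padic_norm_def)

lemma padic_norm_add_le:
  fixes x y :: "'p::prime_card padic_int"
  shows "padic_norm (x + y) \<le> max (padic_norm x) (padic_norm y)"
proof -
  have *: "padic_norm (x + y) \<le> padic_norm y" if le: "padic_norm x \<le> padic_norm y" for x y :: "'p padic_int"
  proof (cases "y = 0")
    case True
    then show ?thesis using le by (auto simp: padic_norm_def split: if_splits)
  next
    case False
    then obtain n where n: "padic_norm y = 1 / real CARD('p) ^ n" by (auto simp: padic_norm_def)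
    with le show ?thesis
      by (metis padic_norm_le_iff dvd_add order_refl)
  qed
  show ?thesis using *[of x y] *[of y x] by (auto simp: max_def add.commute)
qed

instantiation padic_int :: (prime_card) metric_space
begin

definition dist_padic_int :: "'a padic_int \<Rightarrow> 'a padic_int \<Rightarrow> real" where
  "dist_padic_int x y = padic_norm (x - y)"

definition uniformity_padic_int :: "('a padic_int \<times> 'a padic_int) filter" where
  "uniformity_padic_int = (INF e\<in>{0<..}. principal {(x, y). dist x y < e})"

definition open_padic_int :: "'a padic_int set \<Rightarrow> bool" where
  "open_padic_int U \<longleftrightarrow> (\<forall>x\<in>U. \<forall>\<^sub>F (x', y) in uniformity. x' = x \<longrightarrow> y \<in> U)"

instance
proof
  fix x y z :: "'a padic_int"
  have p0: "real CARD('a) > 0" using p_gt_1[where 'p='a] by simp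
  show "dist x y = 0 \<longleftrightarrow> x = y"
    using p0 by (auto simp: dist_padic_int_def padic_norm_def)
  have nonneg: "padic_norm u \<ge> 0" for u :: "'a padic_int" by (simp add: padic_norm_def)
  have minus: "padic_norm (- u) = padic_norm u" for u :: "'a padic_int"
    by (simp add: padic_norm_def padic_val_def)
  have "padic_norm (x - y) \<le> max (padic_norm (x - z)) (padic_norm (z - y))"
    using padic_norm_add_le[of "x - z" "z - y"] by simp
  also have "padic_norm (z - y) = padic_norm (y - z)" using minus[of "z - y"] by simp
  finally show "dist x y \<le> dist x z + dist y z"
    using nonneg[of "x - z"] nonneg[of "y - z"] by (simp add: dist_padic_int_def)
qed (auto simp: uniformity_padic_int_def open_padic_int_def)

end

section \<open>The class \<open>\<B>\<close> and derivatives\<close>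

definition padic_binomial :: "'p::prime_card padic_int \<Rightarrow> nat \<Rightarrow> 'p padic_int" where
  "padic_binomial x i = (\<Prod>j<i. x - of_nat j) div fact i"

text \<open>The condition \<open>a\<^sub>i / i! \<in> \<int>\<^sub>p\<close> reads \<open>fact i dvd a i\<close>.\<close>

definition class_B :: "('p::prime_card padic_int \<Rightarrow> 'p padic_int) set" where
  "class_B = {f. \<exists>a. (\<forall>i. fact i dvd a i) \<and> (\<forall>x. (\<lambda>i. a i * padic_binomial x i) sums f x)}"

text \<open>
  The division in \<open>padic_binomial\<close> is exact, since \<open>i!\<close> divides the falling factorial at a natural
  number close to \<open>x\<close>.
\<close>

lemma padic_unit_of_int:
  assumes "coprime u (int CARD('p::prime_card))"
  shows "(of_int u :: 'p padic_int) dvd 1"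
proof -
  let ?p = "int CARD('p)"
  have p0: "?p > 0" using p_gt_1[where 'p='p] by simp
  have "\<exists>v. (u * v) mod ?p ^ n = 1 mod ?p ^ n" for n
    using assms by (metis cong_def cong_solve_coprime_int coprime_power_right_iff)
  then obtain w where w: "(u * w n) mod ?p ^ n = 1 mod ?p ^ n" for n by metis
  define v where "v = (\<lambda>n. w n mod ?p ^ n)"
  have v: "(u * v n) mod ?p ^ n = 1 mod ?p ^ n" for n
    using w by (simp add: v_def mod_simps)
  have "v n = v (Suc n) mod ?p ^ n" for n
  proof -
    have "(u * v (Suc n)) mod ?p ^ n = (u * v n) mod ?p ^ n"
      using v by (metis mod_pow_Suc_mod)
    then have "[v (Suc n) = v n] (mod ?p ^ n)"
      using assms by (simp add: cong_mult_lcancel cong_def[symmetric] coprime_commute)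
    then show ?thesis by (simp add: cong_def v_def)
  qed
  then have res: "padic_res (Abs_padic_int v :: 'p padic_int) n = v n" for n
    by (rule padic_res_Abs)
  have "1 = of_int u * (Abs_padic_int v :: 'p padic_int)"
    unfolding padic_eq_iff by (simp add: res mod_simps v)
  then show ?thesis by (rule dvdI)
qed

lemma padic_fact_dvd_falling:
  fixes x :: "'p::prime_card padic_int"
  shows "fact i dvd (\<Prod>j<i. x - of_nat j)"
proof -
  let ?P = "of_nat CARD('p) :: 'p padic_int"
  have "\<not> is_unit (int CARD('p))"
    using p_gt_1[where 'p='p] by simp
  then obtain u where u: "(fact i :: int) = int CARD('p) ^ multiplicity (int CARD('p)) (fact i) * u"
      "\<not> int CARD('p) dvd u"
    using multiplicity_decompose'[of "fact i" "int CARD('p)"] by (metis fact_nonzero)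
  define v where "v = multiplicity (int CARD('p)) (fact i)"
  have "coprime u (int CARD('p))"
    using u(2) prime_card_int[where 'a='p] by (metis coprime_commute prime_imp_coprime)
  then have unit: "(of_int u :: 'p padic_int) dvd 1" by (rule padic_unit_of_int)
  have "(fact i :: 'p padic_int) = of_int (fact i)" by simp
  also have "\<dots> = ?P ^ v * of_int u"
    by (subst u(1)) (simp add: v_def)
  finally have fact_eq: "(fact i :: 'p padic_int) = ?P ^ v * of_int u" .
  then have fact_dvd: "fact i dvd z" if "?P ^ v dvd z" for z
    using that unit by (simp add: mult_unit_dvd_iff)
  define m where "m = nat (padic_res x v)"
  have "padic_res (x - of_nat m) v = 0"
    using padic_res_range[of x v] by (simp add: m_def mod_simps)
  then have d: "?P ^ v dvd x - of_nat m" by (simp add: padic_p_power_dvd_iff)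
  have "?P ^ v dvd (\<Prod>j<k. x - of_nat j) - (\<Prod>j<k. of_nat m - of_nat j)" for k
  proof (induction k)
    case (Suc k)
    have "(\<Prod>j<Suc k. x - of_nat j) - (\<Prod>j<Suc k. of_nat m - of_nat j)
       = ((\<Prod>j<k. x - of_nat j) - (\<Prod>j<k. of_nat m - of_nat j)) * (x - of_nat k)
         + (\<Prod>j<k. of_nat m - of_nat j) * (x - of_nat m)"
      by (simp add: algebra_simps)
    then show ?case using Suc d by (simp add: dvd_add)
  qed simp
  then have 1: "fact i dvd (\<Prod>j<i. x - of_nat j) - (\<Prod>j<i. of_nat m - of_nat j)"
    by (rule fact_dvd)
  have "(fact i :: int) dvd (\<Prod>j<i. int m - int j)"
    using fact_dvd_pochhammer[of i "int m - int i + 1"]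
    by (simp add: falling_fact_pochhammer' lessThan_atLeast0)
  then have "of_int (fact i) dvd (of_int (\<Prod>j<i. int m - int j) :: 'p padic_int)"
    by (metis dvd_def of_int_mult)
  then have 2: "(fact i :: 'p padic_int) dvd (\<Prod>j<i. of_nat m - of_nat j)"
    by simp
  from 1 2 show ?thesis by (metis diff_add_cancel dvd_add)
qed

lemma class_B_iff_falling:
  "f \<in> class_B \<longleftrightarrow> (\<exists>b. \<forall>x. (\<lambda>i. b i * (\<Prod>j<i. x - of_nat j)) sums f x)"
proof -
  have *: "(b * fact i) * padic_binomial x i = b * (\<Prod>j<i. x - of_nat j)"
    for b x :: "'a padic_int" and i
    unfolding padic_binomial_def mult.assoc
    by (subst dvd_mult_div_cancel[OF padic_fact_dvd_falling]) (rule refl)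
  show ?thesis
  proof
    assume "f \<in> class_B"
    then obtain a where a: "\<And>i. fact i dvd a i" "\<And>x. (\<lambda>i. a i * padic_binomial x i) sums f x"
      unfolding class_B_def mem_Collect_eq by blast
    have "\<exists>c. a i = c * fact i" for i using a(1)[of i] by (auto elim!: dvdE simp: mult.commute)
    then have "\<exists>b. \<forall>i. a i = b i * fact i" by (intro choice) blast
    then obtain b where b: "a i = b i * fact i" for i by blast
    show "\<exists>b. \<forall>x. (\<lambda>i. b i * (\<Prod>j<i. x - of_nat j)) sums f x"
      using a(2) unfolding b * by blast
  next
    assume "\<exists>b. \<forall>x. (\<lambda>i. b i * (\<Prod>j<i. x - of_nat j)) sums f x"
    then obtain b where "\<And>x. (\<lambda>i. b i * (\<Prod>j<i. x - of_nat j)) sums f x" by blast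
    then have "\<forall>x. (\<lambda>i. (b i * fact i) * padic_binomial x i) sums f x" unfolding * by blast
    moreover have "\<forall>i. fact i dvd b i * fact i" by simp
    ultimately show "f \<in> class_B" unfolding class_B_def mem_Collect_eq
      by (intro exI[of _ "\<lambda>i. b i * fact i"] conjI)
  qed
qed

text \<open>
  The difference quotient lies in the field of fractions, so its convergence to \<open>d\<close> is
  expressed through absolute values.
\<close>

definition has_padic_derivative ::
    "('p::prime_card padic_int \<Rightarrow> 'p padic_int) \<Rightarrow> 'p padic_int \<Rightarrow> 'p padic_int \<Rightarrow> bool" where
  "has_padic_derivative f d y \<longleftrightarrow>
     ((\<lambda>h. padic_norm (f (y + h) - f y - d * h) / padic_norm h) \<longlongrightarrow> 0) (at 0)"

definition padic_deriv ::
    "('p::prime_card padic_int \<Rightarrow> 'p padic_int) \<Rightarrow> 'p padic_int \<Rightarrow> 'p padic_int" where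
  "padic_deriv f y = (THE d. has_padic_derivative f d y)"

section \<open>Haar measure and ergodicity\<close>

definition is_padic_haar :: "'p::prime_card padic_int measure \<Rightarrow> bool" where
  "is_padic_haar \<mu> \<longleftrightarrow>
     sets \<mu> = sets borel \<and> prob_space \<mu> \<and> (\<forall>a. distr \<mu> borel ((+) a) = \<mu>)"

text \<open>
  Existence and uniqueness: the cylinders \<open>{z. padic_res z n = a}\<close> form a countable basis, and a
  translation-invariant probability measure gives each nonempty one the measure \<open>1/p\<^sup>n\<close>. Uniformly
  distributed independent digits realise this.
\<close>

definition padic_cyl :: "nat \<Rightarrow> int \<Rightarrow> 'p::prime_card padic_int set" where
  "padic_cyl n a = {z. padic_res z n = a}"

lemma padic_cyl_eq_empty:
  "\<not> (0 \<le> a \<and> a < int CARD('p) ^ n) \<Longrightarrow> padic_cyl n a = ({} :: 'p::prime_card padic_int set)"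
  unfolding padic_cyl_def using padic_res_range by blast

lemma padic_dist_le_iff:
  fixes x y :: "'p::prime_card padic_int"
  shows "dist x y \<le> 1 / real CARD('p) ^ n \<longleftrightarrow> padic_res x n = padic_res y n"
proof -
  have "padic_res (x - y) n = 0 \<longleftrightarrow> padic_res x n = padic_res y n"
    by (metis padic_res_simps(4) padic_res_mod_self mod_eq_dvd_iff mod_0_imp_dvd
        dvd_imp_mod_0)
  then show ?thesis
    by (simp add: dist_padic_int_def padic_norm_le_iff padic_p_power_dvd_iff)
qed

lemma padic_power_small:
  assumes "e > 0"
  obtains n where "1 / real CARD('p::prime_card) ^ n < e"
proof -
  have "real CARD('p) > 1" using p_gt_1[where 'p='p] by simp
  then obtain n where "(1 / real CARD('p)) ^ n < e"
    using real_arch_pow_inv[of e "1 / real CARD('p)"] assms by auto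
  then show ?thesis using that by (simp add: power_one_over)
qed

lemma open_padic_cyl: "open (padic_cyl n a :: 'p::prime_card padic_int set)"
  unfolding open_dist
proof
  fix x :: "'p padic_int"
  assume x: "x \<in> padic_cyl n a"
  have "real CARD('p) > 1" using p_gt_1[where 'p='p] by simp
  moreover have "y \<in> padic_cyl n a" if "dist y x < 1 / real CARD('p) ^ n" for y
    using padic_dist_le_iff[of y x n] that x by (simp add: padic_cyl_def)
  ultimately show "\<exists>e>0. \<forall>y. dist y x < e \<longrightarrow> y \<in> padic_cyl n a"
    by (intro exI[of _ "1 / real CARD('p) ^ n"]) auto
qed

lemma topological_basis_padic_cyl:
  "topological_basis (range (\<lambda>(n, a). padic_cyl n a :: 'p::prime_card padic_int set))"
proof (rule topological_basisI)
  fix U :: "'p padic_int set" and x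
  assume "open U" "x \<in> U"
  then obtain e where e: "e > 0" "\<And>y. dist y x < e \<Longrightarrow> y \<in> U" by (auto simp: open_dist)
  obtain n where n: "1 / real CARD('p) ^ n < e" using padic_power_small e(1) by blast
  have "y \<in> U" if "y \<in> padic_cyl n (padic_res x n)" for y
    using padic_dist_le_iff[of y x n] that e(2)[of y] n by (simp add: padic_cyl_def)
  moreover have "x \<in> padic_cyl n (padic_res x n)" by (simp add: padic_cyl_def)
  ultimately show "\<exists>B\<in>range (\<lambda>(n, a). padic_cyl n a). x \<in> B \<and> B \<subseteq> U" by auto
qed (auto intro: open_padic_cyl)

lemma borel_padic:
  "(borel :: 'p::prime_card padic_int measure) = sigma UNIV (range (\<lambda>(n, a). padic_cyl n a))"
  by (rule borel_eq_countable_basis[OF _ topological_basis_padic_cyl]) simp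

lemma sets_borel_padic:
  "sets (borel :: 'p::prime_card padic_int measure)
    = sigma_sets UNIV (range (\<lambda>(n, a). padic_cyl n a))"
  by (simp add: borel_padic)

lemma padic_cyl_Int_le:
  assumes "n \<le> m"
  shows "padic_cyl n a \<inter> padic_cyl m b =
    (if b mod int CARD('p) ^ n = a then padic_cyl m b else {} :: 'p::prime_card padic_int set)"
  using padic_res_mod[OF assms, where 'p='p] by (auto simp: padic_cyl_def)

lemma Int_stable_padic_cyl:
  "Int_stable (range (\<lambda>(n, a). padic_cyl n a :: 'p::prime_card padic_int set))"
proof -
  have "padic_cyl n a \<inter> padic_cyl m b \<in> range (\<lambda>(n, a). padic_cyl n a :: 'p padic_int set)"
    if "n \<le> m" for n m a b
  proof -
    have "{} = (padic_cyl 0 1 :: 'p padic_int set)" by (rule padic_cyl_eq_empty[symmetric]) simp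
    then show ?thesis unfolding padic_cyl_Int_le[OF that]
      by (metis (mono_tags, lifting) case_prod_conv rangeI)
  qed
  then show ?thesis unfolding Int_stable_def by (auto simp: image_iff) (metis Int_commute nle_le)
qed

lemma padic_measure_eqI:
  fixes M N :: "'p::prime_card padic_int measure"
  assumes "sets M = sets borel" "sets N = sets borel" "prob_space M"
    and "\<And>n a. 0 \<le> a \<Longrightarrow> a < int CARD('p) ^ n \<Longrightarrow>
      emeasure M (padic_cyl n a) = emeasure N (padic_cyl n a)"
  shows "M = N"
proof (rule measure_eqI_generator_eq[OF Int_stable_padic_cyl, where \<Omega>=UNIV and A="\<lambda>_. UNIV"])
  interpret prob_space M by fact
  have "padic_res z 0 = 0" for z :: "'p padic_int"
    using padic_res_range[of z 0] by simp
  then have "padic_cyl 0 0 = (UNIV :: 'p padic_int set)" by (simp add: padic_cyl_def)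
  then show "range (\<lambda>_. UNIV) \<subseteq> range (\<lambda>(n, a). padic_cyl n a :: 'p padic_int set)"
    by (auto simp: image_iff)
  fix X :: "'p padic_int set" assume "X \<in> range (\<lambda>(n, a). padic_cyl n a)"
  then obtain n a where X: "X = padic_cyl n a" by auto
  show "emeasure M X = emeasure N X"
  proof (cases "0 \<le> a \<and> a < int CARD('p) ^ n")
    case True then show ?thesis using assms(4) by (simp add: X)
  next
    case False then show ?thesis by (simp add: X padic_cyl_eq_empty)
  qed
qed (use assms in \<open>auto simp: sets_borel_padic prob_space.emeasure_space_1
       finite_measure.emeasure_finite prob_space_def\<close>)

lemma padic_cyl_translate:
  fixes c :: "'p::prime_card padic_int"
  assumes "0 \<le> a" "a < int CARD('p) ^ n"
  shows "(+) c -` padic_cyl n a = padic_cyl n ((a - padic_res c n) mod int CARD('p) ^ n)"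
proof -
  have "(padic_res c n + z) mod int CARD('p) ^ n = a \<longleftrightarrow>
      z = (a - padic_res c n) mod int CARD('p) ^ n" if "z mod int CARD('p) ^ n = z" for z
  proof -
    have a: "a mod int CARD('p) ^ n = a" using assms by simp
    have "(padic_res c n + z) mod int CARD('p) ^ n = a mod int CARD('p) ^ n \<longleftrightarrow>
        z mod int CARD('p) ^ n = (a - padic_res c n) mod int CARD('p) ^ n"
      by (simp add: mod_eq_dvd_iff algebra_simps)
    then show ?thesis using a that by simp
  qed
  then show ?thesis by (auto simp: padic_cyl_def padic_res_mod_self)
qed

lemma measurable_padic_translate:
  "(+) c \<in> measurable borel (borel :: 'p::prime_card padic_int measure)"
proof (rule measurable_sigma_sets[OF sets_borel_padic])
  fix X :: "'p padic_int set" assume "X \<in> range (\<lambda>(n, a). padic_cyl n a)"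
  then obtain n a where X: "X = padic_cyl n a" by auto
  have "open ((+) c -` X)"
  proof (cases "0 \<le> a \<and> a < int CARD('p) ^ n")
    case True then show ?thesis by (simp add: X padic_cyl_translate open_padic_cyl)
  next
    case False then show ?thesis by (simp add: X padic_cyl_eq_empty)
  qed
  then show "(+) c -` X \<inter> space borel \<in> sets borel" by simp
qed auto

lemma is_padic_haar_iff:
  fixes M :: "'p::prime_card padic_int measure"
  shows "is_padic_haar M \<longleftrightarrow> sets M = sets borel \<and> prob_space M \<and>
    (\<forall>n a. 0 \<le> a \<longrightarrow> a < int CARD('p) ^ n \<longrightarrow> emeasure M (padic_cyl n a) = 1 / of_nat (CARD('p) ^ n))"
proof (intro iffI conjI allI impI)
  assume M: "is_padic_haar M"
  then show s: "sets M = sets borel" and "prob_space M" by (auto simp: is_padic_haar_def)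
  then interpret prob_space M by simp
  have sp: "space M = UNIV" using sets_eq_imp_space_eq[OF s] by simp
  fix n a assume a: "0 \<le> a" "a < int CARD('p) ^ n"
  have tr: "emeasure M (padic_cyl n b) = emeasure M (padic_cyl n 0)"
    if b: "0 \<le> b" "b < int CARD('p) ^ n" for b
  proof -
    have "emeasure M (padic_cyl n b) = emeasure (distr M borel ((+) (of_int b))) (padic_cyl n b)"
      using M by (simp add: is_padic_haar_def)
    also have "\<dots> = emeasure M ((+) (of_int b) -` padic_cyl n b)"
      using measurable_padic_translate measurable_cong_sets[OF s refl]
      by (subst emeasure_distr) (auto simp: sp open_padic_cyl)
    finally show ?thesis using b by (simp add: padic_cyl_translate)
  qed
  have "1 = emeasure M (\<Union>b\<in>{0..<int CARD('p) ^ n}. padic_cyl n b)"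
  proof -
    have "(\<Union>b\<in>{0..<int CARD('p) ^ n}. padic_cyl n b) = (UNIV :: 'p padic_int set)"
      using padic_res_range[where 'p='p and n=n] by (auto simp: padic_cyl_def)
    then show ?thesis using emeasure_space_1 by (simp add: sp)
  qed
  also have "\<dots> = (\<Sum>b\<in>{0..<int CARD('p) ^ n}. emeasure M (padic_cyl n b))"
  proof (rule sum_emeasure[symmetric])
    show "padic_cyl n ` {0..<int CARD('p) ^ n} \<subseteq> sets M" by (auto simp: s open_padic_cyl)
    show "disjoint_family_on (padic_cyl n :: _ \<Rightarrow> 'p padic_int set) {0..<int CARD('p) ^ n}"
      by (auto simp: disjoint_family_on_def padic_cyl_def)
  qed simp
  also have "\<dots> = (\<Sum>b\<in>{0..<int CARD('p) ^ n}. emeasure M (padic_cyl n a))"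
  proof (rule sum.cong[OF refl])
    fix b assume "b \<in> {0..<int CARD('p) ^ n}"
    then show "emeasure M (padic_cyl n b) = emeasure M (padic_cyl n a)"
      using tr[of b] tr[OF a] by (metis atLeastLessThan_iff)
  qed
  also have "\<dots> = of_nat (CARD('p) ^ n) * emeasure M (padic_cyl n a)"
    by (simp add: nat_power_eq)
  finally have 1: "1 = of_nat (CARD('p) ^ n) * emeasure M (padic_cyl n a)" .
  have "(of_nat (CARD('p) ^ n) :: ennreal) \<noteq> 0" by simp
  then show "emeasure M (padic_cyl n a) = 1 / of_nat (CARD('p) ^ n)"
    unfolding 1 by (metis ennreal_mult_divide_eq ennreal_of_nat_neq_top mult.commute of_nat_power)
next
  assume H: "sets M = sets borel \<and> prob_space M \<and>
    (\<forall>n a. 0 \<le> a \<longrightarrow> a < int CARD('p) ^ n \<longrightarrow> emeasure M (padic_cyl n a) = 1 / of_nat (CARD('p) ^ n))"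
  then have s: "sets M = sets borel" and P: "prob_space M" by auto
  have sp: "space M = UNIV" using sets_eq_imp_space_eq[OF s] by simp
  have me: "(+) c \<in> measurable M borel" for c :: "'p padic_int"
    using measurable_padic_translate measurable_cong_sets[OF s refl] by blast
  have "M = distr M borel ((+) c)" for c
  proof (rule padic_measure_eqI)
    fix n a assume a: "0 \<le> a" "a < int CARD('p) ^ n"
    have p: "int CARD('p) ^ n > 0" using p_gt_1[where 'p='p] by simp
    have "emeasure (distr M borel ((+) c)) (padic_cyl n a) = emeasure M ((+) c -` padic_cyl n a)"
      using me by (subst emeasure_distr) (auto simp: sp open_padic_cyl)
    also have "\<dots> = 1 / of_nat (CARD('p) ^ n)"
      using H a p by (simp add: padic_cyl_translate)
    finally show "emeasure M (padic_cyl n a) = emeasure (distr M borel ((+) c)) (padic_cyl n a)"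
      using H a by simp
  qed (use s P in auto)
  then show "is_padic_haar M" using s P by (simp add: is_padic_haar_def)
qed

lemma digit_sum_range:
  fixes p :: int
  assumes "p > 0" "\<And>i. 0 \<le> d i" "\<And>i. d i < p"
  shows "0 \<le> (\<Sum>i<n. d i * p ^ i)" "(\<Sum>i<n. d i * p ^ i) < p ^ n"
proof -
  show "0 \<le> (\<Sum>i<n. d i * p ^ i)" using assms by (intro sum_nonneg) auto
  show "(\<Sum>i<n. d i * p ^ i) < p ^ n"
  proof (induction n)
    case (Suc n)
    have "d n * p ^ n \<le> (p - 1) * p ^ n"
      using assms(1) assms(3)[of n] by (intro mult_right_mono) auto
    then show ?case using Suc by (simp add: algebra_simps)
  qed simp
qed

lemma digit_sum_eq_iff:
  fixes p :: int
  assumes "p > 0" "\<And>i. 0 \<le> d i" "\<And>i. d i < p" "0 \<le> a" "a < p ^ n"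
  shows "(\<Sum>i<n. d i * p ^ i) = a \<longleftrightarrow> (\<forall>i<n. d i = a div p ^ i mod p)"
  using assms(4,5)
proof (induction n arbitrary: a)
  case (Suc n)
  let ?S = "\<Sum>i<n. d i * p ^ i"
  have S: "0 \<le> ?S" "?S < p ^ n" using digit_sum_range[of p d] assms by auto
  have pn: "p ^ n > 0" using assms by simp
  have "a div p ^ n < p"
  proof (rule ccontr)
    assume "\<not> a div p ^ n < p"
    then have "p * p ^ n \<le> a div p ^ n * p ^ n" using pn by (intro mult_right_mono) auto
    also have "\<dots> \<le> a" using pn by (metis add_increasing2 div_mult_mod_eq order_refl pos_mod_sign)
    finally show False using Suc.prems by simp
  qed
  moreover have "0 \<le> a div p ^ n" using Suc.prems pn by (simp add: pos_imp_zdiv_nonneg_iff)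
  ultimately have dn: "a div p ^ n mod p = a div p ^ n" by simp
  have "?S + d n * p ^ n = a \<longleftrightarrow> ?S = a mod p ^ n \<and> d n = a div p ^ n"
  proof
    assume eq: "?S + d n * p ^ n = a"
    have "a mod p ^ n = ?S" "a div p ^ n = d n"
      unfolding eq[symmetric] using S pn assms(1) by (simp_all add: div_add1_eq)
    then show "?S = a mod p ^ n \<and> d n = a div p ^ n" by simp
  next
    assume "?S = a mod p ^ n \<and> d n = a div p ^ n"
    then show "?S + d n * p ^ n = a" using mod_div_mult_eq[of a "p ^ n"] by simp
  qed
  also have "?S = a mod p ^ n \<longleftrightarrow> (\<forall>i<n. d i = a mod p ^ n div p ^ i mod p)"
    using pn by (intro Suc.IH) auto
  also have "\<dots> \<longleftrightarrow> (\<forall>i<n. d i = a div p ^ i mod p)"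
  proof -
    have "a mod p ^ n div p ^ i mod p = a div p ^ i mod p" if "i < n" for i
    proof -
      obtain k where k: "n = i + Suc k" using \<open>i < n\<close> less_imp_Suc_add by fastforce
      have "a mod p ^ n div p ^ i = a div p ^ i mod p ^ Suc k"
        using pn assms(1) unfolding k power_add by (simp add: zmod_zmult2_eq del: power_Suc)
      then show ?thesis by (simp add: mod_mod_cancel)
    qed
    then show ?thesis by auto
  qed
  finally show ?case using dn by (auto simp: less_Suc_eq)
qed auto

lemma ex_padic_haar: "\<exists>M :: 'p::prime_card padic_int measure. is_padic_haar M"
proof -
  let ?p = "int CARD('p)"
  have p1: "?p > 1" using p_gt_1[where 'p='p] .
  define D where "D = measure_pmf (pmf_of_set {..<CARD('p)})"
  define P where "P = PiM (UNIV :: nat set) (\<lambda>_. D)"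
  define \<phi> where "\<phi> d = (Abs_padic_int (\<lambda>n. \<Sum>i<n. int (d i) mod ?p * ?p ^ i) :: 'p padic_int)"
    for d :: "nat \<Rightarrow> nat"
  have \<phi>: "padic_res (\<phi> d) n = (\<Sum>i<n. int (d i) mod ?p * ?p ^ i)" for d n
    unfolding \<phi>_def
  proof (rule padic_res_Abs)
    fix n
    show "(\<Sum>i<n. int (d i) mod ?p * ?p ^ i) = (\<Sum>i<Suc n. int (d i) mod ?p * ?p ^ i) mod ?p ^ n"
      using digit_sum_range[of ?p "\<lambda>i. int (d i) mod ?p" n] p1 by simp
  qed
  have spD: "space D = UNIV" "sets D = UNIV" by (auto simp: D_def)
  have spP: "space P = UNIV" by (auto simp: P_def space_PiM spD)
  have pD: "prob_space D" unfolding D_def by (rule measure_pmf.prob_space_axioms)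
  have pP: "prob_space P" unfolding P_def by (rule prob_space_PiM) (rule pD)
  define E where "E a i = {k. int k mod ?p = a div ?p ^ i mod ?p}" for a i
  have vim: "\<phi> -` padic_cyl n a = prod_emb UNIV (\<lambda>_. D) {..<n} (Pi\<^sub>E {..<n} (E a))"
    if "0 \<le> a" "a < ?p ^ n" for n a
  proof -
    have "d \<in> \<phi> -` padic_cyl n a \<longleftrightarrow> (\<forall>i<n. d i \<in> E a i)" for d
      using digit_sum_eq_iff[of ?p "\<lambda>i. int (d i) mod ?p" a n] p1 that
      by (simp add: padic_cyl_def \<phi> E_def)
    then show ?thesis by (auto simp: prod_emb_def spD PiE_iff)
  qed
  have me: "\<phi> \<in> measurable P borel"
  proof (rule measurable_sigma_sets[OF sets_borel_padic])
    fix X :: "'p padic_int set" assume "X \<in> range (\<lambda>(n, a). padic_cyl n a)"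
    then obtain n a where X: "X = padic_cyl n a" by auto
    show "\<phi> -` X \<inter> space P \<in> sets P"
    proof (cases "0 \<le> a \<and> a < ?p ^ n")
      case True then show ?thesis
        by (auto simp: X vim spP P_def spD intro!: sets_PiM_I)
    next
      case False then show ?thesis by (simp add: X padic_cyl_eq_empty)
    qed
  qed auto
  have "emeasure (distr P borel \<phi>) (padic_cyl n a) = 1 / of_nat (CARD('p) ^ n)"
    if a: "0 \<le> a" "a < ?p ^ n" for n a
  proof -
    have "emeasure D (E a i) = ennreal (1 / real CARD('p))" for i
    proof -
      define c where "c = nat (a div ?p ^ i mod ?p)"
      have c: "int c = a div ?p ^ i mod ?p" using p1 by (simp add: c_def)
      have "c < CARD('p)" using p1 c by (metis of_nat_less_iff pos_mod_bound less_trans zero_less_one)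
      then have "{..<CARD('p)} \<inter> E a i = {c}"
        by (auto simp: E_def c[symmetric] simp flip: of_nat_mod)
      moreover have "{..<CARD('p)} \<noteq> {}" using \<open>c < CARD('p)\<close> by auto
      ultimately show ?thesis
        by (simp add: D_def emeasure_pmf_of_set)
    qed
    then have "(\<Prod>i<n. emeasure D (E a i)) = ennreal ((1 / real CARD('p)) ^ n)"
      by (simp add: ennreal_power)
    also have "\<dots> = 1 / of_nat (CARD('p) ^ n)"
      by (simp add: power_one_over divide_ennreal[symmetric] ennreal_of_nat_eq_real_of_nat
          flip: ennreal_power)
    finally have "(\<Prod>i<n. emeasure D (E a i)) = 1 / of_nat (CARD('p) ^ n)" .
    moreover have "emeasure (distr P borel \<phi>) (padic_cyl n a) = emeasure P (\<phi> -` padic_cyl n a)"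
      using me by (subst emeasure_distr) (auto simp: spP open_padic_cyl)
    moreover have "\<dots> = (\<Prod>i<n. emeasure D (E a i))"
      unfolding vim[OF a] P_def by (rule emeasure_PiM_emb) (auto simp: pD spD)
    ultimately show ?thesis by simp
  qed
  moreover have "prob_space (distr P borel \<phi>)" by (rule prob_space.prob_space_distr[OF pP me])
  ultimately have "is_padic_haar (distr P borel \<phi>)" by (simp add: is_padic_haar_iff)
  then show ?thesis by blast
qed

lemma ex1_padic_haar: "\<exists>!M :: 'p::prime_card padic_int measure. is_padic_haar M"
proof -
  have "M = N" if "is_padic_haar M" "is_padic_haar N" for M N :: "'p padic_int measure"
    using that by (intro padic_measure_eqI) (auto simp: is_padic_haar_iff)
  then show ?thesis using ex_padic_haar by blast
qed

definition padic_haar :: "'p::prime_card padic_int measure" where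
  "padic_haar = (THE \<mu>. is_padic_haar \<mu>)"

definition normalized_haar_on :: "'p::prime_card padic_int set \<Rightarrow> 'p padic_int measure" where
  "normalized_haar_on S = scale_measure (1 / emeasure padic_haar S) (restrict_space padic_haar S)"

definition padic_ergodic_on ::
    "('p::prime_card padic_int \<Rightarrow> 'p padic_int) \<Rightarrow> 'p padic_int set \<Rightarrow> bool" where
  "padic_ergodic_on f S \<longleftrightarrow> (let \<mu> = normalized_haar_on S in
     f ` S \<subseteq> S \<and> f \<in> measurable \<mu> \<mu> \<and> distr \<mu> \<mu> f = \<mu> \<and>
     (\<forall>A\<in>sets \<mu>. f -` A \<inter> S = A \<longrightarrow> emeasure \<mu> A \<in> {0, 1}))"

end

(*
The unit sphere {u. p does not divide u} parametrises the sphere of radius p^-r around y by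
u |-> y + p^r u, and f becomes g u = (f (y + p^r u) - y) / p^r on it. Taylor expansion gives
g u = g 0 + d u + c p^r u^2 + O(p^(2r)) with d = f'(y).

For a 1-Lipschitz map preserving a sphere, ergodicity is equivalent to transitivity on residues modulo
p^n for every n. Transitivity lifts: if N is the return time of 1 modulo p^k, g^N 1 = 1 + p^k e with a
unit e, and (g^N)' is 1 modulo p (modulo 4 if p = 2), then g^N moves 1 + p^k t to
1 + p^k (e + s t + ...), so that it permutes the p classes modulo p^(k+1) cyclically and
(g^N)^p 1 = 1 + p^(k+1) e' with e' congruent to e modulo p. It therefore suffices to decide transitivity
modulo p^2 (modulo 8 if p = 2). If p is odd, then g 0 must vanish modulo p, and the quadratic term does
not affect g^(p-1) 1 modulo p^2, because the sums of d^j and of d^(-j) over j < p - 1 vanish modulo p;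
thus g is transitive modulo p^2 exactly when u |-> d u is.
*)

theory Submission
  imports Defs
begin

text \<open>The class enters only by truncation: modulo p^n a function of the class and its
  derivative agree with one polynomial over \<int>_p and its formal derivative. Hence the quadratic
  Taylor coefficient is a p-adic integer although f''/2 involves a division. Iterates are never
  computed. \<open>near_affine\<close> records that the slope at every point is d modulo p^r, with
  an error that survives composition, so a return map g^N can be linearised with slope d^N. The
  prime 2 stands apart because 1 + s + ... + s^(p-1) is p modulo p^2 for odd p as soon as s is 1
  modulo p, whereas 1 + s is 2 modulo 4 only if s is 1 modulo 4. Transitivity modulo 4 still admits
  d = 3 modulo 4, and only the level 8 excludes it. For odd p the vanishing of the two power sums
  requires d to differ from 1 modulo p. This is automatic: otherwise the orbit of 1 under
  multiplication by d would never reach -1. On the measure side, the passage from onto to one-to-one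
  is made on finite sets of residues, where a surjective self-map is a permutation.\<close>

section \<open>Divisibility by powers of the uniformizer, and coherent limits\<close>

abbreviation (input) unif :: "'p::prime_card padic_int" where
  "unif \<equiv> of_nat CARD('p)"

text \<open>Links the two forms of a congruence: divisibility serves sums and products, while
  equality of residues lets chains of congruences be closed by rewriting.\<close>

lemma unif_dvd_diff_iff:
  fixes x y :: "'p::prime_card padic_int"
  shows "unif ^ n dvd x - y \<longleftrightarrow> padic_res x n = padic_res y n"
  by (simp add: padic_p_power_dvd_iff mod_eq_0_iff_dvd flip: mod_eq_dvd_iff)
     (simp add: padic_res_mod_self)

lemma unif_nonzero [simp]: "(unif :: 'p::prime_card padic_int) \<noteq> 0"
  using p_gt_1[where 'p='p] by simp

lemma unif_not_dvd_one: "\<not> (unif :: 'p::prime_card padic_int) dvd 1"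
  using padic_p_power_dvd_iff[of 1 "1 :: 'p padic_int"] p_gt_1[where 'p='p] by simp

lemma prime_unif:
  fixes x y :: "'p::prime_card padic_int"
  shows "unif dvd x * y \<longleftrightarrow> unif dvd x \<or> unif dvd y"
proof -
  have dvd: "unif dvd z \<longleftrightarrow> int CARD('p) dvd padic_res z 1" for z :: "'p padic_int"
  proof -
    have "padic_res z 1 mod int CARD('p) = padic_res z 1" using padic_res_mod_self[of z 1] by simp
    then show ?thesis using padic_p_power_dvd_iff[of 1 z] by (metis dvd_eq_mod_eq_0 power_one_right)
  qed
  have "int CARD('p) dvd padic_res (x * y) 1 \<longleftrightarrow> int CARD('p) dvd padic_res x 1 * padic_res y 1"
    by (metis dvd_mod_iff dvd_refl padic_res_simps(6) power_one_right)
  then show ?thesis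
    unfolding dvd using prime_dvd_mult_iff[OF prime_card_int[where 'a='p]] by simp
qed

lemma unif_dvd_power_iff:
  fixes x :: "'p::prime_card padic_int"
  shows "unif dvd x ^ k \<longleftrightarrow> k > 0 \<and> unif dvd x"
  by (induction k) (auto simp: prime_unif unif_not_dvd_one)

lemma unif_power_dvd_mult_iff:
  fixes u x :: "'p::prime_card padic_int"
  assumes "\<not> unif dvd u"
  shows "unif ^ n dvd u * x \<longleftrightarrow> unif ^ n dvd x"
proof (induction n arbitrary: x)
  case (Suc n)
  show ?case
  proof
    assume *: "unif ^ Suc n dvd u * x"
    then have "unif dvd u * x" by (metis dvd_mult_left power_Suc)
    then obtain z where z: "x = unif * z" using assms by (auto simp: prime_unif elim: dvdE)
    with * have "unif * unif ^ n dvd unif * (u * z)" by (simp add: mult.left_commute)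
    then have "unif ^ n dvd z" using Suc.IH by (simp only: dvd_mult_cancel_left unif_nonzero simp_thms)
    then show "unif ^ Suc n dvd x" by (simp add: z mult_dvd_mono)
  qed simp
qed simp

lemma unif_power_dvd_of_nat_iff:
  "(unif :: 'p::prime_card padic_int) ^ n dvd of_nat k \<longleftrightarrow> CARD('p) ^ n dvd k"
proof -
  have "(unif :: 'p padic_int) ^ n dvd of_nat k \<longleftrightarrow> int k mod int (CARD('p) ^ n) = 0"
    by (simp add: padic_p_power_dvd_iff)
  also have "\<dots> \<longleftrightarrow> k mod CARD('p) ^ n = 0" by (metis of_nat_eq_0_iff of_nat_mod)
  finally show ?thesis by (simp add: dvd_eq_mod_eq_0)
qed

lemma padic_eq_0I:
  fixes x :: "'p::prime_card padic_int"
  assumes "\<And>n. unif ^ n dvd x"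
  shows "x = 0"
  using assms by (simp add: padic_eq_iff padic_p_power_dvd_iff)

text \<open>The diagonal of the residues of \<open>s n\<close> modulo p^n is coherent, so it is
  itself an element of the inverse limit.\<close>

lemma padic_complete:
  fixes s :: "nat \<Rightarrow> 'p::prime_card padic_int"
  assumes "\<And>n. unif ^ n dvd s (Suc n) - s n"
  shows "\<exists>l. \<forall>n. unif ^ n dvd l - s n"
proof -
  have "padic_res (s n) n = padic_res (s (Suc n)) (Suc n) mod int CARD('p) ^ n" for n
    using assms[of n] by (simp add: unif_dvd_diff_iff padic_res_Suc_mod)
  then have "padic_res (Abs_padic_int (\<lambda>n. padic_res (s n) n) :: 'p padic_int) n = padic_res (s n) n" for n
    by (rule padic_res_Abs)
  then show ?thesis unfolding unif_dvd_diff_iff by blast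
qed

text \<open>Convergence makes some far partial sum congruent to the limit, and the terms between the
  two partial sums are all divisible by p^n.\<close>

lemma padic_sums_partial:
  fixes t :: "nat \<Rightarrow> 'p::prime_card padic_int"
  assumes "t sums l" "\<And>i. i \<ge> N \<Longrightarrow> unif ^ n dvd t i"
  shows "unif ^ n dvd l - (\<Sum>i<N. t i)"
proof -
  have "eventually (\<lambda>k. dist (\<Sum>i<k. t i) l < 1 / real CARD('p) ^ n) sequentially"
    using assms(1) p_gt_1[where 'p='p] unfolding sums_def by (intro tendstoD) auto
  then obtain K where K: "\<And>k. k \<ge> K \<Longrightarrow> dist (\<Sum>i<k. t i) l < 1 / real CARD('p) ^ n"
    unfolding eventually_sequentially by blast
  define k where "k = max K N"
  have "unif ^ n dvd l - (\<Sum>i<k. t i)"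
    using K[of k] by (simp add: unif_dvd_diff_iff k_def flip: padic_dist_le_iff)
       (simp add: dist_commute)
  moreover have "(\<Sum>i<k. t i) = (\<Sum>i<N. t i) + (\<Sum>i=N..<k. t i)"
    by (simp add: k_def lessThan_atLeast0 sum.atLeastLessThan_concat)
  moreover have "unif ^ n dvd (\<Sum>i=N..<k. t i)" using assms(2) by (intro dvd_sum) auto
  ultimately show ?thesis
    by (simp add: diff_diff_eq[symmetric] dvd_diff_left_iff)
qed

section \<open>Taylor expansion in \<open>\<B>\<close>\<close>

definition falling_poly :: "nat \<Rightarrow> 'a::comm_ring_1 poly" where
  "falling_poly i = (\<Prod>j<i. [:- of_nat j, 1:])"

lemma poly_falling_poly: "poly (falling_poly i) x = (\<Prod>j<i. x - of_nat j)"
  by (simp add: falling_poly_def poly_prod)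

text \<open>Any p consecutive factors x - j contain a multiple of p, so m blocks contribute p^m. The
  product rule differentiates one factor and thus spoils at most one block.\<close>

lemma falling_poly_multiple_dvd:
  fixes x :: "'p::prime_card padic_int"
  shows "unif ^ m dvd poly (falling_poly (m * CARD('p))) x \<and>
    unif ^ (m - 1) dvd poly (pderiv (falling_poly (m * CARD('p)))) x"
proof (induction m)
  case (Suc m)
  define R :: "'p padic_int poly" where
    "R = (\<Prod>j\<in>{m * CARD('p)..<Suc m * CARD('p)}. [:- of_nat j, 1:])"
  have F: "falling_poly (Suc m * CARD('p)) = falling_poly (m * CARD('p)) * R"
    by (simp add: falling_poly_def R_def lessThan_atLeast0 prod.atLeastLessThan_concat)
  have "unif dvd poly R x"
  proof -
    define a where "a = padic_res (x - of_nat (m * CARD('p))) 1"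
    have a: "0 \<le> a" "a < int CARD('p)"
      using padic_res_range[of "x - of_nat (m * CARD('p))" 1] by (auto simp: a_def)
    define j where "j = m * CARD('p) + nat a"
    have j: "j \<in> {m * CARD('p)..<Suc m * CARD('p)}" using a by (auto simp: j_def nat_less_iff)
    have "padic_res (x - of_nat (m * CARD('p))) 1 = padic_res (of_nat (nat a) :: 'p padic_int) 1"
      unfolding a_def[symmetric] using a by simp
    then have "unif ^ 1 dvd (x - of_nat (m * CARD('p))) - of_nat (nat a)"
      unfolding unif_dvd_diff_iff .
    then have "unif dvd poly [:- of_nat j, 1:] x" by (simp add: j_def algebra_simps)
    also have "poly [:- of_nat j, 1:] x dvd poly R x"
      unfolding R_def poly_prod using j by (intro dvd_prodI) auto
    finally show ?thesis .
  qed
  then have "unif ^ Suc m dvd poly (falling_poly (Suc m * CARD('p))) x"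
    using Suc.IH unfolding F poly_mult power_Suc2 by (blast intro: mult_dvd_mono)
  moreover have "unif ^ m dvd poly (pderiv (falling_poly (Suc m * CARD('p)))) x"
  proof -
    have "unif ^ m dvd poly (pderiv (falling_poly (m * CARD('p)))) x * poly R x"
    \<comment> \<open>For positive m the factor p of R raises the exponent m - 1 of the induction
      hypothesis to m; for m = 0 only divisibility by 1 is claimed.\<close>
    proof (cases m)
      case (Suc m')
      have "unif ^ Suc m' dvd poly (pderiv (falling_poly (m * CARD('p)))) x * poly R x"
        unfolding power_Suc2 using Suc.IH \<open>unif dvd poly R x\<close> by (intro mult_dvd_mono) (auto simp: Suc)
      then show ?thesis by (simp only: Suc)
    qed simp
    then show ?thesis using Suc.IH unfolding F by (simp add: pderiv_mult dvd_add mult.commute)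
  qed
  ultimately show ?case by simp
qed simp

text \<open>One block more than n is demanded because the derivative may lose one.\<close>

lemma falling_poly_dvd:
  fixes x :: "'p::prime_card padic_int"
  assumes "Suc n * CARD('p) \<le> i"
  shows "unif ^ n dvd poly (falling_poly i) x" "unif ^ n dvd poly (pderiv (falling_poly i)) x"
proof -
  let ?R = "\<Prod>j\<in>{Suc n * CARD('p)..<i}. [:- of_nat j, 1:] :: 'p padic_int poly"
  have F: "falling_poly i = falling_poly (Suc n * CARD('p)) * ?R"
    using assms by (simp add: falling_poly_def lessThan_atLeast0 prod.atLeastLessThan_concat)
  have 1: "unif ^ n dvd poly (falling_poly (Suc n * CARD('p))) x"
    using falling_poly_multiple_dvd[of "Suc n" x] by (metis dvd_mult_right power_Suc)
  have 2: "unif ^ n dvd poly (pderiv (falling_poly (Suc n * CARD('p)))) x"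
    using falling_poly_multiple_dvd[of "Suc n" x] by simp
  show "unif ^ n dvd poly (falling_poly i) x" using 1 unfolding F by simp
  show "unif ^ n dvd poly (pderiv (falling_poly i)) x" using 1 2 unfolding F by (simp add: pderiv_mult)
qed

text \<open>The tails of the series and of its termwise derivative vanish modulo p^n at all points
  at once, so a single truncation serves both. The function \<open>f'\<close> is the coherent limit
  of the derivatives of the truncations.\<close>

lemma class_B_poly_approx:
  fixes f :: "'p::prime_card padic_int \<Rightarrow> 'p padic_int"
  assumes "f \<in> class_B"
  obtains f' where "\<And>n. \<exists>q. \<forall>x. unif ^ n dvd f x - poly q x \<and> unif ^ n dvd f' x - poly (pderiv q) x"
proof -
  obtain b where b: "\<And>x. (\<lambda>i. b i * (\<Prod>j<i. x - of_nat j)) sums f x"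
    using assms unfolding class_B_iff_falling by blast
  define q where "q n = (\<Sum>i<Suc n * CARD('p). Polynomial.smult (b i) (falling_poly i))" for n
  have val: "unif ^ n dvd f x - poly (q n) x" for n x
  proof -
    have "poly (q n) x = (\<Sum>i<Suc n * CARD('p). b i * (\<Prod>j<i. x - of_nat j))"
      by (simp add: q_def poly_sum poly_falling_poly)
    then show ?thesis
      using padic_sums_partial[OF b[of x], of "Suc n * CARD('p)" n] falling_poly_dvd(1)[of n _ x]
      by (simp add: poly_falling_poly)
  qed
  have "unif ^ n dvd poly (pderiv (q (Suc n))) x - poly (pderiv (q n)) x" for n x
  proof -
    have "q (Suc n) = q n + (\<Sum>i=Suc n * CARD('p)..<Suc (Suc n) * CARD('p). Polynomial.smult (b i) (falling_poly i))"
      by (simp add: q_def lessThan_atLeast0 sum.atLeastLessThan_concat)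
    moreover have "unif ^ n dvd
       (\<Sum>i=Suc n * CARD('p)..<Suc (Suc n) * CARD('p). b i * poly (pderiv (falling_poly i)) x)"
      by (intro dvd_sum dvd_mult falling_poly_dvd(2)) auto
    ultimately show ?thesis by (simp add: pderiv_add pderiv_sum Polynomial.pderiv_smult poly_sum)
  qed
  then have "\<exists>l. \<forall>n. unif ^ n dvd l - poly (pderiv (q n)) x" for x by (rule padic_complete)
  then obtain f' where "\<And>x n. unif ^ n dvd f' x - poly (pderiv (q n)) x" by metis
  with val that show ?thesis by blast
qed

text \<open>Induction on the coefficients produces c, half the second derivative, without dividing
  by 2. The order of the quantifiers matters: c is independent of h, while e may vary with
  it.\<close>

lemma poly_taylor3:
  fixes q :: "'a::idom poly"
  shows "\<exists>c. \<forall>h. \<exists>e. poly q (x + h) = poly q x + poly (pderiv q) x * h + c * h ^ 2 + e * h ^ 3"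
proof (induction q)
  case 0
  show ?case by (auto intro: exI[of _ 0])
next
  case (pCons a q)
  then obtain c e where ce: "\<And>h. poly q (x + h) = poly q x + poly (pderiv q) x * h + c * h ^ 2 + e h * h ^ 3"
    by metis
  have "poly (pCons a q) (x + h) = poly (pCons a q) x + poly (pderiv (pCons a q)) x * h
      + (x * c + poly (pderiv q) x) * h ^ 2 + (x * e h + c + h * e h) * h ^ 3" for h
  proof -
    have "poly (pCons a q) (x + h) = a + (x + h) * (poly q x + poly (pderiv q) x * h + c * h ^ 2 + e h * h ^ 3)"
      by (simp add: ce)
    then show ?thesis
      by (simp add: pderiv_pCons algebra_simps power2_eq_square power3_eq_cube)
  qed
  then show ?case by blast
qed

lemma poly_diff_dvd: "(h :: 'a::idom) dvd poly q (x + h) - poly q x"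
proof -
  obtain c where c: "\<And>h. \<exists>e. poly q (x + h) = poly q x + poly (pderiv q) x * h + c * h ^ 2 + e * h ^ 3"
    using poly_taylor3 by blast
  obtain e where "poly q (x + h) = poly q x + poly (pderiv q) x * h + c * h ^ 2 + e * h ^ 3"
    using c by blast
  then have "poly q (x + h) - poly q x = h * (poly (pderiv q) x + c * h + e * h ^ 2)"
    by (simp add: algebra_simps power2_eq_square power3_eq_cube)
  then show ?thesis by simp
qed

text \<open>Both facts are inherited from a polynomial approximating to the precision in question.
  The coefficient c belongs to that polynomial and so may depend on n; later uses work at one fixed
  precision.\<close>

lemma class_B_taylor_exists:
  fixes f :: "'p::prime_card padic_int \<Rightarrow> 'p padic_int"
  assumes "f \<in> class_B"
  obtains f' where
    "\<And>x n. \<exists>c. \<forall>h. \<exists>e. unif ^ n dvd f (x + h) - f x - f' x * h - c * h ^ 2 - e * h ^ 3"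
    "\<And>x h m. unif ^ m dvd h \<Longrightarrow> unif ^ m dvd f' (x + h) - f' x"
proof -
  obtain f' where f': "\<And>n. \<exists>q. \<forall>x. unif ^ n dvd f x - poly q x \<and> unif ^ n dvd f' x - poly (pderiv q) x"
    using class_B_poly_approx[OF assms] by blast
  show ?thesis
  proof
    fix x n
    obtain q where q: "\<And>x. unif ^ n dvd f x - poly q x" "\<And>x. unif ^ n dvd f' x - poly (pderiv q) x"
      using f' by blast
    obtain c where c: "\<And>h. \<exists>e. poly q (x + h) = poly q x + poly (pderiv q) x * h + c * h ^ 2 + e * h ^ 3"
      using poly_taylor3 by blast
    have "\<exists>e. unif ^ n dvd f (x + h) - f x - f' x * h - c * h ^ 2 - e * h ^ 3" for h
    proof -
      obtain e where "poly q (x + h) = poly q x + poly (pderiv q) x * h + c * h ^ 2 + e * h ^ 3"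
        using c by blast
      then have "f (x + h) - f x - f' x * h - c * h ^ 2 - e * h ^ 3 =
          (f (x + h) - poly q (x + h)) - (f x - poly q x) - (f' x - poly (pderiv q) x) * h"
        by (simp add: algebra_simps)
      then show ?thesis using q by (metis dvd_diff dvd_mult2)
    qed
    then show "\<exists>c. \<forall>h. \<exists>e. unif ^ n dvd f (x + h) - f x - f' x * h - c * h ^ 2 - e * h ^ 3" by blast
  next
    fix x h :: "'p padic_int" and m
    assume h: "unif ^ m dvd h"
    obtain q where q: "\<And>x. unif ^ m dvd f' x - poly (pderiv q) x"
      using f' by blast
    have "unif ^ m dvd (f' (x + h) - poly (pderiv q) (x + h)) - (f' x - poly (pderiv q) x)
        + (poly (pderiv q) (x + h) - poly (pderiv q) x)"
      by (rule dvd_add[OF dvd_diff[OF q q] dvd_trans[OF h poly_diff_dvd]])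
    then show "unif ^ m dvd f' (x + h) - f' x" by (simp add: algebra_simps)
  qed
qed

section \<open>Uniqueness of the derivative and its identification\<close>

lemma padic_norm_pos: "h \<noteq> 0 \<Longrightarrow> padic_norm h > 0"
  for h :: "'p::prime_card padic_int"
  using p_gt_1[where 'p='p] by (simp add: padic_norm_def)

lemma padic_norm_nonneg [simp]: "padic_norm h \<ge> 0"
  for h :: "'p::prime_card padic_int"
  by (simp add: padic_norm_def)

lemma padic_norm_power_obtain:
  fixes h :: "'p::prime_card padic_int"
  assumes "h \<noteq> 0"
  obtains m where "padic_norm h = 1 / real CARD('p) ^ m" "unif ^ m dvd h"
  using assms padic_norm_le_iff[of h "padic_val h"] by (auto simp: padic_norm_def)

text \<open>Supplies nonzero test increments p^k at which two candidate derivatives can be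
  compared.\<close>

lemma eventually_at_zero_imp_powers:
  fixes P :: "'p::prime_card padic_int \<Rightarrow> bool"
  assumes "eventually P (at 0)"
  shows "\<exists>N. \<forall>k\<ge>N. P (unif ^ k)"
proof -
  obtain e where e: "e > 0" "\<And>x. x \<noteq> 0 \<Longrightarrow> dist x 0 < e \<Longrightarrow> P x"
    using assms unfolding eventually_at by auto
  obtain N where N: "1 / real CARD('p) ^ N < e" using padic_power_small[OF e(1)] by blast
  have "P (unif ^ k)" if "k \<ge> N" for k
  proof (rule e(2))
    have "padic_norm (unif ^ k :: 'p padic_int) \<le> 1 / real CARD('p) ^ N"
      unfolding padic_norm_le_iff using that by (rule le_imp_power_dvd)
    then show "dist (unif ^ k :: 'p padic_int) 0 < e" using N by (simp add: dist_padic_int_def)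
  qed simp
  then show ?thesis by blast
qed

text \<open>Choose j such that p^j does not divide d - d'. At a suitable increment p^k both
  remainders are divisible by p^(k + j), hence so is their difference (d - d') p^k, a contradiction.
  This gives the description in \<open>padic_deriv\<close> its meaning.\<close>

lemma has_padic_derivative_unique:
  fixes f :: "'p::prime_card padic_int \<Rightarrow> 'p padic_int"
  assumes "has_padic_derivative f d y" "has_padic_derivative f d' y"
  shows "d = d'"
proof (rule ccontr)
  assume "d \<noteq> d'"
  then obtain j where j: "\<not> unif ^ j dvd d - d'" using padic_eq_0I[of "d - d'"] by auto
  define \<epsilon> where "\<epsilon> = 1 / real CARD('p) ^ j"
  have p1: "real CARD('p) > 1" using p_gt_1[where 'p='p] by simp
  have ev: "eventually (\<lambda>h. padic_norm (f (y + h) - f y - c * h) / padic_norm h < \<epsilon>) (at 0)"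
    if "has_padic_derivative f c y" for c
  proof -
    have "\<epsilon> > 0" using p1 by (simp add: \<epsilon>_def)
    then have "eventually (\<lambda>h. dist (padic_norm (f (y + h) - f y - c * h) / padic_norm h) 0 < \<epsilon>) (at 0)"
      using that tendstoD unfolding has_padic_derivative_def by blast
    then show ?thesis by (rule eventually_mono) auto
  qed
  obtain k where k: "padic_norm (f (y + unif ^ k) - f y - d * unif ^ k) / padic_norm (unif ^ k :: 'p padic_int) < \<epsilon>"
      "padic_norm (f (y + unif ^ k) - f y - d' * unif ^ k) / padic_norm (unif ^ k :: 'p padic_int) < \<epsilon>"
    using eventually_at_zero_imp_powers[OF eventually_conj[OF ev[OF assms(1)] ev[OF assms(2)]]] by blast
  have le: "padic_norm z \<le> 1 / real CARD('p) ^ (k + j)"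
    if "padic_norm z / padic_norm (unif ^ k :: 'p padic_int) < \<epsilon>" for z :: "'p padic_int"
  proof -
    have "padic_norm z < \<epsilon> * padic_norm (unif ^ k :: 'p padic_int)"
      using that padic_norm_pos[of "unif ^ k :: 'p padic_int"] by (simp add: field_simps)
    also have "\<dots> \<le> \<epsilon> * (1 / real CARD('p) ^ k)"
      using p1 by (intro mult_left_mono) (auto simp: padic_norm_le_iff \<epsilon>_def)
    finally show ?thesis by (simp add: \<epsilon>_def power_add mult.commute)
  qed
  have "unif ^ (k + j) dvd (f (y + unif ^ k) - f y - d' * unif ^ k) - (f (y + unif ^ k) - f y - d * unif ^ k)"
    using le[OF k(2)] le[OF k(1)] unfolding padic_norm_le_iff by (rule dvd_diff)
  then have "unif ^ k * unif ^ j dvd unif ^ k * (d - d')" by (simp add: algebra_simps power_add)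
  then show False using j by simp
qed

lemma has_padic_derivativeI:
  fixes f :: "'p::prime_card padic_int \<Rightarrow> 'p padic_int"
  assumes "\<And>m h. unif ^ m dvd h \<Longrightarrow> unif ^ (2 * m) dvd f (y + h) - f y - d * h"
  shows "has_padic_derivative f d y"
  unfolding has_padic_derivative_def
proof (rule tendstoI)
  fix e :: real assume "e > 0"
  have "padic_norm (f (y + h) - f y - d * h) / padic_norm h < e" if h: "h \<noteq> 0" "dist h 0 < e" for h
  proof -
    obtain m where m: "padic_norm h = 1 / real CARD('p) ^ m" "unif ^ m dvd h"
      using padic_norm_power_obtain h(1) by blast
    have "padic_norm (f (y + h) - f y - d * h) \<le> 1 / real CARD('p) ^ (2 * m)"
      unfolding padic_norm_le_iff by (rule assms[OF m(2)])
    also have "\<dots> = padic_norm h * padic_norm h" by (simp add: m power_add mult_2)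
    finally have "padic_norm (f (y + h) - f y - d * h) / padic_norm h \<le> padic_norm h"
      using padic_norm_pos[OF h(1)] by (simp add: field_simps)
    then show ?thesis using h(2) by (simp add: dist_padic_int_def)
  qed
  then show "eventually (\<lambda>h. dist (padic_norm (f (y + h) - f y - d * h) / padic_norm h) 0 < e) (at 0)"
    using \<open>e > 0\<close> unfolding eventually_at by auto
qed

lemma class_B_taylor:
  fixes f :: "'p::prime_card padic_int \<Rightarrow> 'p padic_int"
  assumes "f \<in> class_B"
  shows "\<exists>c. \<forall>h. \<exists>e. unif ^ n dvd f (x + h) - f x - padic_deriv f x * h - c * h ^ 2 - e * h ^ 3"
    and "unif ^ m dvd h \<Longrightarrow> unif ^ m dvd padic_deriv f (x + h) - padic_deriv f x"
proof -
  obtain f' where f':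
    "\<And>x n. \<exists>c. \<forall>h. \<exists>e. unif ^ n dvd f (x + h) - f x - f' x * h - c * h ^ 2 - e * h ^ 3"
    "\<And>x h m. unif ^ m dvd h \<Longrightarrow> unif ^ m dvd f' (x + h) - f' x"
    using class_B_taylor_exists[OF assms] by blast
  have "has_padic_derivative f (f' x) x" for x
  proof (rule has_padic_derivativeI)
    fix m h assume h: "unif ^ m dvd (h :: 'p padic_int)"
    obtain c e where "unif ^ (2 * m) dvd f (x + h) - f x - f' x * h - c * h ^ 2 - e * h ^ 3"
      using f'(1) by meson
    moreover have "unif ^ (2 * m) dvd (c + e * h) * h ^ 2"
      using dvd_power_same[OF h, of 2] by (simp add: power_mult[symmetric] mult.commute[of m] dvd_mult)
    ultimately have "unif ^ (2 * m) dvd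
        (f (x + h) - f x - f' x * h - c * h ^ 2 - e * h ^ 3) + (c + e * h) * h ^ 2"
      by (rule dvd_add)
    then show "unif ^ (2 * m) dvd f (x + h) - f x - f' x * h"
      by (simp add: algebra_simps power2_eq_square power3_eq_cube)
  qed
  then have "padic_deriv f x = f' x" for x
    unfolding padic_deriv_def using has_padic_derivative_unique by blast
  then show "\<exists>c. \<forall>h. \<exists>e. unif ^ n dvd f (x + h) - f x - padic_deriv f x * h - c * h ^ 2 - e * h ^ 3"
    and "unif ^ m dvd h \<Longrightarrow> unif ^ m dvd padic_deriv f (x + h) - padic_deriv f x"
    using f' by auto
qed

text \<open>The terms beyond the linear one combine to (c + e h) h^2, a multiple of p^(2 m). The
  second claim, the Lipschitz property, follows because 2 m is at least m.\<close>

lemma class_B_increment: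
  fixes f :: "'p::prime_card padic_int \<Rightarrow> 'p padic_int"
  assumes "f \<in> class_B" "unif ^ m dvd h"
  shows "unif ^ (2 * m) dvd f (x + h) - f x - padic_deriv f x * h"
    and "unif ^ m dvd f (x + h) - f x"
proof -
  obtain c e where "unif ^ (2 * m) dvd f (x + h) - f x - padic_deriv f x * h - c * h ^ 2 - e * h ^ 3"
    using class_B_taylor(1)[OF assms(1)] by meson
  moreover have "unif ^ (2 * m) dvd (c + e * h) * h ^ 2"
    using dvd_power_same[OF assms(2), of 2] by (simp add: power_mult[symmetric] mult.commute[of m] dvd_mult)
  ultimately have "unif ^ (2 * m) dvd
      (f (x + h) - f x - padic_deriv f x * h - c * h ^ 2 - e * h ^ 3) + (c + e * h) * h ^ 2"
    by (rule dvd_add)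
  then show *: "unif ^ (2 * m) dvd f (x + h) - f x - padic_deriv f x * h"
    by (simp add: algebra_simps power2_eq_square power3_eq_cube)
  have "unif ^ m dvd (f (x + h) - f x - padic_deriv f x * h) + padic_deriv f x * h"
    using * assms(2) by (intro dvd_add dvd_mult) (auto simp: mult_2 power_add dest: dvd_mult_left)
  then show "unif ^ m dvd f (x + h) - f x" by simp
qed

section \<open>Spheres in terms of divisibility\<close>

lemma mem_padic_sphere_iff:
  fixes y z :: "'p::prime_card padic_int"
  shows "z \<in> sphere y (1 / real CARD('p) ^ r) \<longleftrightarrow> unif ^ r dvd z - y \<and> \<not> unif ^ Suc r dvd z - y"
proof -
  have p1: "real CARD('p) > 1" using p_gt_1[where 'p='p] by simp
  show ?thesis
  proof (cases "z = y")
    case True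
    then show ?thesis using p1 by auto
  next
    case False
    then obtain m where m: "padic_norm (z - y) = 1 / real CARD('p) ^ m"
      using padic_norm_power_obtain[of "z - y"] by auto
    have "dist y z = padic_norm (z - y)" by (simp add: dist_commute[of y] flip: dist_padic_int_def)
    then have "z \<in> sphere y (1 / real CARD('p) ^ r) \<longleftrightarrow> m = r"
      using m p1 by simp
    moreover have "unif ^ k dvd z - y \<longleftrightarrow> k \<le> m" for k
    proof -
      have "unif ^ k dvd z - y \<longleftrightarrow> 1 / real CARD('p) ^ m \<le> 1 / real CARD('p) ^ k"
        unfolding padic_norm_le_iff[symmetric] m ..
      also have "\<dots> \<longleftrightarrow> real CARD('p) ^ k \<le> real CARD('p) ^ m"
        using p1 by (simp only: divide_simps) simp
      finally show ?thesis using p1 by (simp only: power_increasing_iff)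
    qed
    ultimately show ?thesis by (metis Suc_n_not_le_n le_antisym not_less_eq_eq order_refl)
  qed
qed

lemma padic_sphere_eq:
  fixes y :: "'p::prime_card padic_int"
  shows "sphere y (1 / real CARD('p) ^ r) = (\<lambda>u. y + unif ^ r * u) ` {u. \<not> unif dvd u}"
proof (intro Set.set_eqI iffI)
  fix z assume "z \<in> sphere y (1 / real CARD('p) ^ r)"
  then have z: "unif ^ r dvd z - y" "\<not> unif ^ Suc r dvd z - y" unfolding mem_padic_sphere_iff by auto
  then obtain u where u: "z - y = unif ^ r * u" by (auto elim: dvdE)
  with z(2) have "\<not> unif dvd u" by (simp add: mult.commute[of unif "unif ^ r"] )
  moreover have "z = y + unif ^ r * u" using u by (simp add: algebra_simps)
  ultimately show "z \<in> (\<lambda>u. y + unif ^ r * u) ` {u. \<not> unif dvd u}" by blast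
next
  fix z assume "z \<in> (\<lambda>u. y + unif ^ r * u) ` {u. \<not> unif dvd u}"
  then obtain u where "z = y + unif ^ r * u" "\<not> unif dvd u" by blast
  then show "z \<in> sphere y (1 / real CARD('p) ^ r)"
    unfolding mem_padic_sphere_iff by (simp add: power_Suc2 del: power_Suc)
qed

section \<open>Lifting transitivity\<close>

lemma padic_fermat:
  fixes a :: "'p::prime_card padic_int"
  assumes "\<not> unif dvd a"
  shows "unif dvd a ^ (CARD('p) - 1) - 1"
proof -
  define A where "A = nat (padic_res a 1)"
  have A: "padic_res a 1 = int A" using padic_res_range(1)[of a 1] by (simp add: A_def)
  have "prime CARD('p)" by (rule prime_card)
  moreover have "\<not> CARD('p) dvd A"
  proof
    assume "CARD('p) dvd A"
    then have "A mod CARD('p) = 0" by simp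
    moreover have "A < CARD('p)" using padic_res_range(2)[of a 1] A by simp
    ultimately have "padic_res a 1 = 0" using A by simp
    then show False using assms padic_p_power_dvd_iff[of 1 a] by simp
  qed
  ultimately have "[A ^ (CARD('p) - 1) = 1] (mod CARD('p))" by (rule fermat_theorem)
  then have "int A ^ (CARD('p) - 1) mod int CARD('p) = 1 mod int CARD('p)"
    by (metis cong_def of_nat_1 of_nat_mod of_nat_power)
  then have "unif ^ 1 dvd a ^ (CARD('p) - 1) - 1"
    unfolding unif_dvd_diff_iff by (simp add: A[simplified])
  then show ?thesis by simp
qed

lemma padic_nat_approx:
  fixes x :: "'p::prime_card padic_int"
  obtains j :: nat where "unif ^ n dvd x - of_nat j"
proof
  show "unif ^ n dvd x - of_nat (nat (padic_res x n))"
    unfolding unif_dvd_diff_iff using padic_res_range[of x n] by (simp add: padic_res_mod_self)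
qed

text \<open>By Fermat, a^(p - 2) inverts a modulo p. The solution is a natural number because in the
  lifting step it counts iterations.\<close>

lemma padic_linear_solve:
  fixes a c :: "'p::prime_card padic_int"
  assumes "\<not> unif dvd a"
  obtains j :: nat where "unif dvd a * of_nat j - c"
proof -
  obtain j :: nat where j: "unif ^ 1 dvd a ^ (CARD('p) - 2) * c - of_nat j"
    using padic_nat_approx by blast
  have "CARD('p) > 1" using p_gt_1[where 'p='p] by simp
  then have *: "a * a ^ (CARD('p) - 2) = a ^ (CARD('p) - 1)"
    by (simp add: numeral_2_eq_2 Suc_diff_Suc flip: power_Suc)
  have "a * of_nat j - c = (a ^ (CARD('p) - 1) - 1) * c - a * (a ^ (CARD('p) - 2) * c - of_nat j)"
    unfolding *[symmetric] by (simp add: algebra_simps)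
  moreover have "unif dvd (a ^ (CARD('p) - 1) - 1) * c - a * (a ^ (CARD('p) - 2) * c - of_nat j)"
    using padic_fermat[OF assms] j by (intro dvd_diff[OF dvd_mult2 dvd_mult]) auto
  ultimately show ?thesis using that by metis
qed

text \<open>
  The rescaling \<open>g u = (f (y + p\<^sup>r u) - y) / p\<^sup>r\<close> of \<open>f\<close> satisfies this with \<open>d = f' y\<close>: its terms
  of order \<open>k \<ge> 2\<close> carry a factor \<open>p\<close> to the power \<open>r (k - 1)\<close>.
\<close>

definition near_affine ::
    "nat \<Rightarrow> 'p::prime_card padic_int \<Rightarrow> ('p padic_int \<Rightarrow> 'p padic_int) \<Rightarrow> bool" where
  "near_affine r d g \<longleftrightarrow> (\<exists>g'. \<forall>u. unif ^ r dvd g' u - d \<and>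
     (\<forall>m h. unif ^ m dvd h \<longrightarrow> unif ^ (r + 2 * m) dvd g (u + h) - g u - g' u * h))"

lemma near_affine_slope:
  fixes d :: "'p::prime_card padic_int"
  assumes "near_affine r d g"
  shows "\<exists>s. unif ^ r dvd s - d \<and>
    (\<forall>m h. unif ^ m dvd h \<longrightarrow> unif ^ (r + 2 * m) dvd g (u + h) - g u - s * h)"
  using assms unfolding near_affine_def by blast

lemma near_affine_lipschitz:
  fixes d :: "'p::prime_card padic_int"
  assumes "near_affine r d g" "unif ^ m dvd x - y"
  shows "unif ^ m dvd g x - g y"
proof -
  obtain s where s: "unif ^ (r + 2 * m) dvd g (y + (x - y)) - g y - s * (x - y)"
    using near_affine_slope[OF assms(1), of y] assms(2) by blast
  have "unif ^ m dvd (g (y + (x - y)) - g y - s * (x - y)) + s * (x - y)"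
  proof (rule dvd_add)
    show "unif ^ m dvd g (y + (x - y)) - g y - s * (x - y)"
      using s by (rule dvd_trans[rotated]) (simp add: le_imp_power_dvd)
  qed (use assms in simp)
  then show ?thesis by simp
qed

lemma near_affine_linear: "near_affine r d (\<lambda>u. d * u)"
  unfolding near_affine_def by (intro exI[of _ "\<lambda>_. d"]) (simp add: algebra_simps)

text \<open>Chain rule. The error exponent r + 2 m persists because the inner map is Lipschitz: its
  increment is again divisible by p^m, so the outer expansion applies with the same m.\<close>

lemma near_affine_comp:
  fixes d :: "'p::prime_card padic_int"
  assumes g: "near_affine r d g" and k: "near_affine r c k"
  shows "near_affine r (d * c) (\<lambda>u. g (k u))"
proof -
  obtain g' where g': "\<And>u. unif ^ r dvd g' u - d"
      "\<And>u m h. unif ^ m dvd h \<Longrightarrow> unif ^ (r + 2 * m) dvd g (u + h) - g u - g' u * h"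
    using g unfolding near_affine_def by blast
  obtain k' where k': "\<And>u. unif ^ r dvd k' u - c"
      "\<And>u m h. unif ^ m dvd h \<Longrightarrow> unif ^ (r + 2 * m) dvd k (u + h) - k u - k' u * h"
    using k unfolding near_affine_def by blast
  show ?thesis unfolding near_affine_def
  proof (intro exI[of _ "\<lambda>u. g' (k u) * k' u"] allI conjI impI)
    fix u
    have "unif ^ r dvd (g' (k u) - d) * k' u + d * (k' u - c)"
      using g'(1) k'(1) by (intro dvd_add dvd_mult dvd_mult2)
    then show "unif ^ r dvd g' (k u) * k' u - d * c" by (simp add: algebra_simps)
    fix m h assume h: "unif ^ m dvd (h :: 'p padic_int)"
    define h' where "h' = k (u + h) - k u"
    have "unif ^ m dvd h'" unfolding h'_def by (rule near_affine_lipschitz[OF k]) (use h in simp)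
    then have "unif ^ (r + 2 * m) dvd g (k u + h') - g (k u) - g' (k u) * h'" by (rule g'(2))
    moreover have "unif ^ (r + 2 * m) dvd g' (k u) * (h' - k' u * h)"
      unfolding h'_def using k'(2)[OF h] by (rule dvd_mult)
    ultimately have "unif ^ (r + 2 * m) dvd
        (g (k u + h') - g (k u) - g' (k u) * h') + g' (k u) * (h' - k' u * h)"
      by (rule dvd_add)
    then show "unif ^ (r + 2 * m) dvd g (k (u + h)) - g (k u) - g' (k u) * k' u * h"
      by (simp add: h'_def algebra_simps)
  qed
qed

lemma near_affine_funpow:
  assumes "near_affine r d g"
  shows "near_affine r (d ^ n) (g ^^ n)"
proof (induction n)
  case 0
  then show ?case using near_affine_linear[of r 1] by (simp add: id_def)
next
  case (Suc n)
  then show ?case using near_affine_comp[OF assms Suc] by (simp add: comp_def)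
qed

text \<open>Transitivity on units modulo p^n, tested from the single start point 1; periodicity of
  residues extends it to other starting points in \<open>returns_imp_transitive\<close>.\<close>

definition orbit_covers :: "('p::prime_card padic_int \<Rightarrow> 'p padic_int) \<Rightarrow> nat \<Rightarrow> bool" where
  "orbit_covers g n \<longleftrightarrow> (\<forall>b. \<not> unif dvd b \<longrightarrow> (\<exists>i. unif ^ n dvd (g ^^ i) 1 - b))"

text \<open>
  \<open>1 + p\<^sup>l\<int>\<^sub>p\<close> with \<open>l = slope_level\<close> is the largest such group on which \<open>s \<mapsto> (s\<^sup>p - 1) / (s - 1)\<close>
  is \<open>p\<close> modulo \<open>p\<^sup>2\<close>.
\<close>

definition slope_level :: "'p::prime_card itself \<Rightarrow> nat" where
  "slope_level _ = (if CARD('p) = 2 then 2 else 1)"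

lemma slope_level_pos: "slope_level TYPE('p::prime_card) \<ge> 1"
  by (simp add: slope_level_def)

text \<open>Since s^i is 1 + i (s - 1) modulo p^2, the sum is p + (s - 1) p (p - 1) / 2, and for odd
  p the last term has two factors p. For p = 2 the sum is 1 + s, and s = 1 modulo 4 is what is
  needed.\<close>

lemma geometric_sum_mod_unif_square:
  fixes s :: "'p::prime_card padic_int"
  assumes s: "unif ^ slope_level TYPE('p) dvd s - 1"
  shows "unif ^ 2 dvd (\<Sum>i<CARD('p). s ^ i) - unif"
proof (cases "CARD('p) = 2")
  case True
  then show ?thesis using s by (simp add: slope_level_def numeral_2_eq_2)
next
  case False
  have odd: "odd CARD('p)" using False prime_card[where 'a='p] prime_odd_nat by (metis primes_dvd_imp_eq two_is_prime_nat)
  have s1: "unif dvd s - 1" using s False by (simp add: slope_level_def)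
  have s2: "unif ^ 2 dvd (s - 1) ^ 2" using s1 by (rule dvd_power_same)
  have pow: "unif ^ 2 dvd s ^ i - 1 - of_nat i * (s - 1)" for i
  proof (induction i)
    case (Suc i)
    have "unif ^ 2 dvd s * (s ^ i - 1 - of_nat i * (s - 1)) + of_nat i * (s - 1) ^ 2"
      using Suc s2 by (intro dvd_add dvd_mult)
    then show ?case by (simp add: algebra_simps power2_eq_square)
  qed simp
  have "unif ^ 2 dvd (\<Sum>i<CARD('p). s ^ i - 1 - of_nat i * (s - 1))"
    using pow by (intro dvd_sum)
  also have "(\<Sum>i<CARD('p). s ^ i - 1 - of_nat i * (s - 1)) =
      (\<Sum>i<CARD('p). s ^ i) - unif - of_nat (\<Sum>i<CARD('p). i) * (s - 1)"
    by (simp add: sum_subtractf sum_distrib_right)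
  finally have 1: "unif ^ 2 dvd (\<Sum>i<CARD('p). s ^ i) - unif - of_nat (\<Sum>i<CARD('p). i) * (s - 1)" .
  have "2 * (\<Sum>i<CARD('p). i) = CARD('p) * (CARD('p) - 1)"
    using gauss_sum_nat[of "CARD('p) - 1"] odd
    by (simp add: lessThan_Suc_atMost[symmetric] atMost_atLeast0[symmetric] mult.commute)
  then have "CARD('p) dvd 2 * (\<Sum>i<CARD('p). i)" by simp
  then have "CARD('p) dvd (\<Sum>i<CARD('p). i)"
    using odd by (subst (asm) coprime_dvd_mult_right_iff) auto
  then have "(unif :: 'p padic_int) dvd of_nat (\<Sum>i<CARD('p). i)" by (simp only: unif_power_dvd_of_nat_iff[of 1, unfolded power_one_right])
  then have "unif ^ 2 dvd of_nat (\<Sum>i<CARD('p). i) * (s - 1)"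
    using s1 by (simp only: power2_eq_square mult_dvd_mono)
  with 1 have "unif ^ 2 dvd ((\<Sum>i<CARD('p). s ^ i) - unif - of_nat (\<Sum>i<CARD('p). i) * (s - 1)) + of_nat (\<Sum>i<CARD('p). i) * (s - 1)"
    by (rule dvd_add)
  then show ?thesis by (simp only: diff_add_cancel)
qed

lemma one_diff_dvd_power: "(x :: 'a::comm_ring_1) - 1 dvd x ^ n - 1"
  by (simp add: power_diff_1_eq)

text \<open>
  The \<open>N\<close>-th iterate maps \<open>1\<close> to a point at distance exactly \<open>p\<^sup>-\<^sup>k\<close> from it, with derivative close
  to \<open>1\<close>; its \<open>p\<close>-th power then does the same one level deeper.
\<close>

definition returns_at_level ::
    "nat \<Rightarrow> 'p::prime_card padic_int \<Rightarrow> ('p padic_int \<Rightarrow> 'p padic_int) \<Rightarrow> bool" where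
  "returns_at_level k d g \<longleftrightarrow> orbit_covers g k \<and>
     (\<exists>N\<ge>1. \<exists>e. unif ^ slope_level TYPE('p) dvd d ^ N - 1 \<and> \<not> unif dvd e \<and> (g ^^ N) 1 = 1 + unif ^ k * e)"

text \<open>In the coordinate t given by G^j 1 = 1 + p^k t, the return map G = g^N acts modulo p^2
  as t |-> e + s t, so \<open>t j\<close> is e (1 + s + ... + s^(j-1)). Modulo p this is e j, which
  runs through all residues; at j = p it is e p modulo p^2, so the unit part of the next
  displacement is again e modulo p.\<close>

lemma returns_at_level_Suc:
  fixes d :: "'p::prime_card padic_int"
  assumes g: "near_affine r d g" and r: "r \<ge> slope_level TYPE('p)" and "k \<ge> 1"
    and ret: "returns_at_level k d g"
  shows "returns_at_level (Suc k) d g"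
proof -
  obtain N e where N: "N \<ge> 1" "unif ^ slope_level TYPE('p) dvd d ^ N - 1"
    and e: "\<not> unif dvd e" "(g ^^ N) 1 = 1 + unif ^ k * e" and cov: "orbit_covers g k"
    using ret unfolding returns_at_level_def by blast
  have r1: "r \<ge> 1" using r slope_level_pos[where 'p='p] by linarith
  define G where "G = g ^^ N"
  have G: "near_affine r (d ^ N) G" unfolding G_def by (rule near_affine_funpow[OF g])
  obtain s where sd: "unif ^ r dvd s - d ^ N"
    and s: "\<And>m h. unif ^ m dvd h \<Longrightarrow> unif ^ (r + 2 * m) dvd G (1 + h) - G 1 - s * h"
    using near_affine_slope[OF G, of 1] by blast
  have "unif ^ slope_level TYPE('p) dvd (s - d ^ N) + (d ^ N - 1)"
    using power_le_dvd[OF sd r] N(2) by (rule dvd_add)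
  then have s1: "unif ^ slope_level TYPE('p) dvd s - 1" by simp
  then have s1': "unif dvd s - 1"
    using slope_level_pos[where 'p='p] power_le_dvd[of unif "slope_level TYPE('p)" "s - 1" 1] by simp
  have "unif ^ k dvd (G ^^ j) 1 - 1" for j
  proof (induction j)
    case (Suc j)
    have "unif ^ k dvd (G ((G ^^ j) 1) - G 1) + (G 1 - 1)"
      using near_affine_lipschitz[OF G Suc] e(2) by (intro dvd_add) (auto simp: G_def)
    then show ?case by simp
  qed simp
  then have "\<exists>t. (G ^^ j) 1 - 1 = unif ^ k * t" for j by (simp add: dvd_def)
  then obtain t where "\<And>j. (G ^^ j) 1 - 1 = unif ^ k * t j" by metis
  then have t: "(G ^^ j) 1 = 1 + unif ^ k * t j" for j by (metis add.commute diff_add_cancel)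
  have "unif ^ k * t 0 = 0" using t[of 0] by simp
  then have t0: "t 0 = 0" by simp
  \<comment> \<open>Dividing the error p^(r + 2 k) by p^k leaves p^(r + k), and r + k is at least 2
    because r and k are at least 1.\<close>
  have step: "unif ^ 2 dvd t (Suc j) - e - s * t j" for j
  proof -
    have "unif ^ (r + 2 * k) dvd G (1 + unif ^ k * t j) - G 1 - s * (unif ^ k * t j)" by (rule s) simp
    moreover have "G (1 + unif ^ k * t j) = 1 + unif ^ k * t (Suc j)"
      using t[of "Suc j"] t[of j] by simp
    moreover have "G 1 = 1 + unif ^ k * e" using e(2) by (simp add: G_def)
    ultimately have "unif ^ k * unif ^ (r + k) dvd unif ^ k * (t (Suc j) - e - s * t j)"
      unfolding mult_2 add.assoc[symmetric] by (simp add: algebra_simps power_add)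
    then have "unif ^ (r + k) dvd t (Suc j) - e - s * t j" by simp
    then show ?thesis using r1 \<open>k \<ge> 1\<close> by (rule_tac power_le_dvd) auto
  qed
  have tj2: "unif ^ 2 dvd t j - e * (\<Sum>i<j. s ^ i)" for j
  proof (induction j)
    case (Suc j)
    have "unif ^ 2 dvd (t (Suc j) - e - s * t j) + s * (t j - e * (\<Sum>i<j. s ^ i))"
      using step Suc by (intro dvd_add dvd_mult)
    moreover have "(\<Sum>i<Suc j. s ^ i) = 1 + s * (\<Sum>i<j. s ^ i)"
      by (simp only: sum.lessThan_Suc_shift) (simp add: sum_distrib_left)
    ultimately show ?case by (simp add: algebra_simps)
  qed (simp add: t0)
  have tj1: "unif dvd t j - e * of_nat j" for j
  proof -
    have "unif dvd (\<Sum>i<j. s ^ i - 1)"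
      using s1' one_diff_dvd_power by (intro dvd_sum) (blast intro: dvd_trans)
    then have "unif dvd (\<Sum>i<j. s ^ i) - of_nat j" by (simp add: sum_subtractf)
    moreover have "unif dvd t j - e * (\<Sum>i<j. s ^ i)"
      using tj2[of j] power_le_dvd[of unif 2 _ 1] by simp
    ultimately have "unif dvd (t j - e * (\<Sum>i<j. s ^ i)) + e * ((\<Sum>i<j. s ^ i) - of_nat j)"
      by (intro dvd_add dvd_mult)
    then show ?thesis by (simp add: algebra_simps)
  qed

  have "unif ^ 2 dvd (t CARD('p) - e * (\<Sum>i<CARD('p). s ^ i)) + e * ((\<Sum>i<CARD('p). s ^ i) - unif)"
    using tj2 geometric_sum_mod_unif_square[OF s1] by (intro dvd_add dvd_mult)
  then have "unif ^ 2 dvd t CARD('p) - e * unif" by (simp add: algebra_simps)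
  then obtain z where "t CARD('p) - e * unif = unif ^ 2 * z" by (auto simp: dvd_def)
  then have tp: "t CARD('p) = unif * (e + unif * z)" by (simp add: algebra_simps power2_eq_square)
  have e': "\<not> unif dvd e + unif * z" using e(1) by (simp add: dvd_add_left_iff)
  have "(g ^^ (N * CARD('p))) 1 = 1 + unif ^ Suc k * (e + unif * z)"
    using t[of "CARD('p)"] unfolding G_def funpow_mult tp by (simp add: mult_ac)
  moreover have "unif ^ slope_level TYPE('p) dvd d ^ (N * CARD('p)) - 1"
    unfolding power_mult using N(2) one_diff_dvd_power by (rule dvd_trans)
  moreover have "N * CARD('p) \<ge> 1" using N(1) p_gt_1[where 'p='p] by simp
  \<comment> \<open>First reach b modulo p^k after i steps, then correct the next digit: letting
    these i steps start at G^j 1 instead of 1 shifts the endpoint by s' p^k t j, where s' is d^i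
    modulo p and hence a unit. The count j solves s' e j = -c modulo p.\<close>
  moreover have "orbit_covers g (Suc k)"
    unfolding orbit_covers_def
  proof (intro allI impI)
    fix b :: "'p padic_int" assume "\<not> unif dvd b"
    then obtain i where "unif ^ k dvd (g ^^ i) 1 - b" using cov unfolding orbit_covers_def by blast
    then obtain c where c: "(g ^^ i) 1 - b = unif ^ k * c" by (auto simp: dvd_def)
    obtain s' where s'd: "unif ^ r dvd s' - d ^ i"
      and s': "\<And>m h. unif ^ m dvd h \<Longrightarrow> unif ^ (r + 2 * m) dvd (g ^^ i) (1 + h) - (g ^^ i) 1 - s' * h"
      using near_affine_slope[OF near_affine_funpow[OF g], of i 1] by blast
    have dN: "unif dvd d ^ N - 1"
      using N(2) slope_level_pos[where 'p='p] power_le_dvd[of unif "slope_level TYPE('p)" _ 1] by simp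
    have d: "\<not> unif dvd d"
    proof
      assume "unif dvd d"
      then have "unif dvd d ^ N" using N(1) by (simp add: unif_dvd_power_iff)
      then have "unif dvd d ^ N - (d ^ N - 1)" using dN by (rule dvd_diff)
      then show False using unif_not_dvd_one[where 'p='p] by simp
    qed
    have us': "\<not> unif dvd s'"
    proof
      assume "unif dvd s'"
      moreover have "unif dvd s' - d ^ i" using s'd r1 power_le_dvd[of unif r _ 1] by simp
      ultimately have "unif dvd s' - (s' - d ^ i)" by (rule dvd_diff)
      then show False using d by (simp add: unif_dvd_power_iff)
    qed
    have "\<not> unif dvd s' * e" using us' e(1) by (simp add: prime_unif)
    then obtain j :: nat where j: "unif dvd s' * e * of_nat j - (- c)" by (rule padic_linear_solve)
    have "unif ^ (r + 2 * k) dvd (g ^^ i) (1 + unif ^ k * t j) - (g ^^ i) 1 - s' * (unif ^ k * t j)"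
      by (rule s') simp
    then have 1: "unif ^ Suc k dvd (g ^^ i) (1 + unif ^ k * t j) - (g ^^ i) 1 - s' * (unif ^ k * t j)"
      using r1 by (rule_tac power_le_dvd) auto
    have "unif dvd s' * (t j - e * of_nat j) + (s' * e * of_nat j - (- c))"
      using j tj1 by (intro dvd_add dvd_mult)
    then have "unif dvd s' * t j + c" by (simp add: algebra_simps)
    then have 2: "unif ^ Suc k dvd unif ^ k * (s' * t j + c)" unfolding power_Suc2 by (rule mult_dvd_mono[OF dvd_refl])
    have "(g ^^ (i + N * j)) 1 = (g ^^ i) (1 + unif ^ k * t j)"
      using t[of j] by (simp add: funpow_add G_def funpow_mult)
    then have "(g ^^ (i + N * j)) 1 - b =
        ((g ^^ i) (1 + unif ^ k * t j) - (g ^^ i) 1 - s' * (unif ^ k * t j)) + unif ^ k * (s' * t j + c)"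
      using c by (simp add: algebra_simps)
    also have "unif ^ Suc k dvd \<dots>" using 1 2 by (rule dvd_add)
    finally show "\<exists>i. unif ^ Suc k dvd (g ^^ i) 1 - b" by blast
  qed
  ultimately show ?thesis unfolding returns_at_level_def using e' by blast
qed

lemma returns_at_level_ge:
  fixes d :: "'p::prime_card padic_int"
  assumes "near_affine r d g" "r \<ge> slope_level TYPE('p)" "returns_at_level 1 d g" "k \<ge> 1"
  shows "returns_at_level k d g"
  using assms(4)
  by (induction k rule: dec_induct) (use assms returns_at_level_Suc in auto)

section \<open>Transitivity modulo \<open>p\<^sup>2\<close> and modulo \<open>8\<close>\<close>

lemma near_affine_funpow_lipschitz:
  fixes d :: "'p::prime_card padic_int"
  assumes "near_affine r d g" "unif ^ m dvd x - y"
  shows "unif ^ m dvd (g ^^ i) x - (g ^^ i) y"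
  using near_affine_lipschitz[OF near_affine_funpow[OF assms(1)] assms(2)] .

text \<open>At m = 0 the increment is unrestricted, so the expansion around 0 is valid on all of
  \<int>_p modulo p^r.\<close>

lemma near_affine_mod_unif:
  fixes d :: "'p::prime_card padic_int"
  assumes "near_affine r d g"
  shows "unif ^ r dvd g u - g 0 - d * u"
proof -
  obtain s where s: "unif ^ r dvd s - d" "unif ^ (r + 2 * 0) dvd g (0 + u) - g 0 - s * u"
    using near_affine_slope[OF assms, of 0] by (metis one_dvd power_0)
  then have "unif ^ r dvd (g u - g 0 - s * u) + (s - d) * u" by (intro dvd_add dvd_mult2) auto
  then show ?thesis by (simp add: algebra_simps)
qed

lemma orbit_periodic:
  fixes d :: "'p::prime_card padic_int"
  assumes "near_affine r d g" "unif ^ n dvd (g ^^ k) 1 - 1"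
  shows "unif ^ n dvd (g ^^ i) 1 - (g ^^ (i mod k)) 1"
proof (induction i rule: less_induct)
  case (less i)
  show ?case
  proof (cases "k > 0 \<and> k \<le> i")
    case True
    then have "unif ^ n dvd (g ^^ (i - k)) 1 - (g ^^ ((i - k) mod k)) 1" using less by auto
    moreover have "unif ^ n dvd (g ^^ (i - k)) ((g ^^ k) 1) - (g ^^ (i - k)) 1"
      by (rule near_affine_funpow_lipschitz[OF assms])
    moreover have "(g ^^ (i - k)) ((g ^^ k) 1) = (g ^^ i) 1"
      using True by (metis comp_apply funpow_add le_add_diff_inverse2)
    ultimately have "unif ^ n dvd ((g ^^ i) 1 - (g ^^ (i - k)) 1) + ((g ^^ (i - k)) 1 - (g ^^ ((i - k) mod k)) 1)"
      by (intro dvd_add) auto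
    then show ?thesis using True by (simp add: mod_if[of i k])
  qed auto
qed

lemma orbit_covers_mono: "orbit_covers g n \<Longrightarrow> m \<le> n \<Longrightarrow> orbit_covers g m"
  unfolding orbit_covers_def by (meson power_le_dvd)

text \<open>Counting: all p - 1 nonzero residues must occur among the first k points of a k-periodic
  orbit.\<close>

lemma orbit_covers_period_ge:
  fixes d :: "'p::prime_card padic_int"
  assumes g: "near_affine r d g" and cov: "orbit_covers g 1" and k: "k > 0" "unif dvd (g ^^ k) 1 - 1"
  shows "CARD('p) - 1 \<le> k"
proof -
  have "{1..<int CARD('p)} \<subseteq> (\<lambda>i. padic_res ((g ^^ i) 1) 1) ` {..<k}"
  proof
    fix b assume b: "b \<in> {1..<int CARD('p)}"
    have "\<not> unif dvd (of_int b :: 'p padic_int)"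
      using padic_p_power_dvd_iff[of 1 "of_int b :: 'p padic_int"] b by simp
    then obtain i where i: "unif ^ 1 dvd (g ^^ i) 1 - of_int b" using cov unfolding orbit_covers_def by blast
    have "unif ^ 1 dvd (g ^^ i) 1 - (g ^^ (i mod k)) 1" by (rule orbit_periodic[OF g]) (use k in simp)
    then have "padic_res ((g ^^ (i mod k)) 1) 1 = b"
      using i b unfolding unif_dvd_diff_iff by simp
    moreover have "i mod k \<in> {..<k}" using k by simp
    ultimately show "b \<in> (\<lambda>i. padic_res ((g ^^ i) 1) 1) ` {..<k}" by blast
  qed
  then have "card {1..<int CARD('p)} \<le> card {..<k}" by (meson finite_lessThan surj_card_le)
  then show ?thesis by simp
qed

lemma odd_slope_level: "odd CARD('p::prime_card) \<Longrightarrow> slope_level TYPE('p) = 1"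
  by (auto simp: slope_level_def)

lemma not_unif_dvd_two:
  assumes "odd CARD('p::prime_card)"
  shows "\<not> (unif :: 'p padic_int) dvd 2"
proof -
  have "\<not> CARD('p) dvd 2"
    using assms prime_card[where 'a='p] by (metis primes_dvd_imp_eq two_is_prime_nat even_numeral)
  then show ?thesis using unif_power_dvd_of_nat_iff[of 1 2, where 'p='p] by simp
qed

lemma orbit_mod_unif:
  fixes d :: "'p::prime_card padic_int"
  assumes "near_affine r d g" "r \<ge> 1" "unif dvd g 0"
  shows "unif dvd (g ^^ i) 1 - d ^ i"
proof (induction i)
  case (Suc i)
  have "unif dvd g ((g ^^ i) 1) - g 0 - d * (g ^^ i) 1"
    using near_affine_mod_unif[OF assms(1)] assms(2) by (metis power_le_dvd power_one_right)
  then have "unif dvd (g ((g ^^ i) 1) - g 0 - d * (g ^^ i) 1) + g 0 + d * ((g ^^ i) 1 - d ^ i)"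
    using Suc assms(3) by (intro dvd_add dvd_mult) auto
  then show ?case by (simp add: algebra_simps)
qed simp

lemma funpow_linear: "((\<lambda>u. d * u) ^^ i) x = d ^ i * (x :: 'a::comm_monoid_mult)"
  by (induction i) (auto simp: mult_ac)

text \<open>A covering orbit needs at least p - 1 steps to return modulo p. If it closed modulo p^2
  after p - 1 steps, the class of 1 + p would be met at a time j below p - 1 at which the orbit is 1
  modulo p, hence at j = 0, which is absurd. Conversely, failure to close means a displacement of p
  times a unit, and the lifting step applies.\<close>

lemma orbit_covers_two_iff:
  fixes d :: "'p::prime_card padic_int"
  assumes odd: "odd CARD('p)" and g: "near_affine r d g" and r: "r \<ge> 1" and g0: "unif dvd g 0"
    and d: "\<not> unif dvd d"
  shows "orbit_covers g 2 \<longleftrightarrow> orbit_covers g 1 \<and> \<not> unif ^ 2 dvd (g ^^ (CARD('p) - 1)) 1 - 1"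
    and "orbit_covers g 2 \<Longrightarrow> returns_at_level 1 d g"
proof -
  define N where "N = CARD('p) - 1"
  have N: "N \<ge> 1" using p_gt_1[where 'p='p] by (simp add: N_def)
  have ret: "returns_at_level 1 d g" if "orbit_covers g 1" "\<not> unif ^ 2 dvd (g ^^ N) 1 - 1"
  proof -
    have F: "unif dvd d ^ N - 1" unfolding N_def by (rule padic_fermat[OF d])
    then have "unif dvd ((g ^^ N) 1 - d ^ N) + (d ^ N - 1)"
      using orbit_mod_unif[OF g r g0] by (intro dvd_add)
    then obtain e where e: "(g ^^ N) 1 - 1 = unif * e" by (auto simp: dvd_def)
    have "\<not> unif dvd e" using that(2) unfolding e by (simp add: power2_eq_square)
    moreover have "(g ^^ N) 1 = 1 + unif ^ 1 * e" using e by (simp add: algebra_simps)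
    ultimately show ?thesis
      using N F that(1) odd unfolding returns_at_level_def by (auto simp: odd_slope_level)
  qed
  have noper: "\<not> unif ^ 2 dvd (g ^^ N) 1 - 1" if cov: "orbit_covers g 2"
  proof
    assume per: "unif ^ 2 dvd (g ^^ N) 1 - 1"
    have cov1: "orbit_covers g 1" by (rule orbit_covers_mono[OF cov]) simp
    have "\<not> unif dvd (1 + unif :: 'p padic_int)"
      using unif_not_dvd_one[where 'p='p] by (simp add: dvd_add_left_iff)
    then obtain i where i: "unif ^ 2 dvd (g ^^ i) 1 - (1 + unif)" using cov unfolding orbit_covers_def by blast
    define j where "j = i mod N"
    have "unif ^ 2 dvd (g ^^ i) 1 - (g ^^ j) 1" unfolding j_def by (rule orbit_periodic[OF g per])
    with i have "unif ^ 2 dvd ((g ^^ i) 1 - (1 + unif)) - ((g ^^ i) 1 - (g ^^ j) 1)" by (rule dvd_diff)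
    then have j: "unif ^ 2 dvd (g ^^ j) 1 - (1 + unif)" by (simp add: algebra_simps)
    have "j \<noteq> 0"
    proof
      assume "j = 0"
      then have "unif * unif dvd (unif :: 'p padic_int) * 1" using j by (simp add: power2_eq_square)
      then show False using unif_not_dvd_one[where 'p='p] by (simp only: dvd_mult_cancel_left unif_nonzero simp_thms)
    qed
    moreover have "unif dvd ((g ^^ j) 1 - (1 + unif)) + unif"
      using j by (intro dvd_add) (auto simp: power2_eq_square dest: dvd_mult_left)
    then have "unif dvd (g ^^ j) 1 - 1" by simp
    ultimately have "N \<le> j" unfolding N_def using orbit_covers_period_ge[OF g cov1] by blast
    moreover have "j < N" unfolding j_def using N by simp
    ultimately show False by simp
  qed
  show "orbit_covers g 2 \<longleftrightarrow> orbit_covers g 1 \<and> \<not> unif ^ 2 dvd (g ^^ (CARD('p) - 1)) 1 - 1"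
    unfolding N_def[symmetric]
  proof
    assume "orbit_covers g 2"
    then show "orbit_covers g 1 \<and> \<not> unif ^ 2 dvd (g ^^ N) 1 - 1"
      using noper orbit_covers_mono[of g 2 1] by auto
  next
    assume "orbit_covers g 1 \<and> \<not> unif ^ 2 dvd (g ^^ N) 1 - 1"
    then have "returns_at_level (Suc 1) d g"
      using ret r odd by (intro returns_at_level_Suc[OF g]) (auto simp: odd_slope_level)
    then show "orbit_covers g 2" by (simp add: returns_at_level_def numeral_2_eq_2)
  qed
  show "returns_at_level 1 d g" if "orbit_covers g 2"
    using ret noper that orbit_covers_mono[of g 2 1] by auto
qed

text \<open>The factor d (d - 1) clears the denominators of the geometric series. It is a unit, so
  it can be cancelled once Fermat has made d^(p-1) - 1 contribute the second factor p.\<close>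

lemma orbit_mod_unif_square:
  fixes d :: "'p::prime_card padic_int"
  assumes g: "near_affine r d g" and r: "r \<ge> 1" and g0: "unif dvd g 0"
    and quad: "\<And>u. unif ^ 2 dvd g u - g 0 - d * u - unif * c * u ^ 2"
    and d: "\<not> unif dvd d" "\<not> unif dvd d - 1"
  shows "unif ^ 2 dvd (g ^^ (CARD('p) - 1)) 1 - d ^ (CARD('p) - 1)"
proof -
  obtain e where e: "g 0 = unif * e" using g0 by (auto simp: dvd_def)
  \<comment> \<open>Modulo \<open>p\<^sup>2\<close> the orbit is that of \<open>u \<mapsto> d u + p (e + c d\<^sup>2\<^sup>i)\<close>, whose closed form is a sum of two
    geometric series; both are multiples of \<open>d\<^sup>i - 1\<close>.\<close>
  have closed: "unif ^ 2 dvd d * (d - 1) * ((g ^^ i) 1 - d ^ i) - unif * (d ^ i - 1) * (d * e + c * d ^ i)" for i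
  proof (induction i)
    case (Suc i)
    define x where "x = (g ^^ i) 1"
    have "unif dvd x - d ^ i" unfolding x_def by (rule orbit_mod_unif[OF g r g0])
    \<comment> \<open>Under the factor p the square of x may be replaced by that of d^i, because x^2
      - d^(2 i) = (x + d^i) (x - d^i) is divisible by p.\<close>
    then have "unif ^ 2 dvd d * (d - 1) * c * (x + d ^ i) * (unif * (x - d ^ i))"
      by (simp add: power2_eq_square)
    then have "unif ^ 2 dvd d * (d * (d - 1) * (x - d ^ i) - unif * (d ^ i - 1) * (d * e + c * d ^ i))
        + d * (d - 1) * (g x - g 0 - d * x - unif * c * x ^ 2)
        + d * (d - 1) * c * (x + d ^ i) * (unif * (x - d ^ i))"
      using Suc quad unfolding x_def[symmetric] by (intro dvd_add[OF dvd_add[OF dvd_mult dvd_mult]]) auto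
    also have "\<dots> = d * (d - 1) * (g x - d * d ^ i) - unif * (d * d ^ i - 1) * (d * e + c * (d * d ^ i))"
      unfolding e by (simp add: algebra_simps power2_eq_square)
    finally show ?case by (simp add: x_def)
  qed simp
  define N where "N = CARD('p) - 1"
  have "unif ^ 2 dvd unif * (d ^ N - 1) * (d * e + c * d ^ N)"
    using padic_fermat[OF d(1)] unfolding N_def[symmetric] by (simp add: power2_eq_square mult_dvd_mono)
  with closed[of N] have "unif ^ 2 dvd (d * (d - 1) * ((g ^^ N) 1 - d ^ N) - unif * (d ^ N - 1) * (d * e + c * d ^ N))
     + unif * (d ^ N - 1) * (d * e + c * d ^ N)"
    by (rule dvd_add)
  then have "unif ^ 2 dvd d * (d - 1) * ((g ^^ N) 1 - d ^ N)" by simp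
  moreover have "\<not> unif dvd d * (d - 1)" using d by (simp add: prime_unif)
  ultimately show ?thesis unfolding N_def by (simp add: unif_power_dvd_mult_iff)
qed

text \<open>The criterion of \<open>orbit_covers_two_iff\<close> looks only at the orbit modulo p
  and at the point after p - 1 steps modulo p^2; g and its linear part agree in both
  respects.\<close>

lemma orbit_covers_two_iff_linear:
  fixes d :: "'p::prime_card padic_int"
  assumes odd: "odd CARD('p)" and g: "near_affine r d g" and r: "r \<ge> 1" and g0: "unif dvd g 0"
    and quad: "\<And>u. unif ^ 2 dvd g u - g 0 - d * u - unif * c * u ^ 2"
    and d: "\<not> unif dvd d"
  shows "orbit_covers g 2 \<longleftrightarrow> orbit_covers (\<lambda>u. d * u) 2"
proof -
  let ?h = "\<lambda>u. d * u" and ?N = "CARD('p) - 1"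
  have h: "near_affine r d ?h" by (rule near_affine_linear)
  have h0: "unif dvd ?h 0" by simp
  have diff: "unif ^ 1 dvd (g ^^ i) 1 - (?h ^^ i) 1" for i
    using orbit_mod_unif[OF g r g0] by (simp add: funpow_linear)
  have cov1: "orbit_covers g 1 \<longleftrightarrow> orbit_covers ?h 1"
    using diff unfolding orbit_covers_def unif_dvd_diff_iff by simp
  \<comment> \<open>If d were 1 modulo p, the linear orbit would stay at 1 modulo p and miss -1,
    which is a different class because p is odd.\<close>
  have "\<not> unif dvd d - 1" if cov: "orbit_covers ?h 1"
  proof
    assume d1: "unif dvd d - 1"
    have "\<not> unif dvd (- 1 :: 'p padic_int)" using unif_not_dvd_one by simp
    then obtain i where i: "unif ^ 1 dvd d ^ i * 1 - (- 1)"
      using cov unfolding orbit_covers_def funpow_linear by blast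
    have "unif dvd (d ^ i * 1 - (- 1)) - (d ^ i - 1)"
      by (rule dvd_diff[OF _ dvd_trans[OF d1 one_diff_dvd_power]]) (use i in simp)
    then show False using not_unif_dvd_two[OF odd] by simp
  qed
  then have "unif ^ 2 dvd (g ^^ ?N) 1 - (?h ^^ ?N) 1" if "orbit_covers ?h 1"
    using orbit_mod_unif_square[OF g r g0 quad d] that by (simp add: funpow_linear)
  then have "unif ^ 2 dvd (g ^^ ?N) 1 - 1 \<longleftrightarrow> unif ^ 2 dvd (?h ^^ ?N) 1 - 1" if "orbit_covers ?h 1"
    using that unfolding unif_dvd_diff_iff by simp
  then show ?thesis
    unfolding orbit_covers_two_iff(1)[OF odd g r g0 d] orbit_covers_two_iff(1)[OF odd h r h0 d]
    using cov1 by blast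
qed

section \<open>Generators of the units modulo p^2\<close>

text \<open>In a finite group the subgroup generated by an element consists of its nonnegative
  powers, and these are the residues of the orbit of 1 under multiplication by d. If p divides d,
  the generated set contains a non-unit.\<close>

lemma generate_units_iff:
  fixes d :: "'p::prime_card padic_int"
  assumes odd: "odd CARD('p)"
  shows "generate (units_of (residue_ring (int CARD('p) ^ 2))) {padic_res d 2}
      = carrier (units_of (residue_ring (int CARD('p) ^ 2))) \<longleftrightarrow>
    \<not> unif dvd d \<and> orbit_covers (\<lambda>u. d * u) 2"
proof -
  define m where "m = int CARD('p) ^ 2"
  have p1: "int CARD('p) > 1" by (rule p_gt_1)
  then have m1: "m > 1" by (simp add: m_def)
  define R where "R = residue_ring m"
  interpret residues m R by unfold_locales (use m1 R_def in auto)
  interpret U: group "units_of R" by (rule units_group)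
  have cop: "coprime (padic_res x 2) m \<longleftrightarrow> \<not> unif dvd x" for x :: "'p padic_int"
  proof -
    have "unif dvd x \<longleftrightarrow> padic_res x 2 mod int CARD('p) = 0"
      using padic_p_power_dvd_iff[of 1 x] padic_res_mod[of 1 2 x] by simp
    also have "\<dots> \<longleftrightarrow> \<not> coprime (int CARD('p)) (padic_res x 2)"
      using prime_card_int[where 'a='p]
      by (metis coprime_absorb_left dvd_eq_mod_eq_0 not_prime_unit prime_imp_coprime)
    finally show ?thesis by (auto simp: m_def coprime_commute)
  qed
  have carr: "x mod m \<in> carrier (units_of R) \<longleftrightarrow> coprime x m" for x
  proof
    assume "coprime x m" then show "x mod m \<in> carrier (units_of R)"
      using m1 by (simp add: units_of_carrier)
  next
    assume "x mod m \<in> carrier (units_of R)" then show "coprime x m"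
      using m1 by (simp add: units_of_carrier res_units_eq coprime_mod_left_iff)
  qed
  have dmod: "padic_res d 2 mod m = padic_res d 2" unfolding m_def by (rule padic_res_mod_self)
  show ?thesis unfolding m_def[symmetric] R_def[symmetric]
  proof (cases "unif dvd d")
    case True
    then have "padic_res d 2 \<notin> carrier (units_of R)" using cop carr dmod by metis
    then show "(generate (units_of R) {padic_res d 2} = carrier (units_of R)) \<longleftrightarrow>
       \<not> unif dvd d \<and> orbit_covers (\<lambda>u. d * u) 2"
      using True generate.incl[of "padic_res d 2" "{padic_res d 2}" "units_of R"] by auto
  next
    case False
    then have dc: "padic_res d 2 \<in> carrier (units_of R)" using cop carr dmod by metis
    have pow: "padic_res d 2 [^]\<^bsub>units_of R\<^esub> i = padic_res (d ^ i) 2" for i :: nat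
    proof (induction i)
      case 0
      then show ?case using m1 by (simp add: units_of_one one_cong m_def)
    next
      case (Suc i)
      then show ?case by (simp add: units_of_mult res_mult_eq m_def mult.commute)
    qed
    have fin: "finite (carrier (units_of R))" by (simp add: units_of_carrier)
    have gen: "generate (units_of R) {padic_res d 2} = range (\<lambda>i. padic_res (d ^ i) 2)"
      unfolding U.generate_pow_on_finite_carrier[OF fin dc] pow by blast
    have "orbit_covers (\<lambda>u. d * u) 2 \<longleftrightarrow> carrier (units_of R) \<subseteq> range (\<lambda>i. padic_res (d ^ i) 2)"
    proof
      assume cov: "orbit_covers (\<lambda>u. d * u) 2"
      show "carrier (units_of R) \<subseteq> range (\<lambda>i. padic_res (d ^ i) 2)"
      proof
        fix b assume b: "b \<in> carrier (units_of R)"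
        then have b': "0 < b" "b < m" "coprime b m" by (auto simp: units_of_carrier res_units_eq)
        then have "padic_res (of_int b :: 'p padic_int) 2 = b" by (simp add: m_def)
        then obtain i where "unif ^ 2 dvd d ^ i * 1 - of_int b"
          using cov cop[of "of_int b"] b' unfolding orbit_covers_def funpow_linear by metis
        then have "padic_res (d ^ i) 2 = b" using b' unfolding unif_dvd_diff_iff by (simp add: m_def)
        then show "b \<in> range (\<lambda>i. padic_res (d ^ i) 2)" by blast
      qed
    next
      assume sub: "carrier (units_of R) \<subseteq> range (\<lambda>i. padic_res (d ^ i) 2)"
      show "orbit_covers (\<lambda>u. d * u) 2" unfolding orbit_covers_def funpow_linear unif_dvd_diff_iff
      proof (intro allI impI)
        fix b :: "'p padic_int" assume "\<not> unif dvd b"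
        then have "padic_res b 2 mod m \<in> carrier (units_of R)" using carr cop by blast
        moreover have "padic_res b 2 mod m = padic_res b 2" unfolding m_def by (rule padic_res_mod_self)
        ultimately obtain i where "padic_res b 2 = padic_res (d ^ i) 2" using sub by auto
        then show "\<exists>i. padic_res (d ^ i * 1) 2 = padic_res b 2" by auto
      qed
    qed
    moreover have "generate (units_of R) {padic_res d 2} \<subseteq> carrier (units_of R)"
      using dc by (intro U.generate_incl) auto
    ultimately show "(generate (units_of R) {padic_res d 2} = carrier (units_of R)) \<longleftrightarrow>
       \<not> unif dvd d \<and> orbit_covers (\<lambda>u. d * u) 2"
      using False gen by auto
  qed
qed

section \<open>From the orbit of 1 to all units\<close>

text \<open>For a map of S into itself this is minimality: the forward orbit of every point of S is
  dense in S.\<close>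

definition transitive_on_residues ::
    "('p::prime_card padic_int \<Rightarrow> 'p padic_int) \<Rightarrow> 'p padic_int set \<Rightarrow> bool" where
  "transitive_on_residues f S \<longleftrightarrow> (\<forall>a\<in>S. \<forall>b\<in>S. \<forall>n. \<exists>k. unif ^ n dvd (f ^^ k) a - b)"

abbreviation units_padic :: "'p::prime_card padic_int set" where
  "units_padic \<equiv> {u. \<not> unif dvd u}"

lemma transitive_imp_orbit_covers:
  "transitive_on_residues g units_padic \<Longrightarrow> orbit_covers g n"
  unfolding transitive_on_residues_def orbit_covers_def
  using unif_not_dvd_one by blast

text \<open>The orbit of 1 is periodic modulo p^(n + 1) and passes near a at a time i and near b at
  a time j. From a it suffices to wait for a time after i that is j modulo the period.\<close>

lemma returns_imp_transitive:
  fixes d :: "'p::prime_card padic_int"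
  assumes g: "near_affine r d g" and ret: "\<And>n. n \<ge> 1 \<Longrightarrow> returns_at_level n d g"
  shows "transitive_on_residues g units_padic"
  unfolding transitive_on_residues_def
proof (intro ballI allI)
  fix a b :: "'p padic_int" and n
  assume ab: "a \<in> units_padic" "b \<in> units_padic"
  obtain N e where N: "N \<ge> 1" "(g ^^ N) 1 = 1 + unif ^ Suc n * e" and cov: "orbit_covers g (Suc n)"
    using ret[of "Suc n"] unfolding returns_at_level_def by auto
  have per: "unif ^ Suc n dvd (g ^^ N) 1 - 1" using N by simp
  obtain i where i: "unif ^ Suc n dvd (g ^^ i) 1 - a" using cov ab unfolding orbit_covers_def by blast
  obtain j where j: "unif ^ Suc n dvd (g ^^ j) 1 - b" using cov ab unfolding orbit_covers_def by blast
  \<comment> \<open>N i is a multiple of the period and at least i, so the subtraction is not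
    truncated.\<close>
  define k where "k = j + N * i - i"
  have "i \<le> N * i" using N(1) by simp
  then have k: "k + i = j + N * i" unfolding k_def by linarith
  have "unif ^ Suc n dvd (g ^^ k) ((g ^^ i) 1) - (g ^^ k) a"
    by (rule near_affine_funpow_lipschitz[OF g i])
  moreover have "(g ^^ k) ((g ^^ i) 1) = (g ^^ (j + N * i)) 1"
    unfolding k[symmetric] by (simp add: funpow_add)
  moreover have "unif ^ Suc n dvd (g ^^ (j + N * i)) 1 - (g ^^ ((j + N * i) mod N)) 1"
    by (rule orbit_periodic[OF g per])
  moreover have "unif ^ Suc n dvd (g ^^ j) 1 - (g ^^ (j mod N)) 1"
    by (rule orbit_periodic[OF g per])
  ultimately have "unif ^ Suc n dvd (g ^^ k) a - b"
    using j unfolding unif_dvd_diff_iff by simp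
  then show "\<exists>k. unif ^ n dvd (g ^^ k) a - b" by (auto dest: dvd_mult_right)
qed

text \<open>Modulo p the map is u |-> g 0 + d u. If p divided d it would be constant and could not
  reach both 1 and -1; if g 0 were a unit, so would be -g 0 / d, which is sent to 0.\<close>

lemma transitive_imp_fixes_center:
  fixes d :: "'p::prime_card padic_int"
  assumes odd: "odd CARD('p)" and g: "near_affine r d g" and r: "r \<ge> 1"
    and inv: "g ` units_padic \<subseteq> units_padic" and tr: "transitive_on_residues g units_padic"
  shows "unif dvd g 0" "\<not> unif dvd d"
proof -
  have aff: "unif dvd g u - g 0 - d * u" for u
    using power_le_dvd[OF near_affine_mod_unif[OF g] r] by simp
  have inv': "\<not> unif dvd g u" if "\<not> unif dvd u" for u using inv that by auto
  have unit1: "\<not> unif dvd (1 :: 'p padic_int)" by (rule unif_not_dvd_one)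
  have tr': "\<exists>k. unif ^ 1 dvd (g ^^ k) a - b" if "\<not> unif dvd a" "\<not> unif dvd b" for a b
    using tr[unfolded transitive_on_residues_def, rule_format, of a b 1] that by simp
  show d: "\<not> unif dvd d"
  proof
    assume d: "unif dvd d"
    have const: "unif dvd g u - g 0" for u
    proof -
      have "unif dvd (g u - g 0 - d * u) + d * u" using aff d by (intro dvd_add dvd_mult2)
      then show ?thesis by simp
    qed
    have "unif dvd (g ^^ k) (g 1) - g 0" for k
      by (induction k) (use const in auto)
    then have k: "unif dvd (g ^^ k) (g 1) - g 0" for k .
    have all: "unif dvd b - g 0" if "\<not> unif dvd b" for b
    proof -
      obtain k where "unif ^ 1 dvd (g ^^ k) (g 1) - b" using tr'[OF inv'[OF unit1] \<open>\<not> unif dvd b\<close>] by blast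
      then have "unif dvd ((g ^^ k) (g 1) - g 0) - ((g ^^ k) (g 1) - b)"
        by (intro dvd_diff[OF k]) simp
      then show ?thesis by simp
    qed
    have "unif dvd (1 - g 0) - (- 1 - g 0)"
      by (intro dvd_diff all) (use unit1 in auto)
    then show False using not_unif_dvd_two[OF odd] by simp
  qed
  show "unif dvd g 0"
  proof (rule ccontr)
    assume g0: "\<not> unif dvd g 0"
    obtain j :: nat where j: "unif dvd d * of_nat j - (- g 0)" using padic_linear_solve[OF d] by blast
    have "\<not> unif dvd (of_nat j :: 'p padic_int)"
    proof
      assume "unif dvd (of_nat j :: 'p padic_int)"
      then have "unif dvd (d * of_nat j - (- g 0)) - d * of_nat j" by (intro dvd_diff[OF j] dvd_mult)
      then show False using g0 by simp
    qed
    then have "\<not> unif dvd g (of_nat j)" by (rule inv')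
    moreover have "unif dvd (g (of_nat j) - g 0 - d * of_nat j) + (d * of_nat j - (- g 0))"
      using aff j by (rule dvd_add)
    ultimately show False by simp
  qed
qed

lemma transitive_on_units_iff_odd:
  fixes d :: "'p::prime_card padic_int"
  assumes odd: "odd CARD('p)" and g: "near_affine r d g" and r: "r \<ge> 1"
    and quad: "\<And>u. unif ^ 2 dvd g u - g 0 - d * u - unif * c * u ^ 2"
  shows "g ` units_padic \<subseteq> units_padic \<and> transitive_on_residues g units_padic \<longleftrightarrow>
    unif dvd g 0 \<and> \<not> unif dvd d \<and> orbit_covers (\<lambda>u. d * u) 2"
proof
  assume *: "g ` units_padic \<subseteq> units_padic \<and> transitive_on_residues g units_padic"
  then have g0: "unif dvd g 0" and d: "\<not> unif dvd d"
    using transitive_imp_fixes_center[OF odd g r] by auto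
  have "orbit_covers g 2" using * transitive_imp_orbit_covers by blast
  then show "unif dvd g 0 \<and> \<not> unif dvd d \<and> orbit_covers (\<lambda>u. d * u) 2"
    using g0 d orbit_covers_two_iff_linear[OF odd g r g0 quad d] by simp
next
  assume *: "unif dvd g 0 \<and> \<not> unif dvd d \<and> orbit_covers (\<lambda>u. d * u) 2"
  then have g0: "unif dvd g 0" and d: "\<not> unif dvd d" by auto
  have "orbit_covers g 2" using * orbit_covers_two_iff_linear[OF odd g r g0 quad d] by simp
  then have "returns_at_level 1 d g" by (rule orbit_covers_two_iff(2)[OF odd g r g0 d])
  then have "returns_at_level n d g" if "n \<ge> 1" for n
    using returns_at_level_ge[OF g] r that odd by (simp add: odd_slope_level)
  then have "transitive_on_residues g units_padic" by (rule returns_imp_transitive[OF g])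
  moreover have "\<not> unif dvd g u" if "\<not> unif dvd u" for u
  proof
    assume "unif dvd g u"
    moreover have "unif dvd g u - g 0 - d * u"
      using power_le_dvd[OF near_affine_mod_unif[OF g] r] by simp
    ultimately have "unif dvd g u - (g u - g 0 - d * u) - g 0" by (intro dvd_diff[OF dvd_diff g0])
    then show False using d that by (simp add: prime_unif)
  qed
  ultimately show "g ` units_padic \<subseteq> units_padic \<and> transitive_on_residues g units_padic" by auto
qed

section \<open>The prime 2\<close>

lemma two_padic_odd:
  fixes x :: "'p::prime_card padic_int"
  assumes "CARD('p) = 2" "\<not> 2 dvd x"
  obtains t where "x = 1 + 2 * t"
proof -
  have "padic_res x 1 \<noteq> 0" using assms padic_p_power_dvd_iff[of 1 x] by simp
  moreover have "0 \<le> padic_res x 1" "padic_res x 1 < 2" using padic_res_range[of x 1] assms by auto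
  ultimately have "padic_res x 1 = 1" by linarith
  then have "unif ^ 1 dvd x - 1" unfolding unif_dvd_diff_iff by (simp add: assms)
  then have "2 dvd x - 1" by (simp add: assms)
  then obtain t where "x - 1 = 2 * t" by (auto simp: dvd_def)
  then have "x = 1 + 2 * t" by (simp add: algebra_simps)
  then show ?thesis by (rule that)
qed

lemma two_padic_odd_square:
  fixes x :: "'p::prime_card padic_int"
  assumes "CARD('p) = 2" "\<not> 2 dvd x"
  shows "8 dvd x ^ 2 - 1"
proof -
  obtain t where t: "x = 1 + 2 * t" using two_padic_odd[OF assms] by blast
  have "2 dvd t * (t + 1)"
  proof (cases "2 dvd t")
    case False
    then obtain s where "t = 1 + 2 * s" using two_padic_odd[OF assms(1)] by blast
    then have "t + 1 = 2 * (1 + s)" by simp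
    then show ?thesis by (simp only: dvd_mult dvd_triv_left)
  qed simp
  then obtain s where "t * (t + 1) = 2 * s" by (auto simp: dvd_def)
  moreover have "x ^ 2 - 1 = 4 * (t * (t + 1))" unfolding t by (simp add: algebra_simps power2_eq_square)
  ultimately have "x ^ 2 - 1 = 8 * s" by simp
  then show ?thesis by simp
qed

lemma two_padic_numeral_dvd:
  assumes "CARD('p::prime_card) = 2"
  shows "\<not> (4 :: 'p padic_int) dvd 2" "\<not> (8 :: 'p padic_int) dvd 4" "\<not> (2 :: 'p padic_int) dvd 1"
  using unif_power_dvd_of_nat_iff[of 2 2, where 'p='p] unif_power_dvd_of_nat_iff[of 3 4, where 'p='p]
    unif_power_dvd_of_nat_iff[of 1 1, where 'p='p]
  by (simp_all add: assms)

text \<open>The odd residues modulo 4 are 1 and 3, so transitivity forces g to exchange them. This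
  ties g 0 to d modulo 4 and leaves two cases, d = 1 and d = 3 modulo 4. They are separated modulo
  8, where the quadratic term is constant on odd points because odd squares are 1.\<close>

lemma transitive_on_units_iff_two:
  fixes d :: "'p::prime_card padic_int"
  assumes two: "CARD('p) = 2" and g: "near_affine r d g" and r: "r \<ge> 2"
    and quad: "\<And>u. 8 dvd g u - g 0 - d * u - 4 * c * u ^ 2"
  shows "g ` units_padic \<subseteq> units_padic \<and> transitive_on_residues g units_padic \<longleftrightarrow>
    2 dvd g 0 \<and> \<not> 4 dvd g 0 \<and> 4 dvd d - 1"
proof
  note nd = two_padic_numeral_dvd[OF two]
  have aff: "4 dvd g u - g 0 - d * u" for u
    using power_le_dvd[OF near_affine_mod_unif[OF g] r] by (simp add: two)
  have lip4: "4 dvd g x - g y" if "4 dvd x - y" for x y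
    using near_affine_lipschitz[OF g, of 2 x y] that by (simp add: two)
  {
    assume *: "g ` units_padic \<subseteq> units_padic \<and> transitive_on_residues g units_padic"
    then have inv: "\<And>u. \<not> 2 dvd u \<Longrightarrow> \<not> 2 dvd g u" by (auto simp: two)
    have tr: "\<exists>k. unif ^ n dvd (g ^^ k) a - b" if "\<not> 2 dvd a" "\<not> 2 dvd b" for a b n
      using * that unfolding transitive_on_residues_def by (simp add: two)
    have no_fix: "\<not> 4 dvd g x - x" if x: "\<not> 2 dvd x" for x
    proof
      assume fix_x: "4 dvd g x - x"
      have fix_k: "4 dvd (g ^^ k) x - x" for k
      proof (induction k)
        case (Suc k)
        have "4 dvd (g ((g ^^ k) x) - g x) + (g x - x)" using lip4[OF Suc] fix_x by (rule dvd_add)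
        then show ?case by simp
      qed simp
      have "\<not> 2 dvd x + 2" using x by simp
      then obtain k where "unif ^ 2 dvd (g ^^ k) x - (x + 2)" using tr x by blast
      then have "4 dvd ((g ^^ k) x - x) - ((g ^^ k) x - (x + 2))" by (intro dvd_diff[OF fix_k]) (simp add: two)
      then show False using nd by simp
    qed
    have odd1: "\<not> 2 dvd (1 :: 'p padic_int)" using nd by simp
    have flip: "4 dvd g x - x - 2" if x: "\<not> 2 dvd x" for x
    proof -
      obtain s where s: "x = 1 + 2 * s" using two_padic_odd[OF two x] by blast
      obtain t where t: "g x = 1 + 2 * t" using two_padic_odd[OF two inv[OF x]] by blast
      have "g x - x = 2 * (t - s)" unfolding t by (simp add: s algebra_simps)
      then have "\<not> 2 * 2 dvd 2 * (t - s)" using no_fix[OF x] by simp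
      then have "\<not> 2 dvd t - s" by (simp only: dvd_mult_cancel_left) simp
      then obtain v where v: "t - s = 1 + 2 * v" using two_padic_odd[OF two] by blast
      have "g x - x - 2 = 2 * (t - s) - 2" unfolding t by (simp add: s algebra_simps)
      also have "\<dots> = 4 * v" by (simp add: v)
      finally show ?thesis by simp
    qed
    have "\<not> 2 dvd (3 :: 'p padic_int)"
    proof
      assume "2 dvd (3 :: 'p padic_int)"
      then have "2 dvd (3 - 2 :: 'p padic_int)" by (intro dvd_diff) auto
      then show False using nd by simp
    qed
    then have f3: "4 dvd g 3 - 3 - 2" using flip by blast
    have f1: "4 dvd g 1 - 1 - 2" using flip odd1 by blast
    \<comment> \<open>Comparing the values at 3 and 1 eliminates g 0 and leaves 2 d - 2; adding 4
      gives the form 2 (d + 1).\<close>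
    have "4 dvd ((g 3 - 3 - 2) - (g 1 - 1 - 2)) - ((g 3 - g 0 - d * 3) - (g 1 - g 0 - d * 1)) + 4"
      by (intro dvd_add[OF dvd_diff[OF dvd_diff[OF f3 f1] dvd_diff[OF aff aff]]]) auto
    then have "2 * 2 dvd 2 * (d + 1)" by (simp add: algebra_simps)
    then have "2 dvd d + 1" by (simp only: dvd_mult_cancel_left) simp
    then obtain w where "d + 1 = 2 * w" by (auto simp: dvd_def)
    then have d: "d = 2 * w - 1" by (simp add: algebra_simps)
    have "4 dvd (g 1 - 1 - 2) - (g 1 - g 0 - d * 1)" using f1 aff[of 1] by (rule dvd_diff)
    then obtain v where "(g 1 - 1 - 2) - (g 1 - g 0 - d * 1) = 4 * v" by (auto simp: dvd_def)
    then have g0: "g 0 = 4 * v + 4 - 2 * w" by (simp add: d algebra_simps)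
    have w: "\<not> 2 dvd w"
    proof
      \<comment> \<open>If \<open>d \<equiv> 3\<close> modulo \<open>4\<close> then \<open>g (g 1) \<equiv> 1\<close> modulo \<open>8\<close>.\<close>
      assume "2 dvd w"
      then obtain w' where w': "w = 2 * w'" by (auto simp: dvd_def)
      \<comment> \<open>Chosen so that 4 h = g 0 + 4 c: on odd u the term 4 c u^2 is 4 c modulo 8,
        and g becomes u |-> 4 h + d u.\<close>
      define h where "h = v + 1 - w' + c"
      have q: "8 dvd g u - 4 * h - d * u" if u: "\<not> 2 dvd u" for u
      proof -
        have "8 dvd (g u - g 0 - d * u - 4 * c * u ^ 2) + 4 * c * (u ^ 2 - 1)"
          by (intro dvd_add[OF quad] dvd_mult two_padic_odd_square[OF two u])
        then show ?thesis by (simp add: g0 w' h_def algebra_simps)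
      qed
      have "\<not> 2 dvd d"
      proof
        assume "2 dvd d"
        then have "2 dvd 2 * w - d" by (intro dvd_diff) auto
        then show False using nd by (simp add: d)
      qed
      \<comment> \<open>Two steps from 1 lead to 4 h (1 + d) + d^2 = 8 h w + d^2, and d is
        odd.\<close>
      then have "8 dvd (g (g 1) - 4 * h - d * g 1) + d * (g 1 - 4 * h - d * 1) + (d ^ 2 - 1) + 8 * (h * w)"
        by (intro dvd_add[OF dvd_add[OF dvd_add[OF q[OF inv[OF odd1]] dvd_mult[OF q[OF odd1]]]]]
            two_padic_odd_square[OF two]) auto
      moreover have "(g (g 1) - 4 * h - d * g 1) + d * (g 1 - 4 * h - d * 1) + (d ^ 2 - 1) + 8 * (h * w) = g (g 1) - 1"
        by (simp add: algebra_simps power2_eq_square) (simp add: d algebra_simps)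
      ultimately have "8 dvd g (g 1) - 1" by (simp only:)
      then have per: "unif ^ 3 dvd (g ^^ 2) 1 - 1" by (simp add: two numeral_2_eq_2)
      \<comment> \<open>The witness 5 is 1 modulo 4 but not 1 modulo 8, while the orbit modulo 8
        consists of 1 and of g 1, which is 3 modulo 4.\<close>
      have "\<not> 2 dvd (5 :: 'p padic_int)"
      proof
        assume "2 dvd (5 :: 'p padic_int)"
        then have "2 dvd (5 - 2 * 2 :: 'p padic_int)" by (rule dvd_diff[OF _ dvd_triv_left])
        then show False using nd by simp
      qed
      then obtain k where k: "unif ^ 3 dvd (g ^^ k) 1 - 5" using tr odd1 by blast
      have "unif ^ 3 dvd (g ^^ k) 1 - (g ^^ (k mod 2)) 1" by (rule orbit_periodic[OF g per])
      with k have "unif ^ 3 dvd ((g ^^ k) 1 - 5) - ((g ^^ k) 1 - (g ^^ (k mod 2)) 1)" by (rule dvd_diff)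
      then have k8: "8 dvd (g ^^ (k mod 2)) 1 - 5" by (simp add: two)
      have "k mod 2 = 0 \<or> k mod 2 = 1" by auto
      then show False
      proof
        assume "k mod 2 = 0"
        then have "8 dvd (- 4 :: 'p padic_int)" using k8 by simp
        then show False using nd by simp
      next
        assume "k mod 2 = 1"
        then have "4 * 2 dvd g 1 - 5" using k8 by simp
        then have "4 dvd g 1 - 5" by (rule dvd_mult_left)
        then have "4 dvd (g 1 - 1 - 2) - (g 1 - 5)" by (rule dvd_diff[OF f1])
        then show False using nd by simp
      qed
    qed
    then obtain z where z: "w = 1 + 2 * z" using two_padic_odd[OF two] by blast
    have "g 0 = 2 * (2 * v + 2 - w)" by (simp add: g0)
    moreover have "\<not> 4 dvd g 0"
    proof
      assume "4 dvd g 0"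
      then have "4 dvd 4 * (v - z) - g 0" by (intro dvd_diff) auto
      then show False using nd by (simp add: g0 z algebra_simps)
    qed
    moreover have "d - 1 = 4 * z" by (simp add: d z)
    ultimately show "2 dvd g 0 \<and> \<not> 4 dvd g 0 \<and> 4 dvd d - 1" by (simp only: dvd_triv_left simp_thms)
  }
  assume *: "2 dvd g 0 \<and> \<not> 4 dvd g 0 \<and> 4 dvd d - 1"
  then obtain v where v: "g 0 = 2 * v" by (auto simp: dvd_def)
  have "\<not> 2 dvd v"
  proof
    assume "2 dvd v"
    then have "2 * 2 dvd 2 * v" by (rule mult_dvd_mono[OF dvd_refl])
    then show False using * by (simp add: v)
  qed
  obtain z where z: "d - 1 = 4 * z" using * by (auto simp: dvd_def)
  obtain q where q: "g 1 - g 0 - d * 1 = 4 * q" using aff[of 1] by (auto simp: dvd_def)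
  \<comment> \<open>Modulo 2 there is only one odd class, so a single application of g is already
    the return map (N = 1); e is read off from g 1 = g 0 + d + 4 q.\<close>
  define e where "e = v + 2 * z + 2 * q"
  have "g 1 = 1 + 2 * e" using z q by (simp add: e_def v algebra_simps)
  moreover have "\<not> 2 dvd e"
  proof
    assume "2 dvd e"
    then have "2 dvd e - 2 * (z + q)" by (intro dvd_diff) auto
    then show False using \<open>\<not> 2 dvd v\<close> by (simp add: e_def algebra_simps)
  qed
  moreover have "orbit_covers g 1"
    unfolding orbit_covers_def
  proof (intro allI impI)
    fix b :: "'p padic_int" assume "\<not> unif dvd b"
    then obtain t where "b = 1 + 2 * t" using two_padic_odd[OF two] by (auto simp: two)
    then have "unif ^ 1 dvd (g ^^ 0) 1 - b" by (simp add: two)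
    then show "\<exists>i. unif ^ 1 dvd (g ^^ i) 1 - b" by blast
  qed
  ultimately have "returns_at_level 1 d g"
    unfolding returns_at_level_def using *
    by (intro conjI exI[of _ 1] exI[of _ e]) (auto simp: two slope_level_def)
  then have "returns_at_level n d g" if "n \<ge> 1" for n
    using returns_at_level_ge[OF g] r that by (simp add: slope_level_def two)
  then have "transitive_on_residues g units_padic" by (rule returns_imp_transitive[OF g])
  moreover have "\<not> 2 dvd g u" if u: "\<not> 2 dvd u" for u
  proof
    assume gu: "2 dvd g u"
    obtain t where t: "u = 1 + 2 * t" using two_padic_odd[OF two u] by blast
    have "2 * 2 dvd g u - g 0 - d * u" using aff[of u] by simp
    then have "2 dvd g u - g 0 - d * u" by (rule dvd_mult_left)
    then have "2 dvd g u - (g u - g 0 - d * u) - g 0 - 2 * (2 * z * u + t)" 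
      using gu * by (intro dvd_diff[OF dvd_diff[OF dvd_diff] dvd_triv_left]) auto
    moreover have "d = 1 + 4 * z" using z by (simp add: algebra_simps)
    ultimately show False using nd by (simp add: t algebra_simps)
  qed
  ultimately show "g ` units_padic \<subseteq> units_padic \<and> transitive_on_residues g units_padic" by (auto simp: two)
qed

section \<open>Ergodicity and transitivity on residues\<close>

abbreviation padic_ball :: "nat \<Rightarrow> 'p::prime_card padic_int \<Rightarrow> 'p padic_int set" where
  "padic_ball n b \<equiv> padic_cyl n (padic_res b n)"

lemma mem_padic_ball: "x \<in> padic_ball n b \<longleftrightarrow> unif ^ n dvd x - b"
  unfolding unif_dvd_diff_iff by (simp add: padic_cyl_def)

lemma is_padic_haar_padic_haar: "is_padic_haar (padic_haar :: 'p::prime_card padic_int measure)"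
  unfolding padic_haar_def by (rule theI'[OF ex1_padic_haar])

lemma sets_padic_haar [simp, measurable_cong]:
  "sets (padic_haar :: 'p::prime_card padic_int measure) = sets borel"
  using is_padic_haar_padic_haar[where 'p='p] by (simp add: is_padic_haar_iff)

lemma space_padic_haar [simp]: "space (padic_haar :: 'p::prime_card padic_int measure) = UNIV"
  using sets_eq_imp_space_eq[OF sets_padic_haar] by simp

lemma prob_space_padic_haar: "prob_space (padic_haar :: 'p::prime_card padic_int measure)"
  using is_padic_haar_padic_haar[where 'p='p] by (simp add: is_padic_haar_iff)

lemma emeasure_padic_haar_finite: "emeasure (padic_haar :: 'p::prime_card padic_int measure) A \<noteq> \<infinity>"
proof -
  interpret prob_space "padic_haar :: 'p padic_int measure" by (rule prob_space_padic_haar)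
  show ?thesis by simp
qed

lemma emeasure_padic_haar_ball:
  fixes b :: "'p::prime_card padic_int"
  shows "emeasure padic_haar (padic_ball n b) = 1 / of_nat (CARD('p) ^ n)"
  using is_padic_haar_padic_haar[where 'p='p] padic_res_range[of b n] by (simp add: is_padic_haar_iff)

lemma emeasure_padic_haar_ball_pos:
  fixes b :: "'p::prime_card padic_int"
  shows "emeasure padic_haar (padic_ball n b) > 0"
  unfolding emeasure_padic_haar_ball
  by (simp only: ennreal_zero_less_divide of_nat_less_top zero_less_one simp_thms)

lemma padic_cyl_eq_Union:
  assumes "n \<le> m"
  shows "(padic_cyl n a :: 'p::prime_card padic_int set) =
    (\<Union>b\<in>{b\<in>{0..<int CARD('p) ^ m}. b mod int CARD('p) ^ n = a}. padic_cyl m b)"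
  using padic_res_mod[OF assms, where 'p='p] padic_res_range[where 'p='p and n=m] by (auto simp: padic_cyl_def)

text \<open>A coarse cylinder is a finite disjoint union of finer ones. This permits comparison only
  at levels at which S is a union of balls.\<close>

lemma padic_measure_eqI_ge:
  fixes M N :: "'p::prime_card padic_int measure"
  assumes s: "sets M = sets borel" "sets N = sets borel" and "prob_space M"
    and eq: "\<And>n a. n \<ge> m \<Longrightarrow> emeasure M (padic_cyl n a) = emeasure N (padic_cyl n a)"
  shows "M = N"
proof (rule padic_measure_eqI[OF s \<open>prob_space M\<close>])
  fix n a
  define k where "k = max n m"
  let ?B = "{b\<in>{0..<int CARD('p) ^ k}. b mod int CARD('p) ^ n = a}"
  have sum: "emeasure L (padic_cyl n a) = (\<Sum>b\<in>?B. emeasure L (padic_cyl k b))"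
    if "sets L = sets borel" for L :: "'p padic_int measure"
  proof -
    have "(padic_cyl n a :: 'p padic_int set) = (\<Union>b\<in>?B. padic_cyl k b)"
      by (rule padic_cyl_eq_Union) (unfold k_def, rule max.cobounded1)
    also have "emeasure L \<dots> = (\<Sum>b\<in>?B. emeasure L (padic_cyl k b))"
    proof (rule sum_emeasure[symmetric])
      show "padic_cyl k ` ?B \<subseteq> sets L" by (simp add: that image_subset_iff open_padic_cyl)
      show "disjoint_family_on (padic_cyl k :: _ \<Rightarrow> 'p padic_int set) ?B"
        unfolding disjoint_family_on_def padic_cyl_def by blast
    qed (rule finite_subset[of _ "{0..<int CARD('p) ^ k}"], blast, rule finite_atLeastLessThan_int)
    finally show ?thesis .
  qed
  have "m \<le> k" by (simp add: k_def)
  have "emeasure M (padic_cyl n a) = (\<Sum>b\<in>?B. emeasure M (padic_cyl k b))" by (rule sum[OF s(1)])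
  also have "\<dots> = (\<Sum>b\<in>?B. emeasure N (padic_cyl k b))"
    by (intro sum.cong refl eq \<open>m \<le> k\<close>)
  also have "\<dots> = emeasure N (padic_cyl n a)" by (rule sum[OF s(2), symmetric])
  finally show "emeasure M (padic_cyl n a) = emeasure N (padic_cyl n a)" .
qed

lemma funpow_image_subset:
  "f ` S \<subseteq> S \<Longrightarrow> x \<in> S \<Longrightarrow> (f ^^ k) x \<in> S"
  by (induction k) auto

text \<open>Isolates what the measure argument uses: f acts on residues at every level, and S is a
  union of residue classes at every level from m on.\<close>

locale padic_lipschitz_on =
  fixes f :: "'p::prime_card padic_int \<Rightarrow> 'p padic_int" and S :: "'p padic_int set" and m :: nat
  assumes lipschitz: "unif ^ n dvd x - y \<Longrightarrow> unif ^ n dvd f x - f y"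
    and saturated: "b \<in> S \<Longrightarrow> m \<le> n \<Longrightarrow> padic_ball n b \<subseteq> S"
    and nonempty: "S \<noteq> {}"
begin

abbreviation "haar \<equiv> padic_haar :: 'p padic_int measure"
abbreviation "\<mu> \<equiv> normalized_haar_on S"

lemma lipschitz_funpow: "unif ^ n dvd x - y \<Longrightarrow> unif ^ n dvd (f ^^ k) x - (f ^^ k) y"
  by (induction k) (auto intro: lipschitz)

lemma open_if_ball_subset:
  assumes "\<And>b. b \<in> A \<Longrightarrow> padic_ball n b \<subseteq> A"
  shows "open (A :: 'p padic_int set)"
proof -
  have "A = (\<Union>b\<in>A. padic_ball n b)" using assms by (auto simp: mem_padic_ball)
  moreover have "open (\<Union>b\<in>A. padic_ball n b)" by (intro open_UN ballI open_padic_cyl)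
  ultimately show ?thesis by metis
qed

lemma open_S: "open S"
  using saturated by (intro open_if_ball_subset[of _ m]) auto

lemma S_borel [measurable]: "S \<in> sets borel"
  using open_S by simp

lemma ball_borel [measurable]: "padic_ball n b \<in> sets (borel :: 'p padic_int measure)"
  by (simp add: open_padic_cyl)

lemma f_measurable [measurable]: "f \<in> borel_measurable borel"
proof (rule measurable_sigma_sets[OF sets_borel_padic])
  fix X :: "'p padic_int set" assume "X \<in> range (\<lambda>(n, a). padic_cyl n a)"
  then obtain n a where X: "X = padic_cyl n a" by auto
  have "open (f -` X)"
  proof (rule open_if_ball_subset)
    fix b assume "b \<in> f -` X"
    then show "padic_ball n b \<subseteq> f -` X"
      using lipschitz[of n _ b] unfolding X mem_padic_ball[symmetric] by (auto simp: padic_cyl_def)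
  qed
  then show "f -` X \<inter> space borel \<in> sets borel" by simp
qed auto

lemma haar_pos_if_ball_subset: "A \<in> sets borel \<Longrightarrow> padic_ball n b \<subseteq> A \<Longrightarrow> emeasure haar A > 0"
  using emeasure_mono[of "padic_ball n b" A haar] emeasure_padic_haar_ball_pos[of n b]
  by (simp add: less_le_trans)

lemma haar_S_pos: "emeasure haar S > 0"
proof -
  obtain b where "b \<in> S" using nonempty by blast
  then show ?thesis using saturated[of b m] by (intro haar_pos_if_ball_subset) auto
qed

lemma haar_divide_self: "emeasure haar A \<noteq> 0 \<Longrightarrow> emeasure haar A / emeasure haar A = 1"
  using emeasure_padic_haar_finite[of A] by (intro ennreal_divide_self) (auto simp: less_top)

lemma sets_\<mu>: "sets \<mu> = {A. A \<in> sets borel \<and> A \<subseteq> S}"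
  unfolding normalized_haar_on_def by (auto simp: sets_restrict_space_iff)

lemma space_\<mu>: "space \<mu> = S"
  by (simp add: normalized_haar_on_def space_scale_measure space_restrict_space)

lemma emeasure_\<mu>: "A \<in> sets borel \<Longrightarrow> A \<subseteq> S \<Longrightarrow> emeasure \<mu> A = emeasure haar A / emeasure haar S"
  unfolding normalized_haar_on_def
  by (simp add: emeasure_restrict_space divide_ennreal_def mult.commute)

lemma prob_space_\<mu>: "prob_space \<mu>"
proof (rule prob_spaceI)
  show "emeasure \<mu> (space \<mu>) = 1"
    using haar_S_pos haar_divide_self[of S] by (simp add: space_\<mu> emeasure_\<mu>)
qed

lemma f_measurable_\<mu>: "f \<in> measurable \<mu> borel"
  using f_measurable unfolding normalized_haar_on_def
  by (simp add: measurable_restrict_space1 cong: measurable_cong_sets)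

lemma f_measurable_\<mu>_\<mu>: "f ` S \<subseteq> S \<Longrightarrow> f \<in> measurable \<mu> \<mu>"
  using measurable_sets[OF f_measurable_\<mu>] by (intro measurableI) (auto simp: space_\<mu> sets_\<mu>)

text \<open>At each level S splits into finitely many balls of equal mass, so total mass 1 on S
  fixes the common value; a cylinder missing S is null. The lemma serves both for invariance of the
  measure and for ergodicity.\<close>

lemma measure_eqI_constant_on_balls:
  fixes M N :: "'p padic_int measure"
  assumes s: "sets M = sets borel" "sets N = sets borel" and p: "prob_space M" "prob_space N"
    and S: "emeasure M S = 1" "emeasure N S = 1"
    and M: "\<And>n a b. m \<le> n \<Longrightarrow> a \<in> S \<Longrightarrow> b \<in> S \<Longrightarrow> emeasure M (padic_ball n a) = emeasure M (padic_ball n b)"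
    and N: "\<And>n a b. m \<le> n \<Longrightarrow> a \<in> S \<Longrightarrow> b \<in> S \<Longrightarrow> emeasure N (padic_ball n a) = emeasure N (padic_ball n b)"
  shows "M = N"
proof (rule padic_measure_eqI_ge[OF s p(1)])
  fix n a assume n: "m \<le> n"
  define X where "X = (\<lambda>z. padic_res z n) ` S"
  have "X \<subseteq> {0..<int CARD('p) ^ n}" using padic_res_range[where 'p='p] by (auto simp: X_def)
  then have fin: "finite X" by (rule finite_subset) simp
  show "emeasure M (padic_cyl n a) = emeasure N (padic_cyl n a)"
  proof (cases "a \<in> X")
    case True
    have val: "emeasure L (padic_cyl n a) = 1 / of_nat (card X)"
      if s: "sets L = sets borel" and S: "emeasure L S = 1"
        and L: "\<And>b. b \<in> X \<Longrightarrow> emeasure L (padic_cyl n b) = emeasure L (padic_cyl n a)"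
      for L :: "'p padic_int measure"
    proof -
      have "S = (\<Union>b\<in>X. padic_cyl n b)"
      proof
        show "S \<subseteq> (\<Union>b\<in>X. padic_cyl n b)" unfolding X_def padic_cyl_def by blast
        show "(\<Union>b\<in>X. padic_cyl n b) \<subseteq> S" unfolding X_def using saturated[OF _ n] by blast
      qed
      then have "1 = emeasure L (\<Union>b\<in>X. padic_cyl n b)" using S by simp
      also have "\<dots> = (\<Sum>b\<in>X. emeasure L (padic_cyl n b))"
      proof (rule sum_emeasure[symmetric])
        show "padic_cyl n ` X \<subseteq> sets L" by (simp add: s image_subset_iff open_padic_cyl)
        show "disjoint_family_on (padic_cyl n :: _ \<Rightarrow> 'p padic_int set) X"
          unfolding disjoint_family_on_def padic_cyl_def by blast
      qed (rule fin)
      also have "\<dots> = (\<Sum>b\<in>X. emeasure L (padic_cyl n a))" by (intro sum.cong refl L)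
      also have "\<dots> = emeasure L (padic_cyl n a) * of_nat (card X)" by (simp add: mult.commute)
      finally have 1: "1 = emeasure L (padic_cyl n a) * of_nat (card X)" .
      have "(of_nat (card X) :: ennreal) \<noteq> 0" using True fin by auto
      then have "emeasure L (padic_cyl n a) * of_nat (card X) / of_nat (card X) = emeasure L (padic_cyl n a)"
        by (rule ennreal_mult_divide_eq) (rule ennreal_of_nat_neq_top)
      then show ?thesis by (simp only: 1[symmetric])
    qed
    have eqM: "emeasure M (padic_cyl n b) = emeasure M (padic_cyl n a)" if b: "b \<in> X" for b
    proof -
      obtain z where z: "b = padic_res z n" "z \<in> S" using b[unfolded X_def] by (rule imageE)
      obtain w where w: "a = padic_res w n" "w \<in> S" using True[unfolded X_def] by (rule imageE)
      show ?thesis unfolding z(1) w(1) by (rule M[OF n z(2) w(2)])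
    qed
    have eqN: "emeasure N (padic_cyl n b) = emeasure N (padic_cyl n a)" if b: "b \<in> X" for b
    proof -
      obtain z where z: "b = padic_res z n" "z \<in> S" using b[unfolded X_def] by (rule imageE)
      obtain w where w: "a = padic_res w n" "w \<in> S" using True[unfolded X_def] by (rule imageE)
      show ?thesis unfolding z(1) w(1) by (rule N[OF n z(2) w(2)])
    qed
    have "emeasure M (padic_cyl n a) = 1 / of_nat (card X)" using s(1) S(1) eqM by (rule val)
    moreover have "emeasure N (padic_cyl n a) = 1 / of_nat (card X)" using s(2) S(2) eqN by (rule val)
    ultimately show ?thesis by simp
  next
    case False
    have null: "emeasure L (padic_cyl n a) = 0"
      if s: "sets L = sets borel" and p: "prob_space L" and S: "emeasure L S = 1"
      for L :: "'p padic_int measure"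
    proof -
      have SL: "S \<in> sets L" unfolding s by (rule S_borel)
      have sp: "space L = UNIV" using sets_eq_imp_space_eq[OF s] by simp
      have "emeasure L (space L - S) = emeasure L (space L) - emeasure L S"
        by (rule emeasure_compl[OF SL]) (simp add: S)
      also have "\<dots> = 0" unfolding S prob_space.emeasure_space_1[OF p] by simp
      finally have "emeasure L (space L - S) = 0" .
      moreover have "padic_cyl n a \<subseteq> space L - S"
        using False unfolding sp X_def padic_cyl_def by blast
      ultimately show ?thesis using emeasure_mono[OF _ sets.compl_sets[OF SL]] by (metis le_zero_eq)
    qed
    show ?thesis unfolding null[OF s(1) p(1) S(1)] null[OF s(2) p(2) S(2)] ..
  qed
qed

text \<open>The Lipschitz condition makes \<open>F\<close> independent of the chosen
  representatives; a surjective self-map of the finite set of residues of S is injective.\<close>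

lemma residue_injective:
  assumes inv: "f ` S \<subseteq> S" and surj: "\<And>b. b \<in> S \<Longrightarrow> \<exists>a\<in>S. unif ^ n dvd f a - b"
    and xy: "x \<in> S" "y \<in> S" "unif ^ n dvd f x - f y"
  shows "unif ^ n dvd x - y"
proof -
  let ?r = "\<lambda>z. padic_res z n"
  define X where "X = ?r ` S"
  define F where "F c = ?r (f (inv_into S ?r c))" for c
  have F: "F (?r z) = ?r (f z)" if "z \<in> S" for z
  proof -
    have "?r (inv_into S ?r (?r z)) = ?r z" by (rule f_inv_into_f) (use that in blast)
    then show ?thesis using lipschitz[of n] unfolding F_def unif_dvd_diff_iff by blast
  qed
  have "X \<subseteq> {0..<int CARD('p) ^ n}" using padic_res_range[where 'p='p] by (auto simp: X_def)
  then have "finite X" by (rule finite_subset) simp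
  moreover have "X \<subseteq> F ` X"
  proof
    fix c assume "c \<in> X"
    then obtain b where "b \<in> S" "c = ?r b" by (auto simp: X_def)
    then obtain a where "a \<in> S" "?r (f a) = c" using surj[of b] unfolding unif_dvd_diff_iff by auto
    then have "c = F (?r a)" "?r a \<in> X" using F[of a] by (auto simp: X_def)
    then show "c \<in> F ` X" by (rule image_eqI)
  qed
  ultimately have "inj_on F X" by (rule finite_surj_inj)
  moreover have "F (?r x) = F (?r y)" using F xy unfolding unif_dvd_diff_iff by simp
  ultimately show ?thesis using xy unfolding unif_dvd_diff_iff X_def by (auto dest: inj_onD)
qed

text \<open>The set of points that visit the ball around a infinitely often is invariant and a union
  of balls, as is its complement in S. It contains a, so its mass is positive and therefore 1; the
  complement is null, and a null union of balls is empty.\<close>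

lemma ergodic_imp_transitive:
  assumes "padic_ergodic_on f S"
  shows "f ` S \<subseteq> S \<and> transitive_on_residues f S"
proof -
  have inv: "f ` S \<subseteq> S" and pres: "distr \<mu> \<mu> f = \<mu>"
    and erg: "\<And>A. A \<in> sets \<mu> \<Longrightarrow> f -` A \<inter> S = A \<Longrightarrow> emeasure \<mu> A \<in> {0, 1}"
    using assms unfolding padic_ergodic_on_def Let_def by blast+
  interpret prob_space \<mu> by (rule prob_space_\<mu>)
  have pos: "emeasure \<mu> A > 0" if "b \<in> S" "padic_ball n b \<subseteq> A" "A \<in> sets \<mu>" for A b n
    using that haar_pos_if_ball_subset[of A n b] emeasure_padic_haar_finite[of S] emeasure_\<mu>[of A]
    by (simp add: sets_\<mu> ennreal_zero_less_divide top.not_eq_extremum)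
  have fk: "(f ^^ k) x \<in> S" if "x \<in> S" for k x using funpow_image_subset[OF inv that] .
  have "\<exists>k. unif ^ n dvd (f ^^ k) b - a" if a: "a \<in> S" and b: "b \<in> S" and n: "m \<le> n" for a b n
  proof -
    \<comment> \<open>Asking for infinitely many visits, not just one, makes \<open>A\<close> invariant for every \<open>f\<close>.\<close>
    define A where "A = {z \<in> S. infinite {k. unif ^ n dvd (f ^^ k) z - a}}"
    have same: "{k. unif ^ n dvd (f ^^ k) z - a} = {k. unif ^ n dvd (f ^^ k) w - a}"
      if "z \<in> padic_ball n w" for z w
      using lipschitz_funpow[of n z w] that unfolding mem_padic_ball unif_dvd_diff_iff by simp
    have A_iff: "z \<in> A \<longleftrightarrow> w \<in> A" if z: "z \<in> padic_ball n w" "w \<in> S" for z w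
    proof -
      have "z \<in> S" using saturated[OF z(2) n] z(1) by (rule subsetD)
      then show ?thesis using z(2) by (simp add: A_def same[OF z(1)])
    qed
    have ballA: "padic_ball n w \<subseteq> A" if w: "w \<in> A" for w
      using A_iff[of _ w] w by (auto simp: A_def)
    have ballSA: "padic_ball n w \<subseteq> S - A" if w: "w \<in> S - A" for w
    proof -
      have "padic_ball n w \<subseteq> S" using w by (intro saturated[OF _ n]) simp
      then show ?thesis using A_iff[of _ w] w by auto
    qed
    have A: "A \<in> sets \<mu>"
      using open_if_ball_subset[OF ballA] by (auto simp: sets_\<mu> A_def)
    then have SA: "S - A \<in> sets \<mu>" by (auto simp: sets_\<mu>)
    have "f -` A \<inter> S = A"
    proof -
      have "infinite {k. unif ^ n dvd (f ^^ k) (f z) - a} \<longleftrightarrow> infinite {k. unif ^ n dvd (f ^^ k) z - a}" for z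
      proof -
        have "{k. unif ^ n dvd (f ^^ k) z - a} \<subseteq> insert 0 (Suc ` {k. unif ^ n dvd (f ^^ k) (f z) - a})"
        proof
          fix k assume k: "k \<in> {k. unif ^ n dvd (f ^^ k) z - a}"
          show "k \<in> insert 0 (Suc ` {k. unif ^ n dvd (f ^^ k) (f z) - a})"
            using k by (cases k) (auto simp: funpow_swap1)
        qed
        moreover have "Suc ` {k. unif ^ n dvd (f ^^ k) (f z) - a} \<subseteq> {k. unif ^ n dvd (f ^^ k) z - a}"
          by (auto simp: funpow_swap1)
        ultimately show ?thesis
          by (metis finite_imageD finite_imageI finite_insert finite_subset inj_Suc)
      qed
      then show ?thesis using inv unfolding A_def by blast
    qed
    then have A01: "emeasure \<mu> A = 0 \<or> emeasure \<mu> A = 1" using erg[OF A] by auto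

    \<comment> \<open>Invariance of the measure gives the preimage of every ball in S positive mass,
      so it is nonempty.\<close>
    have surj: "\<exists>c\<in>S. unif ^ n dvd f c - w" if w: "w \<in> S" for w
    proof -
      have wS: "padic_ball n w \<in> sets \<mu>" using saturated[OF w n] by (simp add: sets_\<mu>)
      have "0 < emeasure (distr \<mu> \<mu> f) (padic_ball n w)"
        unfolding pres using w wS by (intro pos) auto
      also have "\<dots> = emeasure \<mu> (f -` padic_ball n w \<inter> S)"
        using f_measurable_\<mu>_\<mu>[OF inv] wS by (subst emeasure_distr) (auto simp: space_\<mu>)
      finally have "f -` padic_ball n w \<inter> S \<noteq> {}" by (metis emeasure_empty less_irrefl)
      then show ?thesis by (auto simp: mem_padic_ball)
    qed
    have cancel: "unif ^ n dvd (f ^^ j) z - w" if "unif ^ n dvd (f ^^ (i + j)) z - (f ^^ i) w" "z \<in> S" "w \<in> S" for i j z w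
      using that(1)
    proof (induction i)
      case (Suc i)
      have "unif ^ n dvd (f ^^ (i + j)) z - (f ^^ i) w"
        by (rule residue_injective[OF inv surj fk fk]) (use Suc.prems that in auto)
      then show ?case by (rule Suc.IH)
    qed simp
    \<comment> \<open>The residues of the orbit of a repeat, and injectivity on residues cancels the
      initial segment: a itself recurs with period q, so it visits its own ball infinitely
      often.\<close>
    have "finite (range (\<lambda>k. padic_res ((f ^^ k) a) n))"
      by (rule finite_subset[of _ "{0..<int CARD('p) ^ n}"]) (use padic_res_range[where 'p='p] in auto)
    then have "\<not> inj (\<lambda>k. padic_res ((f ^^ k) a) n)" using finite_imageD infinite_UNIV_nat by blast
    then obtain i k where "i \<noteq> k" "padic_res ((f ^^ i) a) n = padic_res ((f ^^ k) a) n"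
      by (auto simp: inj_on_def)
    then obtain i k where ik: "i < k" "padic_res ((f ^^ i) a) n = padic_res ((f ^^ k) a) n"
      by (metis linorder_neqE_nat)
    define q where "q = k - i"
    have iq: "i + q = k" and q0: "q > 0" using ik(1) by (auto simp: q_def)
    have "unif ^ n dvd (f ^^ (i + q)) a - (f ^^ i) a" unfolding iq unif_dvd_diff_iff by (simp only: ik(2))
    then have q: "unif ^ n dvd (f ^^ q) a - a" using a a by (rule cancel)
    have "unif ^ n dvd (f ^^ (q * j)) a - a" for j
    proof (induction j)
      case (Suc j)
      have "unif ^ n dvd (f ^^ q) ((f ^^ (q * j)) a) - (f ^^ q) a" by (rule lipschitz_funpow[OF Suc])
      then have "unif ^ n dvd ((f ^^ q) ((f ^^ (q * j)) a) - (f ^^ q) a) + ((f ^^ q) a - a)"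
        using q by (rule dvd_add)
      then show ?case by (simp add: funpow_add)
    qed simp
    then have "range (\<lambda>j. q * j) \<subseteq> {k. unif ^ n dvd (f ^^ k) a - a}" by blast
    moreover have "infinite (range (\<lambda>j. q * j))"
      using q0 by (intro range_inj_infinite) (auto simp: inj_on_def)
    ultimately have "infinite {k. unif ^ n dvd (f ^^ k) a - a}" by (rule infinite_super)
    then have "a \<in> A" using a by (simp add: A_def)
    then have "emeasure \<mu> A > 0" using a ballA A by (intro pos[of a n]) auto
    then have "emeasure \<mu> A = 1" using A01 by auto
    then have "emeasure \<mu> (S - A) = 0"
      using emeasure_compl[OF A] emeasure_space_1 by (simp add: space_\<mu>)
    then have "S - A = {}" using pos[of _ n "S - A"] ballSA SA by fastforce
    then have "b \<in> A" using b by blast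
    then have "{k. unif ^ n dvd (f ^^ k) b - a} \<noteq> {}" unfolding A_def by fastforce
    then show ?thesis by blast
  qed
  then have "\<exists>k. unif ^ n dvd (f ^^ k) b - a" if "a \<in> S" "b \<in> S" for a b n
    using that by (metis max.cobounded1 max.cobounded2 power_le_dvd)
  then show ?thesis using inv unfolding transitive_on_residues_def by blast
qed

text \<open>Transitivity makes f a permutation of the residues of S, so the preimage in S of a small
  ball is one ball of the same radius. For an invariant A, the mass of A in a ball is therefore
  constant along orbits of balls, and these orbits exhaust S.\<close>

lemma transitive_imp_ergodic:
  assumes inv: "f ` S \<subseteq> S" and tr: "transitive_on_residues f S"
  shows "padic_ergodic_on f S"
proof -
  interpret prob_space \<mu> by (rule prob_space_\<mu>)
  have fk: "(f ^^ k) x \<in> S" if "x \<in> S" for k x using funpow_image_subset[OF inv that] .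
  have fS: "f x \<in> S" if "x \<in> S" for x using inv that by blast
  have reach: "\<exists>k. unif ^ n dvd (f ^^ k) a - b" if "a \<in> S" "b \<in> S" for a b n
    using tr that unfolding transitive_on_residues_def by blast
  have surj: "\<exists>a\<in>S. unif ^ n dvd f a - b" if b: "b \<in> S" for b n
  proof -
    \<comment> \<open>Starting at f b rather than b guarantees one application of f, since k may be
      0.\<close>
    obtain k where k: "unif ^ n dvd (f ^^ k) (f b) - b" using reach[OF fS[OF b] b] by blast
    have "unif ^ n dvd f ((f ^^ k) b) - b" using k by (simp only: funpow_swap1)
    then show ?thesis using fk[OF b] by blast
  qed
  have pre: "f -` padic_ball n (f a) \<inter> S = padic_ball n a" if a: "a \<in> S" "m \<le> n" for a n
  proof
    show "f -` padic_ball n (f a) \<inter> S \<subseteq> padic_ball n a"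
    proof
      fix x assume "x \<in> f -` padic_ball n (f a) \<inter> S"
      then have "x \<in> S" "unif ^ n dvd f x - f a" by (simp_all flip: mem_padic_ball)
      then show "x \<in> padic_ball n a"
        unfolding mem_padic_ball using residue_injective[OF inv surj _ a(1)] by blast
    qed
    show "padic_ball n a \<subseteq> f -` padic_ball n (f a) \<inter> S"
    proof
      fix x assume x: "x \<in> padic_ball n a"
      then have "unif ^ n dvd f x - f a" unfolding mem_padic_ball by (rule lipschitz)
      moreover have "x \<in> S" using saturated[OF a] x by (rule subsetD)
      ultimately show "x \<in> f -` padic_ball n (f a) \<inter> S" by (simp flip: mem_padic_ball)
    qed
  qed
  have ball_\<mu>: "padic_ball n b \<in> sets \<mu>" if "b \<in> S" "m \<le> n" for b n
    using saturated[OF that] by (simp add: sets_\<mu>)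
  \<comment> \<open>The measure lives on S only; pushing it forward along the identity to the Borel
    sets of \<int>_p makes the comparison on balls applicable.\<close>
  have id_\<mu>: "(\<lambda>x. x) \<in> measurable \<mu> borel"
    by (intro measurableI) (auto simp: sets_\<mu> space_\<mu>)
  have "distr \<mu> borel f = distr \<mu> borel (\<lambda>x. x)"
  proof (rule measure_eqI_constant_on_balls)
    show "prob_space (distr \<mu> borel f)" by (rule prob_space_distr[OF f_measurable_\<mu>])
    show "prob_space (distr \<mu> borel (\<lambda>x. x))" by (rule prob_space_distr[OF id_\<mu>])
    have "f -` S \<inter> S = S" using inv by blast
    then show "emeasure (distr \<mu> borel f) S = 1" "emeasure (distr \<mu> borel (\<lambda>x. x)) S = 1"
      using f_measurable_\<mu> id_\<mu> emeasure_space_1 by (simp_all add: emeasure_distr space_\<mu>)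
  next
    fix n a b assume n: "m \<le> n" and ab: "a \<in> S" "b \<in> S"
    have val: "emeasure \<mu> (padic_ball n c) = 1 / of_nat (CARD('p) ^ n) / emeasure haar S" if "c \<in> S" for c
      using saturated[OF that n] by (simp only: emeasure_\<mu> ball_borel emeasure_padic_haar_ball)
    have "padic_ball n c \<inter> S = padic_ball n c" if "c \<in> S" for c using saturated[OF that n] by blast
    then show "emeasure (distr \<mu> borel (\<lambda>x. x)) (padic_ball n a) = emeasure (distr \<mu> borel (\<lambda>x. x)) (padic_ball n b)"
      using id_\<mu> ab val by (simp add: emeasure_distr space_\<mu>)
    have "emeasure (distr \<mu> borel f) (padic_ball n c) = 1 / of_nat (CARD('p) ^ n) / emeasure haar S" if c: "c \<in> S" for c
    proof -
      obtain c' where c': "c' \<in> S" "unif ^ n dvd f c' - c" using surj[OF c] by blast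
      then have "padic_ball n c = padic_ball n (f c')" unfolding unif_dvd_diff_iff by simp
      then have "f -` padic_ball n c \<inter> S = padic_ball n c'" using pre[OF c'(1) n] by simp
      then show ?thesis using f_measurable_\<mu> val[OF c'(1)] by (simp add: emeasure_distr space_\<mu>)
    qed
    then show "emeasure (distr \<mu> borel f) (padic_ball n a) = emeasure (distr \<mu> borel f) (padic_ball n b)"
      using ab by simp
  qed simp_all
  then have pres: "emeasure \<mu> (f -` B \<inter> S) = emeasure \<mu> B" if "B \<in> sets \<mu>" for B
  proof -
    assume eq: "distr \<mu> borel f = distr \<mu> borel (\<lambda>x. x)"
    have B: "B \<in> sets borel" "B \<inter> S = B" using that by (auto simp: sets_\<mu>)
    have "emeasure (distr \<mu> borel f) B = emeasure (distr \<mu> borel (\<lambda>x. x)) B" by (simp only: eq)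
    then show ?thesis using f_measurable_\<mu> id_\<mu> B by (simp add: emeasure_distr space_\<mu>)
  qed
  have distr: "distr \<mu> \<mu> f = \<mu>"
  proof (rule measure_eqI)
    fix B assume "B \<in> sets (distr \<mu> \<mu> f)"
    then show "emeasure (distr \<mu> \<mu> f) B = emeasure \<mu> B"
      using f_measurable_\<mu>_\<mu>[OF inv] pres[of B] by (simp add: emeasure_distr space_\<mu>)
  qed simp
  have "emeasure \<mu> A = 1" if A: "A \<in> sets \<mu>" and invA: "f -` A \<inter> S = A" and nz: "emeasure \<mu> A \<noteq> 0" for A
  proof -
    have A': "A \<in> sets borel" "A \<subseteq> S" using A by (auto simp: sets_\<mu>)
    have SA: "S \<inter> A = A" "A \<inter> S = A" using A' by auto
    have A0: "emeasure haar A \<noteq> 0" using nz A' by (auto simp: emeasure_\<mu>)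
    have step: "emeasure haar (A \<inter> padic_ball n (f c)) = emeasure haar (A \<inter> padic_ball n c)"
      if c: "c \<in> S" "m \<le> n" for c n
    proof -
      have "f -` (A \<inter> padic_ball n (f c)) \<inter> S = A \<inter> padic_ball n c"
        using invA pre[OF c] by blast
      moreover have "A \<inter> padic_ball n (f c) \<in> sets \<mu>" using A' by (auto simp: sets_\<mu>)
      ultimately have "emeasure \<mu> (A \<inter> padic_ball n c) = emeasure \<mu> (A \<inter> padic_ball n (f c))"
        using pres by metis
      then have "emeasure haar (A \<inter> padic_ball n c) / emeasure haar S * emeasure haar S
          = emeasure haar (A \<inter> padic_ball n (f c)) / emeasure haar S * emeasure haar S"
        using A' by (simp add: emeasure_\<mu> le_infI1)
      then show ?thesis using haar_divide_self[of S] haar_S_pos by (simp add: ennreal_divide_times)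
    qed
    have iter: "emeasure haar (A \<inter> padic_ball n ((f ^^ k) c)) = emeasure haar (A \<inter> padic_ball n c)"
      if "c \<in> S" "m \<le> n" for c n k
      by (induction k) (use step fk that in auto)
    have const: "emeasure haar (A \<inter> padic_ball n a) = emeasure haar (A \<inter> padic_ball n b)"
      if n: "m \<le> n" and ab: "a \<in> S" "b \<in> S" for n a b
    proof -
      obtain k where "unif ^ n dvd (f ^^ k) a - b" using reach[OF ab] by blast
      then have "padic_ball n ((f ^^ k) a) = padic_ball n b" unfolding unif_dvd_diff_iff by simp
      then show ?thesis using iter[OF ab(1) n, of k] by simp
    qed
    \<comment> \<open>\<open>A\<close> has the same mass in all balls of \<open>S\<close> of a given radius, so conditioning on \<open>A\<close> or on \<open>S\<close>
      gives the same measure.\<close>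
    have "uniform_measure haar A = uniform_measure haar S"
    proof (rule measure_eqI_constant_on_balls)
      show "prob_space (uniform_measure haar A)" "prob_space (uniform_measure haar S)"
        using A0 haar_S_pos emeasure_padic_haar_finite[where 'p='p] by (auto intro!: prob_space_uniform_measure)
      show "emeasure (uniform_measure haar A) S = 1" "emeasure (uniform_measure haar S) S = 1"
        using A0 haar_S_pos haar_divide_self[of S] haar_divide_self[of A] A'(1) by (simp_all add: SA)
      fix n a b assume n: "m \<le> n" and ab: "a \<in> S" "b \<in> S"
      show "emeasure (uniform_measure haar A) (padic_ball n a) = emeasure (uniform_measure haar A) (padic_ball n b)"
        using const[OF n ab] A'(1) by simp
      have "S \<inter> padic_ball n c = padic_ball n c" if "c \<in> S" for c using saturated[OF that n] by blast
      then show "emeasure (uniform_measure haar S) (padic_ball n a) = emeasure (uniform_measure haar S) (padic_ball n b)"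
        using ab by (simp add: emeasure_padic_haar_ball)
    qed simp_all
    then have "emeasure (uniform_measure haar A) A = emeasure (uniform_measure haar S) A" by simp
    then show ?thesis using A0 haar_divide_self[of A] A' by (simp add: SA emeasure_\<mu>)
  qed
  then show ?thesis
    unfolding padic_ergodic_on_def Let_def using inv f_measurable_\<mu>_\<mu>[OF inv] distr by auto
qed

lemma ergodic_iff_transitive: "padic_ergodic_on f S \<longleftrightarrow> f ` S \<subseteq> S \<and> transitive_on_residues f S"
  using ergodic_imp_transitive transitive_imp_ergodic by blast

end

section \<open>Rescaling the sphere\<close>

text \<open>The congruence at y is what makes the quotient (f (y + p^r u) - y) / p^r a p-adic
  integer.\<close>

lemma class_B_rescale:
  fixes f :: "'p::prime_card padic_int \<Rightarrow> 'p padic_int"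
  assumes f: "f \<in> class_B" and y: "unif ^ r dvd f y - y"
  obtains g c where "\<And>u. f (y + unif ^ r * u) = y + unif ^ r * g u"
    "near_affine r (padic_deriv f y) g"
    "\<And>u. unif ^ (2 * r) dvd g u - g 0 - padic_deriv f y * u - c * unif ^ r * u ^ 2"
proof -
  have "\<exists>v. f (y + unif ^ r * u) = y + unif ^ r * v" for u
  proof -
    have "unif ^ r dvd (f (y + unif ^ r * u) - f y) + (f y - y)"
      by (intro dvd_add class_B_increment(2)[OF f] y) simp
    then obtain v where "f (y + unif ^ r * u) - y = unif ^ r * v" by (auto simp: dvd_def)
    then have "f (y + unif ^ r * u) = y + unif ^ r * v" by (simp add: algebra_simps)
    then show ?thesis by blast
  qed
  then obtain g where g: "\<And>u. f (y + unif ^ r * u) = y + unif ^ r * g u" by metis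
  have fy: "f y = y + unif ^ r * g 0" using g[of 0] by simp
  have "near_affine r (padic_deriv f y) g"
    unfolding near_affine_def
  proof (intro exI[of _ "\<lambda>u. padic_deriv f (y + unif ^ r * u)"] allI conjI impI)
    fix u
    show "unif ^ r dvd padic_deriv f (y + unif ^ r * u) - padic_deriv f y"
      by (rule class_B_taylor(2)[OF f]) simp
    fix m h assume "unif ^ m dvd (h :: 'p padic_int)"
    then have "unif ^ (r + m) dvd unif ^ r * h" by (simp add: power_add mult_dvd_mono)
    then have "unif ^ (2 * (r + m)) dvd f (y + unif ^ r * u + unif ^ r * h) - f (y + unif ^ r * u)
        - padic_deriv f (y + unif ^ r * u) * (unif ^ r * h)"
      by (rule class_B_increment(1)[OF f])
    moreover have "f (y + unif ^ r * u + unif ^ r * h) = y + unif ^ r * g (u + h)"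
      using g[of "u + h"] by (simp add: algebra_simps)
    moreover have "2 * (r + m) = r + (r + 2 * m)" by simp
    ultimately have "unif ^ r * unif ^ (r + 2 * m) dvd
        unif ^ r * (g (u + h) - g u - padic_deriv f (y + unif ^ r * u) * h)"
      unfolding g by (simp only: power_add[symmetric]) (simp add: algebra_simps)
    then show "unif ^ (r + 2 * m) dvd g (u + h) - g u - padic_deriv f (y + unif ^ r * u) * h"
      by simp
  qed
  \<comment> \<open>At precision 3 r the cubic term vanishes. Division by p^r leaves 2 r, which
    reaches p^2 when r is at least 1 and 8 when p = 2 and r is at least 2.\<close>
  moreover obtain c where c: "\<And>h. \<exists>e. unif ^ (3 * r) dvd f (y + h) - f y - padic_deriv f y * h - c * h ^ 2 - e * h ^ 3"
    using class_B_taylor(1)[OF f, of "3 * r" y] by blast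
  have "unif ^ (2 * r) dvd g u - g 0 - padic_deriv f y * u - c * unif ^ r * u ^ 2" for u
  proof -
    obtain e where e: "unif ^ (3 * r) dvd f (y + unif ^ r * u) - f y - padic_deriv f y * (unif ^ r * u)
        - c * (unif ^ r * u) ^ 2 - e * (unif ^ r * u) ^ 3"
      using c by blast
    have "unif ^ (3 * r) dvd (unif ^ r * u) ^ 3"
      by (simp add: power_mult_distrib power_mult[symmetric] mult.commute)
    then have "unif ^ (3 * r) dvd (f (y + unif ^ r * u) - f y - padic_deriv f y * (unif ^ r * u)
        - c * (unif ^ r * u) ^ 2 - e * (unif ^ r * u) ^ 3) + e * (unif ^ r * u) ^ 3"
      by (intro dvd_add[OF e] dvd_mult)
    also have "\<dots> = unif ^ r * (g u - g 0 - padic_deriv f y * u - c * unif ^ r * u ^ 2)"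
      unfolding g fy by (simp add: algebra_simps power2_eq_square)
    finally have "unif ^ r * unif ^ (2 * r) dvd unif ^ r * (g u - g 0 - padic_deriv f y * u - c * unif ^ r * u ^ 2)"
      by (simp only: power_add[symmetric]) simp
    then show ?thesis by simp
  qed
  ultimately show ?thesis using that g by blast
qed

text \<open>The map u |-> y + p^r u conjugates g to f. Its scaling factor costs r digits of
  precision, which is harmless because every precision is demanded.\<close>

lemma transitive_on_sphere_iff:
  fixes f :: "'p::prime_card padic_int \<Rightarrow> 'p padic_int"
  assumes g: "\<And>u. f (y + unif ^ r * u) = y + unif ^ r * g u"
  defines "S \<equiv> sphere y (1 / real CARD('p) ^ r)"
  shows "f ` S \<subseteq> S \<and> transitive_on_residues f S \<longleftrightarrow>
    g ` units_padic \<subseteq> units_padic \<and> transitive_on_residues g units_padic"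
proof -
  define \<phi> where "\<phi> u = y + unif ^ r * u" for u
  have S: "S = \<phi> ` units_padic" unfolding S_def \<phi>_def by (rule padic_sphere_eq)
  have inj: "\<phi> u = \<phi> v \<longleftrightarrow> u = v" for u v by (simp add: \<phi>_def)
  have f\<phi>: "f (\<phi> u) = \<phi> (g u)" for u using g by (simp add: \<phi>_def)
  have fk: "(f ^^ k) (\<phi> u) = \<phi> ((g ^^ k) u)" for k u by (induction k) (auto simp: f\<phi>)
  have "f ` S \<subseteq> S \<longleftrightarrow> g ` units_padic \<subseteq> units_padic"
    unfolding S image_image f\<phi> image_subset_iff by (simp add: inj image_iff)
  moreover have "transitive_on_residues f S \<longleftrightarrow>
     (\<forall>a\<in>units_padic. \<forall>b\<in>units_padic. \<forall>n. \<exists>k. unif ^ n dvd unif ^ r * ((g ^^ k) a - b))"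
    unfolding transitive_on_residues_def S by (simp add: fk) (simp add: \<phi>_def algebra_simps)
  moreover have "\<dots> \<longleftrightarrow> transitive_on_residues g units_padic"
    unfolding transitive_on_residues_def
  proof (intro iffI ballI allI)
    fix a b :: "'p padic_int" and n
    assume *: "\<forall>a\<in>units_padic. \<forall>b\<in>units_padic. \<forall>n. \<exists>k. unif ^ n dvd unif ^ r * ((g ^^ k) a - b)"
      and ab: "a \<in> units_padic" "b \<in> units_padic"
    obtain k where "unif ^ (r + n) dvd unif ^ r * ((g ^^ k) a - b)"
      using *[rule_format, OF ab] by blast
    then have "unif ^ n dvd (g ^^ k) a - b" by (simp add: power_add)
    then show "\<exists>k. unif ^ n dvd (g ^^ k) a - b" by blast
  next
    fix a b :: "'p padic_int" and n
    assume *: "\<forall>a\<in>units_padic. \<forall>b\<in>units_padic. \<forall>n. \<exists>k. unif ^ n dvd (g ^^ k) a - b"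
      and ab: "a \<in> units_padic" "b \<in> units_padic"
    obtain k where "unif ^ n dvd (g ^^ k) a - b"
      using *[rule_format, OF ab] by blast
    then have "unif ^ n dvd unif ^ r * ((g ^^ k) a - b)" by (rule dvd_mult)
    then show "\<exists>k. unif ^ n dvd unif ^ r * ((g ^^ k) a - b)" by blast
  qed
  ultimately show ?thesis by blast
qed

lemma class_B_ergodic_on_sphere_iff:
  fixes f :: "'p::prime_card padic_int \<Rightarrow> 'p padic_int" and y :: "'p padic_int" and r :: nat
  assumes f: "f \<in> class_B"
  defines "S \<equiv> sphere y (1 / real CARD('p) ^ r)"
  shows "padic_ergodic_on f S \<longleftrightarrow> f ` S \<subseteq> S \<and> transitive_on_residues f S"
proof -
  \<comment> \<open>Membership in the sphere is decided modulo p^(r + 1), hence the level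
    \<open>Suc r\<close>.\<close>
  have "padic_lipschitz_on f S (Suc r)"
  proof
    fix n and x z :: "'p padic_int" assume "unif ^ n dvd x - z"
    then show "unif ^ n dvd f x - f z" using class_B_increment(2)[OF f, of n "x - z" z] by simp
  next
    fix b :: "'p padic_int" and n assume b: "b \<in> S" "Suc r \<le> n"
    show "padic_ball n b \<subseteq> S"
    proof
      fix x assume "x \<in> padic_ball n b"
      then have "unif ^ n dvd x - b" by (simp only: mem_padic_ball)
      then have "unif ^ k dvd x - y \<longleftrightarrow> unif ^ k dvd b - y" if "k \<le> Suc r" for k
        using that b(2) dvd_add_right_iff[of "unif ^ k" "x - b" "b - y"] power_le_dvd[of unif n "x - b" k] by simp
      then show "x \<in> S" using b(1) unfolding S_def mem_padic_sphere_iff by (metis le_SucI order_refl)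
    qed
  next
    have "\<not> unif dvd (1 :: 'p padic_int)" by (rule unif_not_dvd_one)
    then show "S \<noteq> {}" unfolding S_def padic_sphere_eq by blast
  qed
  then show ?thesis by (rule padic_lipschitz_on.ergodic_iff_transitive)
qed

text \<open>The images of y and of y + p^r differ by a multiple of p^r, and the latter image lies on
  the sphere. Ergodicity thus supplies the congruence that rescaling requires.\<close>

lemma class_B_sphere_invariant_imp:
  fixes f :: "'p::prime_card padic_int \<Rightarrow> 'p padic_int" and y :: "'p padic_int"
  assumes f: "f \<in> class_B" and inv: "f ` sphere y (1 / real CARD('p) ^ r) \<subseteq> sphere y (1 / real CARD('p) ^ r)"
  shows "unif ^ r dvd f y - y"
proof -
  have "\<not> unif dvd (1 :: 'p padic_int)" by (rule unif_not_dvd_one)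
  then have "y + unif ^ r * 1 \<in> sphere y (1 / real CARD('p) ^ r)" unfolding padic_sphere_eq by blast
  then have "f (y + unif ^ r * 1) \<in> sphere y (1 / real CARD('p) ^ r)" using inv by blast
  then have "unif ^ r dvd f (y + unif ^ r * 1) - y" unfolding mem_padic_sphere_iff by simp
  moreover have "unif ^ r dvd f (y + unif ^ r * 1) - f y" by (rule class_B_increment(2)[OF f]) simp
  ultimately have "unif ^ r dvd (f (y + unif ^ r * 1) - y) - (f (y + unif ^ r * 1) - f y)" by (rule dvd_diff)
  then show ?thesis by simp
qed

theorem theorem5p7:
  fixes f :: "'p::prime_card padic_int \<Rightarrow> 'p padic_int" and y :: "'p padic_int"
    and p r :: nat
  assumes "p = CARD('p)"
    and "f \<in> class_B"
    and "p > 3 \<longrightarrow> r \<ge> 1" and "p \<le> 3 \<longrightarrow> r \<ge> 2"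
  shows "padic_ergodic_on f (sphere y (1 / real p ^ r)) \<longleftrightarrow>
      (odd p \<and> of_nat p ^ (r + 1) dvd f y - y \<and>
        generate (units_of (residue_ring (int p ^ 2))) {padic_res (padic_deriv f y) 2}
          = carrier (units_of (residue_ring (int p ^ 2)))) \<or>
      (p = 2 \<and> 2 ^ (r + 1) dvd f y - y \<and> \<not> 2 ^ (r + 2) dvd f y - y \<and>
        4 dvd padic_deriv f y - 1)"
proof (cases "unif ^ r dvd f y - y")
  case False
  have "\<not> f ` sphere y (1 / real p ^ r) \<subseteq> sphere y (1 / real p ^ r)"
    using False class_B_sphere_invariant_imp[OF \<open>f \<in> class_B\<close>] unfolding \<open>p = CARD('p)\<close> by blast
  then have "\<not> padic_ergodic_on f (sphere y (1 / real p ^ r))"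
    unfolding padic_ergodic_on_def Let_def by simp
  moreover have "\<not> of_nat p ^ (r + 1) dvd f y - y"
    using False unfolding \<open>p = CARD('p)\<close> by (meson le_add1 power_le_dvd)
  moreover have "\<not> (p = 2 \<and> 2 ^ (r + 1) dvd f y - y)"
    using \<open>\<not> of_nat p ^ (r + 1) dvd f y - y\<close> by auto
  ultimately show ?thesis by blast
next
  case True
  define d where "d = padic_deriv f y"
  obtain g c where g: "\<And>u. f (y + unif ^ r * u) = y + unif ^ r * g u"
    and aff: "near_affine r d g"
    and quad: "\<And>u. unif ^ (2 * r) dvd g u - g 0 - d * u - c * unif ^ r * u ^ 2"
    using class_B_rescale[OF \<open>f \<in> class_B\<close> True] unfolding d_def by blast
  have "f y - y = unif ^ r * g 0" using g[of 0] by simp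
  then have g0: "unif ^ (r + k) dvd f y - y \<longleftrightarrow> unif ^ k dvd g 0" for k
    by (simp add: power_add)
  have erg: "padic_ergodic_on f (sphere y (1 / real p ^ r)) \<longleftrightarrow>
      g ` units_padic \<subseteq> units_padic \<and> transitive_on_residues g units_padic"
    unfolding \<open>p = CARD('p)\<close> class_B_ergodic_on_sphere_iff[OF \<open>f \<in> class_B\<close>]
    by (rule transitive_on_sphere_iff) (rule g)
  have r1: "r \<ge> 1" using assms(3,4) by linarith
  show ?thesis
  proof (cases "odd p")
    case odd: True
    \<comment> \<open>One factor p is split off c p^r to match the odd criterion; the quadratic term
      can be nonzero modulo p^2 only for r = 1.\<close>
    have quad2: "unif ^ 2 dvd g u - g 0 - d * u - unif * (c * unif ^ (r - 1)) * u ^ 2" for u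
    proof -
      have "unif * (c * unif ^ (r - 1)) = c * unif ^ r"
        using r1 by (simp add: power_eq_if[of _ r] mult.left_commute)
      then show ?thesis using power_le_dvd[OF quad[of u], of 2] r1 by (simp only:)
    qed
    have odd': "odd CARD('p)" using odd \<open>p = CARD('p)\<close> by simp
    have "padic_ergodic_on f (sphere y (1 / real p ^ r)) \<longleftrightarrow>
        unif dvd g 0 \<and> \<not> unif dvd d \<and> orbit_covers (\<lambda>u. d * u) 2"
      unfolding erg by (rule transitive_on_units_iff_odd[OF odd' aff r1 quad2])
    moreover have "p \<noteq> 2" using odd by auto
    ultimately show ?thesis
      using odd g0[of 1] generate_units_iff[OF odd', of d] unfolding \<open>p = CARD('p)\<close> d_def by simp
  next
    case False
    have "prime p" unfolding \<open>p = CARD('p)\<close> by (rule prime_card)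
    then have p2: "p = 2" using False primes_dvd_imp_eq[of 2 p] by auto
    then have two: "CARD('p) = 2" using \<open>p = CARD('p)\<close> by simp
    have r2: "r \<ge> 2" using assms(4) p2 by simp
    \<comment> \<open>Here r is at least 2, so 4 can be split off 2^r, and 2 r is at least 3, so the
      remainder is a multiple of 8.\<close>
    have "8 dvd g u - g 0 - d * u - 4 * (c * 2 ^ (r - 2)) * u ^ 2" for u
    proof -
      have "(2 :: 'p padic_int) ^ r = 2 ^ 2 * 2 ^ (r - 2)"
        by (simp only: power_add[symmetric] le_add_diff_inverse[OF r2])
      then have eq: "4 * (c * 2 ^ (r - 2)) = c * 2 ^ r" by simp
      have "unif ^ 3 dvd g u - g 0 - d * u - c * unif ^ r * u ^ 2"
        by (rule power_le_dvd[OF quad]) (use r2 in simp)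
      then show ?thesis unfolding eq by (simp add: two)
    qed
    then have "padic_ergodic_on f (sphere y (1 / real p ^ r)) \<longleftrightarrow>
        2 dvd g 0 \<and> \<not> 4 dvd g 0 \<and> 4 dvd d - 1"
      unfolding erg by (rule transitive_on_units_iff_two[OF two aff r2])
    then show ?thesis using g0[of 1] g0[of 2] p2 by (simp add: two d_def)
  qed
qed

end
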